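(* Let $\Sigma=\{a,b,c,e\}$ with $e$ neutral, and let $L_{ab}$ be the language of words $u\in\Sigma^*$ such that (1) deleting all $e$'s from $u$ yields exactly $ab$, or (2) $|u|_a\ge 3$, or (3) $|u|_b\ge3$. Let $L_3$ be the language of words $w\in\Sigma^*$ with $|w|_c\ge1$ and $w_{-\{c\}}\in L_{ab}$. Then $L_3$ is a ZG language that is not semi-extensible ZG, and, assuming the prefix-$U_1$ hypothesis, $L_3$ is not tractable.
   Context: $|u|_x$ is the number of occurrences of $x$ in $u$; $w_{-\{c\}}$ is $w$ with all $c$'s deleted. A letter $e$ is neutral for $L$ if $st\in L\Leftrightarrow set\in L$ for all words $s,t$. The syntactic monoid $M$ of $L$ is $\Sigma^*$ quotiented by $u\sim_L v$ iff ($sut\in L\Leftrightarrow svt\in L$ for all $s,t$); $\omega$ is its idempotent power. $L$ is ZG if $yx^{\omega+1}=x^{\omega+1}y$ for all $x,y\in M$; $L$ is semi-extensible ZG if it is ZG and for all words $x,y,z$ and every non-neutral letter $a$, $y\in L$ implies $xyza^\omega\in L$. For $w=a_1\cdots a_n$, an $L$-infix is a pair $[i,j]$ with $1\le i\le j\le n$ and $a_i\cdots a_j\in L$. $L$ is tractable if there is a data structure built on an input word $w$ supporting letter substitution updates (replace the $i$-th letter by a given letter) and enumeration queries (output every $L$-infix of the current word exactly once, any order), and a constant $B$ depending only on $L$ such that for every $w$: each update takes at most $B$ steps; during enumeration the next $L$-infix (or the conclusion that none remain) is produced within $B$ steps; enumeration uses at most $B$ additional memory cells, previous memory read-only; building takes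 at most $B|w|$ steps and memory never exceeds $B|w|$ cells. Model: unit-cost RAM with logarithmic cell size. The prefix-$U_1$ problem: maintain $S\subseteq\{1,\dots,n\}$ supporting, on input $i\le n$, (1) test $i\in S$, (2) insert $i$, (3) remove $i$, (4) return yes iff $i\le\min S$; the prefix-$U_1$ hypothesis states no data structure does all of these in time independent of $n$ in that model. *)

theory Defs
  imports Main
begin

datatype sym = A | B | C | E

definition wpow :: "'a list \<Rightarrow> nat \<Rightarrow> 'a list" where
  "wpow x k = concat (replicate k x)"

definition synt_eq :: "'a list set \<Rightarrow> 'a list \<Rightarrow> 'a list \<Rightarrow> bool" where
  "synt_eq L u v \<longleftrightarrow> (\<forall>s t. s @ u @ t \<in> L \<longleftrightarrow> s @ v @ t \<in> L)"

text \<open>The idempotent power omega of the class of x in the syntactic monoid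
  (least positive k with [x]^k idempotent; it exists whenever the monoid is finite).\<close>
definition omega :: "'a list set \<Rightarrow> 'a list \<Rightarrow> nat" where
  "omega L x = (LEAST k. 1 \<le> k \<and> synt_eq L (wpow x k @ wpow x k) (wpow x k))"

definition neutral :: "'a list set \<Rightarrow> 'a \<Rightarrow> bool" where
  "neutral L e \<longleftrightarrow> (\<forall>s t. s @ t \<in> L \<longleftrightarrow> s @ [e] @ t \<in> L)"

definition ZG :: "'a list set \<Rightarrow> bool" where
  "ZG L \<longleftrightarrow> (\<forall>x y. synt_eq L (y @ wpow x (omega L x + 1)) (wpow x (omega L x + 1) @ y))"

definition semi_ext_ZG :: "'a list set \<Rightarrow> bool" where
  "semi_ext_ZG L \<longleftrightarrow> ZG L \<and>
     (\<forall>x y z a. \<not> neutral L a \<longrightarrow> y \<in> L \<longrightarrow> x @ y @ z @ wpow [a] (omega L [a]) \<in> L)"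

definition L_ab :: "sym list set" where
  "L_ab = {u. filter (\<lambda>x. x \<noteq> E) u = [A, B] \<or> count_list u A \<ge> 3 \<or> count_list u B \<ge> 3}"

definition L3 :: "sym list set" where
  "L3 = {w. count_list w C \<ge> 1 \<and> filter (\<lambda>x. x \<noteq> C) w \<in> L_ab}"

text \<open>For an instance of size n,
  every value stored and every address used must be below (n+2)^K, where K is a constant
  of the data structure (cells of O(log n) bits).\<close>

datatype instr =
    Const nat nat
  | Add nat nat nat
  | Sub nat nat nat        (* truncated subtraction *)
  | Mul nat nat nat
  | Div nat nat nat
  | Mod nat nat nat
  | Load nat nat
  | Store nat nat
  | Input nat nat          (* M[a] := inp ! M[b]  (0 if out of range) *)
  | Jmp nat
  | Jz nat nat
  | Out nat nat

type_synonym mem = "nat \<Rightarrow> nat"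
text \<open>configuration: pc, memory, outputs (time of output, pair), time, set of written cells\<close>
type_synonym config = "nat \<times> mem \<times> (nat \<times> nat \<times> nat) list \<times> nat \<times> nat set"

definition step :: "instr list \<Rightarrow> nat list \<Rightarrow> nat \<Rightarrow> nat \<Rightarrow> config \<Rightarrow> config option" where
  "step P inp cap amax c = (case c of (pc, M, Os, t, W) \<Rightarrow>
     if length P \<le> pc then Some c else
     (let ok = (\<lambda>a. a < amax);
          wr = (\<lambda>a v. if a < amax \<and> v < cap
                       then Some (Suc pc, M(a := v), Os, Suc t, insert a W) else None)
      in case P ! pc of
        Const a v \<Rightarrow> wr a v
      | Add a b d \<Rightarrow> if ok b \<and> ok d then wr a (M b + M d) else None
      | Sub a b d \<Rightarrow> if ok b \<and> ok d then wr a (M b - M d) else None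
      | Mul a b d \<Rightarrow> if ok b \<and> ok d then wr a (M b * M d) else None
      | Div a b d \<Rightarrow> if ok b \<and> ok d then wr a (M b div M d) else None
      | Mod a b d \<Rightarrow> if ok b \<and> ok d then wr a (M b mod M d) else None
      | Load a b \<Rightarrow> if ok b \<and> ok (M b) then wr a (M (M b)) else None
      | Store a b \<Rightarrow> if ok a \<and> ok b then wr (M a) (M b) else None
      | Input a b \<Rightarrow> if ok b then wr a (if M b < length inp then inp ! (M b) else 0) else None
      | Jmp l \<Rightarrow> Some (l, M, Os, Suc t, W)
      | Jz a l \<Rightarrow> if ok a then Some (if M a = 0 then l else Suc pc, M, Os, Suc t, W) else None
      | Out a b \<Rightarrow> if ok a \<and> ok b then Some (Suc pc, M, Os @ [(Suc t, M a, M b)], Suc t, W)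
                   else None))"

fun steps :: "instr list \<Rightarrow> nat list \<Rightarrow> nat \<Rightarrow> nat \<Rightarrow> nat \<Rightarrow> config \<Rightarrow> config option" where
  "steps P inp cap amax 0 c = Some c"
| "steps P inp cap amax (Suc k) c = Option.bind (step P inp cap amax c) (steps P inp cap amax k)"

definition run :: "instr list \<Rightarrow> nat list \<Rightarrow> nat \<Rightarrow> nat \<Rightarrow> nat \<Rightarrow> mem
                   \<Rightarrow> (mem \<times> (nat \<times> nat \<times> nat) list \<times> nat \<times> nat set) option" where
  "run P inp cap amax fuel M = (case steps P inp cap amax fuel (0, M, [], 0, {}) of
      None \<Rightarrow> None
    | Some (pc, M', Os, t, W) \<Rightarrow> if length P \<le> pc then Some (M', Os, t, W) else None)"

fun code :: "sym \<Rightarrow> nat" where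
  "code A = 0" | "code B = 1" | "code C = 2" | "code E = 3"

definition infixes :: "sym list set \<Rightarrow> sym list \<Rightarrow> (nat \<times> nat) set" where
  "infixes L w = {(i, j). 1 \<le> i \<and> i \<le> j \<and> j \<le> length w \<and> take (j - i + 1) (drop (i - 1) w) \<in> L}"

definition valid_upds :: "nat \<Rightarrow> (nat \<times> sym) list \<Rightarrow> bool" where
  "valid_upds n us \<longleftrightarrow> (\<forall>(i, x) \<in> set us. 1 \<le> i \<and> i \<le> n)"

definition apply_upds :: "sym list \<Rightarrow> (nat \<times> sym) list \<Rightarrow> sym list" where
  "apply_upds w us = fold (\<lambda>(i, x) v. v[i - 1 := x]) us w"

fun upds :: "instr list \<Rightarrow> nat \<Rightarrow> nat \<Rightarrow> nat \<Rightarrow> mem \<Rightarrow> (nat \<times> sym) list \<Rightarrow> mem option" where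
  "upds Pu cap amax Bd M [] = Some M"
| "upds Pu cap amax Bd M ((i, x) # us) = (case run Pu [i, code x] cap amax Bd M of
      None \<Rightarrow> None
    | Some (M', _) \<Rightarrow> upds Pu cap amax Bd M' us)"

definition gaps_le :: "nat \<Rightarrow> nat list \<Rightarrow> bool" where
  "gaps_le Bd ts \<longleftrightarrow> (\<forall>k. Suc k < length ts \<longrightarrow> ts ! Suc k - ts ! k \<le> Bd)"

text \<open>The data-structure memory is left unchanged
  (the enumeration's memory effects are discarded), modelling "previous memory read-only".\<close>
definition enum_ok :: "sym list set \<Rightarrow> instr list \<Rightarrow> nat \<Rightarrow> nat \<Rightarrow> nat \<Rightarrow> sym list \<Rightarrow> mem \<Rightarrow> bool" where
  "enum_ok L Pe cap amax Bd w M \<longleftrightarrow>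
     (\<exists>fuel M' Os T W. run Pe [] cap amax fuel M = Some (M', Os, T, W) \<and>
        card W \<le> Bd \<and> distinct (map snd Os) \<and> set (map snd Os) = infixes L w \<and>
        gaps_le Bd (0 # map fst Os @ [T]))"

definition tractable :: "sym list set \<Rightarrow> bool" where
  "tractable L \<longleftrightarrow> (\<exists>Pb Pu Pe K Bd. \<forall>w us. valid_upds (length w) us \<longrightarrow>
     (let n = length w; cap = (n + 2) ^ K; amax = Bd * (n + 1) in
      case run Pb (n # map code w) cap amax (Bd * (n + 1)) (\<lambda>_. 0) of
        None \<Rightarrow> False
      | Some (M0, _) \<Rightarrow>
          (case upds Pu cap amax Bd M0 us of
             None \<Rightarrow> False
           | Some M \<Rightarrow> enum_ok L Pe cap amax Bd (apply_upds w us) M)))"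

text \<open>Operation codes: 1 test membership, 2 insert, 3 remove, 4 prefix query (i \<le> min S,
  true when S is empty). Returns the correct answer and the new set.\<close>
definition u1_spec :: "nat set \<Rightarrow> nat \<Rightarrow> nat \<Rightarrow> bool \<times> nat set" where
  "u1_spec S op i = (if op = 1 then (i \<in> S, S)
                     else if op = 2 then (False, insert i S)
                     else if op = 3 then (False, S - {i})
                     else ((\<forall>j\<in>S. i \<le> j), S))"

text \<open>Answer of a query = "yes" iff the operation produced some output.\<close>
fun u1_run :: "instr list \<Rightarrow> nat \<Rightarrow> nat \<Rightarrow> mem \<Rightarrow> nat set \<Rightarrow> (nat \<times> nat) list \<Rightarrow> bool" where
  "u1_run Po cap Cst M S [] = True"
| "u1_run Po cap Cst M S ((op, i) # ops) = (case run Po [op, i] cap cap Cst M of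
      None \<Rightarrow> False
    | Some (M', Os, _) \<Rightarrow> (op \<in> {1, 4} \<longrightarrow> (Os \<noteq> []) = fst (u1_spec S op i)) \<and>
                         u1_run Po cap Cst M' (snd (u1_spec S op i)) ops)"

definition prefix_U1_hyp :: bool where
  "prefix_U1_hyp \<longleftrightarrow> \<not> (\<exists>Pi Po K Cst. \<forall>n ops.
      (\<forall>(op, i) \<in> set ops. op \<in> {1, 2, 3, 4} \<and> 1 \<le> i \<and> i \<le> n) \<longrightarrow>
      (\<exists>fuel M0 Os t W. run Pi [n] ((n + 2) ^ K) ((n + 2) ^ K) fuel (\<lambda>_. 0) = Some (M0, Os, t, W) \<and>
         u1_run Po ((n + 2) ^ K) Cst M0 {} ops))"

end

theory Submission
  imports Defs
begin

text \<open>
  Membership in L3 depends only on whether c occurs, on the numbers of a's and b's, and, when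
  both numbers are at most two, on the order of the a's and b's. If x contains an a or a b,
  then the power of x with exponent omega + 1 contains three a's or three b's: otherwise x
  has at most two of each, x and xx are separated by a context, and omega is at least 2.
  Such a power commutes with every word modulo L3. If x contains neither a nor b, that power
  consists of c's and e's and does not affect the order of the a's and b's. The letter c is
  not neutral, and a (c a b) c^omega has two a's and one b, so L3 is not semi-extensible.

  For the lower bound, a set S of positions in 1..n is encoded by a (e e x_1) ... (e e x_n)
  with x_j = c iff j is in S. After writing b b in front of x_i, every L3-infix contains the
  unique a and exactly one b, so there is one iff some j < i lies in S. Hence a prefix query
  costs four letter updates and the first step of one enumeration. The build, update and
  enumeration programs of a tractable structure for L3 are compiled into a single RAM
  program: every instruction becomes a block of fixed length, the simulated memory is
  relocated above the registers and a write log, inputs are recomputed arithmetically, and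
  the cells written by the enumeration are logged and restored. All costs are constant
  multiples of the bound of the tractable structure, which contradicts the prefix-U1
  hypothesis.
\<close>

section \<open>L3 is ZG but not semi-extensible ZG\<close>

lemma count_list_wpow [simp]: "count_list (wpow x k) c = k * count_list x c"
  by (induction k) (simp_all add: wpow_def)

lemma count_list_replicate [simp]: "count_list (replicate n x) y = (if x = y then n else 0)"
  by (induction n) auto

lemma set_wpow [simp]: "set (wpow x k) = (if k = 0 then {} else set x)"
  by (simp add: wpow_def)

lemma count_list_filter: "count_list (filter P xs) x = (if P x then count_list xs x else 0)"
  by (induction xs) auto

definition ab_proj :: "sym list \<Rightarrow> sym list" where
  "ab_proj w = filter (\<lambda>x. x = A \<or> x = B) w"

lemma ab_proj_append [simp]: "ab_proj (u @ v) = ab_proj u @ ab_proj v"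
  by (simp add: ab_proj_def)

lemma ab_proj_eq_Nil_iff: "ab_proj w = [] \<longleftrightarrow> A \<notin> set w \<and> B \<notin> set w"
  by (auto simp: ab_proj_def filter_empty_conv)

lemma count_list_ab_proj: "x = A \<or> x = B \<Longrightarrow> count_list (ab_proj w) x = count_list w x"
  by (auto simp: ab_proj_def count_list_filter)

lemma mem_L3_iff:
  "w \<in> L3 \<longleftrightarrow> C \<in> set w \<and> (ab_proj w = [A, B] \<or> 3 \<le> count_list w A \<or> 3 \<le> count_list w B)"
proof -
  have "(\<lambda>x. x \<noteq> C \<and> x \<noteq> E) = (\<lambda>x. x = A \<or> x = B)"
    by (rule ext) (metis sym.exhaust sym.distinct)
  then have "filter (\<lambda>x. x \<noteq> E) (filter (\<lambda>x. x \<noteq> C) w) = ab_proj w"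
    by (simp add: ab_proj_def filter_filter conj_commute)
  moreover have "1 \<le> count_list w C \<longleftrightarrow> C \<in> set w"
    by (metis count_list_0_iff less_one not_le)
  ultimately show ?thesis
    by (simp add: L3_def L_ab_def count_list_filter)
qed

lemma L3_mem_cong:
  assumes "\<And>x. count_list u x = count_list v x"
    and "ab_proj u = ab_proj v \<or> 3 \<le> count_list u A \<or> 3 \<le> count_list u B"
  shows "u \<in> L3 \<longleftrightarrow> v \<in> L3"
proof -
  have "C \<in> set u \<longleftrightarrow> C \<in> set v"
    using assms(1)[of C] by (metis count_list_0_iff)
  then show ?thesis
    using assms unfolding mem_L3_iff by metis
qed

lemma synt_eq_L3_if_saturated:
  assumes "a = A \<or> a = B" "3 \<le> count_list u a" "3 \<le> count_list v a"
    and "C \<in> set u \<longleftrightarrow> C \<in> set v"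
  shows "synt_eq L3 u v"
  using assms unfolding synt_eq_def mem_L3_iff by auto

lemma not_synt_eq_L3_square:
  assumes a: "a = A \<or> a = B" "1 \<le> count_list x a"
    and small: "count_list x A \<le> 2" "count_list x B \<le> 2"
  shows "\<not> synt_eq L3 (x @ x) x"
proof
  let ?t = "replicate (3 - 2 * count_list x a) a"
  have "count_list x a \<le> 2" using a(1) small by auto
  then have counts: "count_list ((x @ x) @ ?t) a = 3 \<or> count_list ((x @ x) @ ?t) a = 4"
    "count_list (x @ ?t) a = 2"
    using a(2) by auto
  assume "synt_eq L3 (x @ x) x"
  then have "[C] @ (x @ x) @ ?t \<in> L3 \<longleftrightarrow> [C] @ x @ ?t \<in> L3"
    unfolding synt_eq_def by blast
  moreover have "[C] @ (x @ x) @ ?t \<in> L3"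
    using a(1) counts(1) unfolding mem_L3_iff by force
  moreover have "[C] @ x @ ?t \<notin> L3"
  proof
    assume mem: "[C] @ x @ ?t \<in> L3"
    have "count_list ([C] @ x @ ?t) A \<le> 2" "count_list ([C] @ x @ ?t) B \<le> 2"
      using a(1) small counts(2) by auto
    with mem have "ab_proj ([C] @ x @ ?t) = [A, B]"
      unfolding mem_L3_iff by linarith
    then have "count_list (ab_proj ([C] @ x @ ?t)) a = 1"
      using a(1) by auto
    moreover have "count_list ([C] @ x @ ?t) a = 2"
      using a(1) counts(2) by auto
    then have "count_list (ab_proj ([C] @ x @ ?t)) a = 2"
      using a(1) count_list_ab_proj by metis
    ultimately show False by simp
  qed
  ultimately show False by blast
qed

lemma omega_L3_ge_2:
  assumes a: "a = A \<or> a = B" "1 \<le> count_list x a"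
    and small: "count_list x A \<le> 2" "count_list x B \<le> 2"
  shows "2 \<le> omega L3 x"
proof -
  let ?P = "\<lambda>k. 1 \<le> k \<and> synt_eq L3 (wpow x k @ wpow x k) (wpow x k)"
  have "synt_eq L3 (wpow x 3 @ wpow x 3) (wpow x 3)"
    using a by (intro synt_eq_L3_if_saturated[OF a(1)]) auto
  then have "?P 3" by simp
  then have P: "?P (omega L3 x)"
    unfolding omega_def by (rule LeastI)
  have "omega L3 x \<noteq> 1"
  proof
    assume "omega L3 x = 1"
    with P have "synt_eq L3 (x @ x) x" by (simp add: wpow_def)
    with not_synt_eq_L3_square[OF a small] show False by blast
  qed
  with P show ?thesis by linarith
qed

lemma L3_power_omega_saturated:
  assumes "A \<in> set x \<or> B \<in> set x"
  obtains a where "a = A \<or> a = B" "3 \<le> count_list (wpow x (omega L3 x + 1)) a"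
proof (cases "count_list x A \<le> 2 \<and> count_list x B \<le> 2")
  case True
  have "count_list x A \<noteq> 0 \<or> count_list x B \<noteq> 0"
    using assms by (simp add: count_list_0_iff)
  then obtain a where a: "a = A \<or> a = B" "1 \<le> count_list x a"
    by (metis One_nat_def Suc_leI neq0_conv)
  have "3 * 1 \<le> (omega L3 x + 1) * count_list x a"
    using omega_L3_ge_2[OF a] True a(2) by (intro mult_le_mono) auto
  with a(1) show thesis by (intro that) auto
next
  case False
  then have "3 \<le> count_list x A \<or> 3 \<le> count_list x B" by auto
  then obtain a where a: "a = A \<or> a = B" "3 \<le> count_list x a" by blast
  have "count_list x a \<le> (omega L3 x + 1) * count_list x a" by simp
  with a show thesis by (intro that) auto
qed

lemma ZG_L3: "ZG L3"
  unfolding ZG_def synt_eq_def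
proof (intro allI)
  fix x y s t :: "sym list"
  let ?X = "wpow x (omega L3 x + 1)"
  have "ab_proj (s @ (y @ ?X) @ t) = ab_proj (s @ (?X @ y) @ t) \<or>
      3 \<le> count_list (s @ (y @ ?X) @ t) A \<or> 3 \<le> count_list (s @ (y @ ?X) @ t) B"
  proof (cases "A \<in> set x \<or> B \<in> set x")
    case True
    then obtain a where "a = A \<or> a = B" "3 \<le> count_list ?X a"
      by (rule L3_power_omega_saturated)
    then show ?thesis by (auto simp del: count_list_wpow)
  next
    case False
    then have "ab_proj ?X = []"
      by (simp add: ab_proj_eq_Nil_iff)
    then show ?thesis by simp
  qed
  moreover have "count_list (s @ (y @ ?X) @ t) c = count_list (s @ (?X @ y) @ t) c" for c
    by (simp del: count_list_wpow)
  ultimately show "s @ (y @ ?X) @ t \<in> L3 \<longleftrightarrow> s @ (?X @ y) @ t \<in> L3"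
    by (intro L3_mem_cong)
qed

lemma not_semi_ext_ZG_L3: "\<not> semi_ext_ZG L3"
proof
  have CAB: "[C, A, B] \<in> L3"
    by (simp add: mem_L3_iff ab_proj_def)
  have "\<not> neutral L3 C"
  proof
    assume "neutral L3 C"
    then have "[] @ [A, B] \<in> L3"
      using CAB unfolding neutral_def by (metis append_Cons append_Nil)
    then show False by (simp add: mem_L3_iff)
  qed
  moreover assume "semi_ext_ZG L3"
  ultimately have "[A] @ [C, A, B] @ [] @ wpow [C] (omega L3 [C]) \<in> L3"
    using CAB unfolding semi_ext_ZG_def by blast
  moreover have "ab_proj (wpow [C] k) = []" for k
    by (simp add: ab_proj_eq_Nil_iff)
  ultimately show False
    by (simp add: mem_L3_iff ab_proj_def)
qed

section \<open>Sets as words\<close>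

definition set_letter :: "nat set \<Rightarrow> nat \<Rightarrow> sym" where
  "set_letter S k = (if k = 0 then A else if k mod 3 = 0 \<and> k div 3 \<in> S then C else E)"

definition set_word :: "nat \<Rightarrow> nat set \<Rightarrow> sym list" where
  "set_word n S = map (set_letter S) [0..<3 * n + 1]"

definition query_letter :: "nat set \<Rightarrow> nat \<Rightarrow> nat \<Rightarrow> sym" where
  "query_letter S i k = (if k = 3 * i - 2 \<or> k = 3 * i - 1 then B else set_letter S k)"

definition query_word :: "nat \<Rightarrow> nat set \<Rightarrow> nat \<Rightarrow> sym list" where
  "query_word n S i = map (query_letter S i) [0..<3 * n + 1]"

lemma length_set_word [simp]: "length (set_word n S) = 3 * n + 1"
  by (simp add: set_word_def)

lemma length_query_word [simp]: "length (query_word n S i) = 3 * n + 1"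
  by (simp add: query_word_def)

lemma take_drop_eq_map_nth:
  "1 \<le> l \<Longrightarrow> l \<le> r \<Longrightarrow> r \<le> length w \<Longrightarrow> take (r - l + 1) (drop (l - 1) w) = map (nth w) [l - 1..<r]"
  by (rule nth_equalityI) (auto simp: min_def split: if_splits)

lemma infix_query_word:
  "1 \<le> l \<Longrightarrow> l \<le> r \<Longrightarrow> r \<le> 3 * n + 1 \<Longrightarrow>
    take (r - l + 1) (drop (l - 1) (query_word n S i)) = map (query_letter S i) [l - 1..<r]"
  unfolding query_word_def by (subst take_drop_eq_map_nth) (auto simp del: upt_Suc)

lemma count_list_map_upt: "count_list (map f [a..<b]) x = card {k. a \<le> k \<and> k < b \<and> f k = x}"
proof -
  have "count_list (map f [a..<b]) x = length (filter (\<lambda>k. f k = x) [a..<b])"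
    by (induction b) auto
  also have "\<dots> = card (set (filter (\<lambda>k. f k = x) [a..<b]))"
    by (rule distinct_card[symmetric]) simp
  also have "set (filter (\<lambda>k. f k = x) [a..<b]) = {k. a \<le> k \<and> k < b \<and> f k = x}" by auto
  finally show ?thesis .
qed

text \<open>The witness is the prefix ending with the first of the two b's.\<close>
lemma L3_infix_query_word:
  assumes "j \<in> S" "1 \<le> j" "j < i" "i \<le> n"
  shows "(1, 3 * i - 1) \<in> infixes L3 (query_word n S i)"
proof -
  let ?u = "map (query_letter S i) [0..<3 * i - 1]"
  have "3 * i - 1 = Suc (3 * i - 2)" "[0..<3 * i - 2] = 0 # [1..<3 * i - 2]"
    using assms by (simp_all add: upt_conv_Cons)
  then have "[0..<3 * i - 1] = 0 # [1..<3 * i - 2] @ [3 * i - 2]"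
    by (simp only: upt_Suc_append[OF le0] append_Cons)
  moreover have "ab_proj (map (query_letter S i) [1..<3 * i - 2]) = []"
    by (auto simp: ab_proj_eq_Nil_iff query_letter_def set_letter_def simp del: upt_Suc)
  ultimately have ab: "ab_proj ?u = [A, B]"
    using assms by (simp add: query_letter_def set_letter_def ab_proj_def del: upt_Suc)
  have "query_letter S i (3 * j) = C" "3 * j \<in> set [0..<3 * i - 1]"
    using assms by (auto simp: query_letter_def set_letter_def simp del: upt_Suc)
  then have "C \<in> set ?u"
    by (metis image_eqI set_map)
  with ab have "?u \<in> L3"
    unfolding mem_L3_iff by simp
  then show ?thesis
    unfolding infixes_def using assms infix_query_word[of 1 "3 * i - 1" n S i] by auto
qed

lemma L3_infix_query_word_imp:
  assumes lr: "(l, r) \<in> infixes L3 (query_word n S i)" and i: "1 \<le> i"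
  shows "\<exists>j\<in>S. j < i"
proof -
  let ?u = "map (query_letter S i) [l - 1..<r]"
  have lr': "1 \<le> l" "l \<le> r" "r \<le> 3 * n + 1"
    using lr by (auto simp: infixes_def query_word_def)
  moreover have "take (r - l + 1) (drop (l - 1) (query_word n S i)) \<in> L3"
    using lr by (simp add: infixes_def)
  ultimately have u: "?u \<in> L3"
    by (simp only: infix_query_word)
  let ?PA = "{k. l - 1 \<le> k \<and> k < r \<and> k = 0}"
  let ?PB = "{k. l - 1 \<le> k \<and> k < r \<and> (k = 3 * i - 2 \<or> k = 3 * i - 1)}"
  have cA: "count_list ?u A = card ?PA" and cB: "count_list ?u B = card ?PB"
    using i unfolding count_list_map_upt by (auto simp: query_letter_def set_letter_def intro!: arg_cong[where f = card])
  have "card ?PA \<le> card {0::nat}" "card ?PB \<le> card {3 * i - 2, 3 * i - 1}"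
    by (intro card_mono; auto)+
  moreover have "card {3 * i - 2, 3 * i - 1} \<le> 2"
    by (simp add: card_insert_if)
  ultimately have "count_list ?u A \<le> 2" "count_list ?u B \<le> 2"
    using cA cB by auto
  with u have ab: "ab_proj ?u = [A, B]" and "C \<in> set ?u"
    unfolding mem_L3_iff by auto
  from ab have "card ?PA = 1" "card ?PB = 1"
    using cA cB count_list_ab_proj[of A ?u] count_list_ab_proj[of B ?u] by auto
  from \<open>card ?PA = 1\<close> have "?PA \<noteq> {}"
    by (metis card.empty zero_neq_one)
  then have "l = 1"
    using lr'(1) by auto
  have "r < 3 * i"
  proof (rule ccontr)
    assume "\<not> r < 3 * i"
    with \<open>l = 1\<close> i have "?PB = {3 * i - 2, 3 * i - 1}" by auto
    with \<open>card ?PB = 1\<close> i show False by simp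
  qed
  from \<open>C \<in> set ?u\<close> obtain k where "k < r" "query_letter S i k = C" by auto
  then have "k mod 3 = 0" "k div 3 \<in> S" "k div 3 < i"
    using \<open>r < 3 * i\<close> by (auto simp: query_letter_def set_letter_def split: if_splits)
  then show ?thesis by blast
qed

lemma infixes_query_word_empty_iff:
  assumes "S \<subseteq> {1..n}" "1 \<le> i" "i \<le> n"
  shows "infixes L3 (query_word n S i) = {} \<longleftrightarrow> (\<forall>j\<in>S. i \<le> j)"
proof
  assume empty: "infixes L3 (query_word n S i) = {}"
  show "\<forall>j\<in>S. i \<le> j"
  proof (rule ccontr)
    assume "\<not> (\<forall>j\<in>S. i \<le> j)"
    then obtain j where "j \<in> S" "j < i" by (auto simp: not_le)
    with assms L3_infix_query_word[of j S i n] empty show False by auto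
  qed
next
  assume "\<forall>j\<in>S. i \<le> j"
  show "infixes L3 (query_word n S i) = {}"
  proof (rule equals0I)
    fix p assume "p \<in> infixes L3 (query_word n S i)"
    moreover obtain l r where "p = (l, r)" by (cases p)
    ultimately obtain j where "j \<in> S" "j < i"
      using L3_infix_query_word_imp assms(2) by blast
    with \<open>\<forall>j\<in>S. i \<le> j\<close> show False by auto
  qed
qed

lemma set_word_insert: "1 \<le> i \<Longrightarrow> i \<le> n \<Longrightarrow> (set_word n S)[3 * i := C] = set_word n (insert i S)"
  by (rule nth_equalityI) (auto simp: set_word_def set_letter_def nth_list_update simp del: upt_Suc)

lemma set_word_remove: "1 \<le> i \<Longrightarrow> i \<le> n \<Longrightarrow> (set_word n S)[3 * i := E] = set_word n (S - {i})"
  by (rule nth_equalityI) (auto simp: set_word_def set_letter_def nth_list_update simp del: upt_Suc)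

lemma set_word_query:
  "1 \<le> i \<Longrightarrow> i \<le> n \<Longrightarrow> (set_word n S)[3 * i - 2 := B, 3 * i - 1 := B] = query_word n S i"
  by (rule nth_equalityI)
    (auto simp: set_word_def query_word_def query_letter_def nth_list_update simp del: upt_Suc)

lemma query_word_restore:
  assumes "1 \<le> i" "i \<le> n"
  shows "(query_word n S i)[3 * i - 2 := E, 3 * i - 1 := E] = set_word n S"
proof (rule nth_equalityI)
  fix k assume "k < length ((query_word n S i)[3 * i - 2 := E, 3 * i - 1 := E])"
  moreover have "set_letter S k = E" if "k = 3 * i - 2 \<or> k = 3 * i - 1"
  proof -
    have "k \<noteq> 0" "k mod 3 \<noteq> 0"
      using that assms by presburger+
    then show ?thesis by (simp add: set_letter_def)
  qed
  ultimately show "(query_word n S i)[3 * i - 2 := E, 3 * i - 1 := E] ! k = set_word n S ! k"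
    using assms by (auto simp: set_word_def query_word_def query_letter_def nth_list_update simp del: upt_Suc)
qed (simp add: set_word_def query_word_def)

section \<open>Straight-line code and runs of programs\<close>

fun instr_sem :: "nat list \<Rightarrow> nat \<Rightarrow> nat \<Rightarrow> instr \<Rightarrow> mem \<Rightarrow> mem option" where
  "instr_sem inp cap amax (Const a v) M = (if a < amax \<and> v < cap then Some (M(a := v)) else None)"
| "instr_sem inp cap amax (Add a b d) M = (if b < amax \<and> d < amax \<and> a < amax \<and> M b + M d < cap then Some (M(a := M b + M d)) else None)"
| "instr_sem inp cap amax (Sub a b d) M = (if b < amax \<and> d < amax \<and> a < amax \<and> M b - M d < cap then Some (M(a := M b - M d)) else None)"
| "instr_sem inp cap amax (Mul a b d) M = (if b < amax \<and> d < amax \<and> a < amax \<and> M b * M d < cap then Some (M(a := M b * M d)) else None)"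
| "instr_sem inp cap amax (Div a b d) M = (if b < amax \<and> d < amax \<and> a < amax \<and> M b div M d < cap then Some (M(a := M b div M d)) else None)"
| "instr_sem inp cap amax (Mod a b d) M = (if b < amax \<and> d < amax \<and> a < amax \<and> M b mod M d < cap then Some (M(a := M b mod M d)) else None)"
| "instr_sem inp cap amax (Load a b) M = (if b < amax \<and> M b < amax \<and> a < amax \<and> M (M b) < cap then Some (M(a := M (M b))) else None)"
| "instr_sem inp cap amax (Store a b) M = (if a < amax \<and> b < amax \<and> M a < amax \<and> M b < cap then Some (M(M a := M b)) else None)"
| "instr_sem inp cap amax (Input a b) M = (if b < amax \<and> a < amax \<and> (if M b < length inp then inp ! (M b) else 0) < cap
       then Some (M(a := (if M b < length inp then inp ! (M b) else 0))) else None)"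
| "instr_sem inp cap amax (Jmp l) M = None"
| "instr_sem inp cap amax (Jz a l) M = None"
| "instr_sem inp cap amax (Out a b) M = None"

lemma step_straight_instr:
  assumes "pc < length Q" "Q ! pc = ins" "instr_sem inp cap amax ins M = Some M'"
  shows "\<exists>W'. step Q inp cap amax (pc, M, Os, t, W) = Some (Suc pc, M', Os, Suc t, W')"
  using assms by (cases ins) (simp_all add: step_def Let_def split: if_split_asm)

fun run_straight :: "nat list \<Rightarrow> nat \<Rightarrow> nat \<Rightarrow> instr list \<Rightarrow> mem \<Rightarrow> mem option" where
  "run_straight inp cap amax [] M = Some M"
| "run_straight inp cap amax (i # is) M = Option.bind (instr_sem inp cap amax i M) (run_straight inp cap amax is)"

lemma run_straight_append: "run_straight inp cap amax (xs @ ys) M = Option.bind (run_straight inp cap amax xs M) (run_straight inp cap amax ys)"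
  by (induction xs arbitrary: M) (auto split: Option.bind_split)

definition code_at :: "instr list \<Rightarrow> nat \<Rightarrow> instr list \<Rightarrow> bool" where
  "code_at Q p xs \<longleftrightarrow> p + length xs \<le> length Q \<and> (\<forall>j<length xs. Q ! (p + j) = xs ! j)"

lemma code_at_append: "code_at Q p (xs @ ys) \<longleftrightarrow> code_at Q p xs \<and> code_at Q (p + length xs) ys"
proof
  assume h: "code_at Q p (xs @ ys)"
  have a: "\<forall>j<length xs. Q ! (p + j) = xs ! j"
  proof (intro allI impI)
    fix j assume "j < length xs"
    with h show "Q ! (p + j) = xs ! j" unfolding code_at_def by (auto simp: nth_append)
  qed
  have b: "\<forall>j<length ys. Q ! (p + length xs + j) = ys ! j"
  proof (intro allI impI)
    fix j assume j: "j < length ys"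
    with h have "Q ! (p + (length xs + j)) = (xs @ ys) ! (length xs + j)" unfolding code_at_def by auto
    thus "Q ! (p + length xs + j) = ys ! j" by (simp add: add.assoc)
  qed
  from h a b show "code_at Q p xs \<and> code_at Q (p + length xs) ys" unfolding code_at_def by auto
next
  assume h: "code_at Q p xs \<and> code_at Q (p + length xs) ys"
  have "Q ! (p + j) = (xs @ ys) ! j" if j: "j < length (xs @ ys)" for j
  proof (cases "j < length xs")
    case True with h show ?thesis unfolding code_at_def by (auto simp: nth_append)
  next
    case False
    then obtain j' where j': "j = length xs + j'" by (metis le_add_diff_inverse not_le)
    with j have "j' < length ys" by simp
    with h have "Q ! (p + length xs + j') = ys ! j'" unfolding code_at_def by auto
    thus ?thesis using j' by (simp add: add.assoc nth_append)
  qed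
  with h show "code_at Q p (xs @ ys)" unfolding code_at_def by auto
qed

lemma code_at_appendD1: "code_at Q p (xs @ ys) \<Longrightarrow> code_at Q p xs"
  by (simp add: code_at_append)

lemma code_at_appendD2: "code_at Q p (xs @ ys) \<Longrightarrow> code_at Q (p + length xs) ys"
  by (simp add: code_at_append)

lemma code_at_take: "code_at Q p xs \<Longrightarrow> code_at Q p (take k xs)"
  by (auto simp: code_at_def min_def)

lemma code_at_nth: "code_at Q p xs \<Longrightarrow> j < length xs \<Longrightarrow> code_at Q (p + j) [xs ! j]"
  by (simp add: code_at_def)

lemma code_at_Cons: "code_at Q p (x # ys) \<longleftrightarrow> p < length Q \<and> Q ! p = x \<and> code_at Q (Suc p) ys"
  using code_at_append[of Q p "[x]" ys] by (auto simp: code_at_def)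

lemma code_at_here: "code_at (xs @ ys @ zs) (length xs) ys"
  by (auto simp: code_at_def nth_append)

lemma steps_add: "steps P inp cap amax (k1 + k2) c = Option.bind (steps P inp cap amax k1 c) (steps P inp cap amax k2)"
  by (induction k1 arbitrary: c) (auto split: Option.bind_split)

lemma steps_trans: "steps P inp cap amax k1 c = Some c1 \<Longrightarrow> steps P inp cap amax k2 c1 = Some c2 \<Longrightarrow>
   steps P inp cap amax (k1 + k2) c = Some c2"
  by (simp add: steps_add)


lemma steps_run_straight:
  assumes "code_at Q pc xs" "run_straight inp cap amax xs M = Some M'"
  shows "\<exists>W'. steps Q inp cap amax (length xs) (pc, M, Os, t, W) = Some (pc + length xs, M', Os, t + length xs, W')"
  using assms
proof (induction xs arbitrary: pc M t W)
  case Nil then show ?case by simp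
next
  case (Cons i xs)
  from Cons.prems(2) obtain M1 where s1: "instr_sem inp cap amax i M = Some M1" and r: "run_straight inp cap amax xs M1 = Some M'"
    by (auto split: Option.bind_splits)
  from Cons.prems(1) have c: "pc < length Q" "Q ! pc = i" "code_at Q (Suc pc) xs" by (auto simp: code_at_Cons)
  from step_straight_instr[OF c(1,2) s1] obtain W1 where st: "step Q inp cap amax (pc, M, Os, t, W) = Some (Suc pc, M1, Os, Suc t, W1)" by blast
  from Cons.IH[OF c(3) r] obtain W' where "steps Q inp cap amax (length xs) (Suc pc, M1, Os, Suc t, W1) = Some (Suc pc + length xs, M', Os, Suc t + length xs, W')" by blast
  with st show ?case by auto
qed

lemma step_Jmp: "pc < length Q \<Longrightarrow> Q ! pc = Jmp l \<Longrightarrow> step Q inp cap amax (pc, M, Os, t, W) = Some (l, M, Os, Suc t, W)"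
  by (simp add: step_def)
lemma step_Jz: "pc < length Q \<Longrightarrow> Q ! pc = Jz a l \<Longrightarrow> a < amax \<Longrightarrow>
   step Q inp cap amax (pc, M, Os, t, W) = Some (if M a = 0 then l else Suc pc, M, Os, Suc t, W)"
  by (simp add: step_def)
lemma step_Out: "pc < length Q \<Longrightarrow> Q ! pc = Out a b \<Longrightarrow> a < amax \<Longrightarrow> b < amax \<Longrightarrow>
   step Q inp cap amax (pc, M, Os, t, W) = Some (Suc pc, M, Os @ [(Suc t, M a, M b)], Suc t, W)"
  by (simp add: step_def)
lemma step_halt: "length Q \<le> pc \<Longrightarrow> step Q inp cap amax (pc, M, Os, t, W) = Some (pc, M, Os, t, W)"
  by (simp add: step_def)

lemma steps_halt: "length Q \<le> pc \<Longrightarrow> steps Q inp cap amax k (pc, M, Os, t, W) = Some (pc, M, Os, t, W)"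
  by (induction k) (simp_all add: step_halt)

lemma steps_mono_halt:
  assumes "steps Q inp cap amax k c = Some (pc, M, Os, t, W)" "length Q \<le> pc" "k \<le> k'"
  shows "steps Q inp cap amax k' c = Some (pc, M, Os, t, W)"
proof -
  have "k' = k + (k' - k)" using assms(3) by simp
  then show ?thesis using assms steps_halt by (metis steps_trans)
qed

lemma step_time:
  assumes "step Q inp cap amax (pc, M, Os, t, W) = Some (pc', M', Os', t', W')"
  shows "(length Q \<le> pc \<and> (pc', M', Os', t', W') = (pc, M, Os, t, W)) \<or> (pc < length Q \<and> t' = Suc t)"
  using assms by (auto simp: step_def Let_def split: if_splits instr.splits)

lemma step_Os:
  assumes "step Q inp cap amax (pc, M, Os, t, W) = Some (pc', M', Os', t', W')"
  shows "Os' = Os \<or> (pc < length Q \<and> (\<exists>a b. Q ! pc = Out a b \<and> Os' = Os @ [(Suc t, M a, M b)]))"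
  using assms by (auto simp: step_def Let_def split: if_splits instr.splits)

lemma steps_time:
  assumes "steps Q inp cap amax k (pc, M, Os, t, W) = Some (pc', M', Os', t', W')"
  shows "t \<le> t' \<and> t' - t \<le> k \<and> steps Q inp cap amax (t' - t) (pc, M, Os, t, W) = Some (pc', M', Os', t', W')"
  using assms
proof (induction k arbitrary: pc M Os t W)
  case 0 then show ?case by simp
next
  case (Suc k)
  from Suc.prems obtain c1 where s1: "step Q inp cap amax (pc, M, Os, t, W) = Some c1"
    and r: "steps Q inp cap amax k c1 = Some (pc', M', Os', t', W')" by (auto split: Option.bind_splits)
  obtain pc1 M1 Os1 t1 W1 where c1: "c1 = (pc1, M1, Os1, t1, W1)" by (cases c1) auto
  from step_time[OF s1[unfolded c1]]
  show ?case
  proof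
    assume h: "length Q \<le> pc \<and> (pc1, M1, Os1, t1, W1) = (pc, M, Os, t, W)"
    with Suc.IH[of pc M Os t W] r c1 show ?thesis by auto
  next
    assume h: "pc < length Q \<and> t1 = Suc t"
    from Suc.IH[of pc1 M1 Os1 t1 W1] r c1 have ih: "t1 \<le> t' \<and> t' - t1 \<le> k \<and>
      steps Q inp cap amax (t' - t1) c1 = Some (pc', M', Os', t', W')" by auto
    hence "t' - t = Suc (t' - t1)" using h by auto
    with ih s1 h show ?thesis by auto
  qed
qed

lemma steps_Os_prefix:
  assumes "steps Q inp cap amax k (pc, M, Os, t, W) = Some (pc', M', Os', t', W')"
  shows "\<exists>zs. Os' = Os @ zs"
  using assms
proof (induction k arbitrary: pc M Os t W)
  case 0 then show ?case by simp
next
  case (Suc k)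
  from Suc.prems obtain c1 where s1: "step Q inp cap amax (pc, M, Os, t, W) = Some c1"
    and r: "steps Q inp cap amax k c1 = Some (pc', M', Os', t', W')" by (auto split: Option.bind_splits)
  obtain pc1 M1 Os1 t1 W1 where c1: "c1 = (pc1, M1, Os1, t1, W1)" by (cases c1) auto
  from Suc.IH[of pc1 M1 Os1 t1 W1] r c1 obtain zs where "Os' = Os1 @ zs" by auto
  with step_Os[OF s1[unfolded c1]] show ?case by auto
qed

lemma steps_first_output:
  assumes "steps Q inp cap amax k (pc, M, [], t, W) = Some (pc', M', Os', t', W')" "Os' \<noteq> []"
  shows "\<exists>j pcm Mm tm Wm a b. steps Q inp cap amax j (pc, M, [], t, W) = Some (pcm, Mm, [], tm, Wm) \<and>
     pcm < length Q \<and> Q ! pcm = Out a b \<and> fst (hd Os') = Suc tm"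
  using assms
proof (induction k arbitrary: pc M t W)
  case 0 then show ?case by simp
next
  case (Suc k)
  from Suc.prems obtain c1 where s1: "step Q inp cap amax (pc, M, [], t, W) = Some c1"
    and r: "steps Q inp cap amax k c1 = Some (pc', M', Os', t', W')" by (auto split: Option.bind_splits)
  obtain pc1 M1 Os1 t1 W1 where c1: "c1 = (pc1, M1, Os1, t1, W1)" by (cases c1) auto
  from step_Os[OF s1[unfolded c1]] show ?case
  proof
    assume "Os1 = []"
    with Suc.IH[of pc1 M1 t1 W1] r c1 Suc.prems(2) obtain j pcm Mm tm Wm a b where
      "steps Q inp cap amax j c1 = Some (pcm, Mm, [], tm, Wm) \<and> pcm < length Q \<and> Q ! pcm = Out a b \<and> fst (hd Os') = Suc tm"
      by auto
    moreover from this s1 have "steps Q inp cap amax (Suc j) (pc, M, [], t, W) = Some (pcm, Mm, [], tm, Wm)" by simp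
    ultimately show ?thesis by blast
  next
    assume "pc < length Q \<and> (\<exists>a b. Q ! pc = Out a b \<and> Os1 = [] @ [(Suc t, M a, M b)])"
    then obtain a b where h: "pc < length Q" "Q ! pc = Out a b" "Os1 = [(Suc t, M a, M b)]" by auto
    from steps_Os_prefix[OF r[unfolded c1]] h obtain zs where "Os' = (Suc t, M a, M b) # zs" by auto
    moreover have "steps Q inp cap amax 0 (pc, M, [], t, W) = Some (pc, M, [], t, W)" by simp
    ultimately show ?thesis using h by fastforce
  qed
qed



section \<open>Compiling programs into relocated blocks\<close>

text \<open>Registers of compiled programs: cells 0, 1, 2 hold the constants 0, 1, 3, cell 3 the
  relocation offset R, cell 4 the word length m, cell 5 the base bm of the characteristic
  vector of S (at bm + 1, ..., bm + n), cell 6 the start log_base of the write log, cells 7, 8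
  the arguments of a simulated update, and cells 9, 10 the operation and index of a prefix-U1
  operation. Cells 13 to 20 are temporaries (19 is the log pointer), the log starts at cell
  21, and cell a of a simulated program is kept in cell a + R.\<close>

abbreviation "rZ \<equiv> (0::nat)"
abbreviation "rONE \<equiv> (1::nat)"
abbreviation "rTHREE \<equiv> (2::nat)"
abbreviation "rRR \<equiv> (3::nat)"
abbreviation "rMM \<equiv> (4::nat)"
abbreviation "rBM \<equiv> (5::nat)"
abbreviation "rLB \<equiv> (6::nat)"
abbreviation "rI0 \<equiv> (7::nat)"
abbreviation "rI1 \<equiv> (8::nat)"
abbreviation "rOP \<equiv> (9::nat)"
abbreviation "rIX \<equiv> (10::nat)"
abbreviation "rN \<equiv> (12::nat)"
abbreviation "rX \<equiv> (13::nat)"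
abbreviation "rV \<equiv> (14::nat)"
abbreviation "rT \<equiv> (15::nat)"
abbreviation "rX1 \<equiv> (16::nat)"
abbreviation "rX2 \<equiv> (17::nat)"
abbreviation "rX3 \<equiv> (18::nat)"
abbreviation "rLP \<equiv> (19::nat)"
abbreviation "rT2 \<equiv> (20::nat)"
abbreviation "log_base \<equiv> (21::nat)"

text \<open>Compilation modes for the build, update and enumeration program. They differ in how
  Input is emulated; in mode ME every write is logged and Out becomes a jump to fnd.\<close>
datatype mode = MB | MU | ME

definition block_size :: nat where "block_size = 16"

fun is_write :: "instr \<Rightarrow> bool" where
  "is_write (Jmp l) = False" | "is_write (Jz a l) = False" | "is_write (Out a b) = False" | "is_write _ = True"

fun write_reg :: "instr \<Rightarrow> nat" where
  "write_reg (Const a v) = a" | "write_reg (Add a b d) = a" | "write_reg (Sub a b d) = a" | "write_reg (Mul a b d) = a"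
| "write_reg (Div a b d) = a" | "write_reg (Mod a b d) = a" | "write_reg (Load a b) = a" | "write_reg (Store a b) = a"
| "write_reg (Input a b) = a" | "write_reg _ = 0"

definition addr_code :: "nat \<Rightarrow> instr \<Rightarrow> instr list" where
  "addr_code R i = (case i of Store a b \<Rightarrow> [Add rX (a+R) rRR] | _ \<Rightarrow> [Const rX (write_reg i + R)])"

fun input_code :: "mode \<Rightarrow> nat \<Rightarrow> nat \<Rightarrow> instr list" where
  "input_code MB R b = [Add rT (b+R) rZ, Sub rX1 rONE rT, Sub rX2 rT rONE, Sub rX2 rONE rX2, Sub rX2 rX2 rX1,
      Sub rX3 rT rMM, Sub rX3 rONE rX3, Sub rX3 rX3 rX1, Sub rX3 rX3 rX2, Mul rX3 rX3 rTHREE,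
      Mul rV rX1 rMM, Add rV rV rX3]"
| "input_code MU R b = [Add rT (b+R) rZ, Sub rX1 rONE rT, Sub rX2 rT rONE, Sub rX2 rONE rX2, Sub rX2 rX2 rX1,
      Mul rX1 rX1 rI0, Mul rX2 rX2 rI1, Add rV rX1 rX2]"
| "input_code ME R b = [Const rV 0]"

fun value_code :: "mode \<Rightarrow> nat \<Rightarrow> instr \<Rightarrow> instr list" where
  "value_code m R (Const a v) = [Const rV v]"
| "value_code m R (Add a b d) = [Add rV (b+R) (d+R)]"
| "value_code m R (Sub a b d) = [Sub rV (b+R) (d+R)]"
| "value_code m R (Mul a b d) = [Mul rV (b+R) (d+R)]"
| "value_code m R (Div a b d) = [Div rV (b+R) (d+R)]"
| "value_code m R (Mod a b d) = [Mod rV (b+R) (d+R)]"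
| "value_code m R (Load a b) = [Add rT (b+R) rRR, Load rV rT]"
| "value_code m R (Store a b) = [Add rV (b+R) rZ]"
| "value_code m R (Input a b) = input_code m R b"
| "value_code m R _ = []"

definition log_code :: "mode \<Rightarrow> instr list" where
  "log_code m = (if m = ME then [Store rLP rX, Add rLP rLP rONE, Load rT rX, Store rLP rT, Add rLP rLP rONE] else [])"

text \<open>All blocks have length block_size, so jump targets are scaled; targets beyond the end
  of the program go to its end.\<close>
definition block_addr :: "nat \<Rightarrow> nat \<Rightarrow> nat \<Rightarrow> nat" where
  "block_addr off len l = off + block_size * min l len"

definition instr_block :: "mode \<Rightarrow> nat \<Rightarrow> nat \<Rightarrow> nat \<Rightarrow> nat \<Rightarrow> instr \<Rightarrow> instr list" where
  "instr_block m R off len fnd i = (case i of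
     Jmp l \<Rightarrow> [Jmp (block_addr off len l)]
   | Jz a l \<Rightarrow> [Jz (a+R) (block_addr off len l)]
   | Out a b \<Rightarrow> (if m = ME then [Jmp fnd] else [])
   | _ \<Rightarrow> addr_code R i @ log_code m @ value_code m R i @ [Store rX rV])"

definition pad_block :: "instr list \<Rightarrow> instr list" where
  "pad_block xs = xs @ replicate (block_size - length xs) (Const rT 0)"

definition compile :: "mode \<Rightarrow> nat \<Rightarrow> nat \<Rightarrow> nat \<Rightarrow> instr list \<Rightarrow> instr list" where
  "compile m R off fnd P = concat (map (\<lambda>i. pad_block (instr_block m R off (length P) fnd i)) P)"

lemma length_instr_block: "length (instr_block m R off len fnd i) \<le> block_size"
  by (cases i; cases m) (simp_all add: instr_block_def addr_code_def log_code_def block_size_def)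

lemma length_pad_block[simp]: "length (pad_block (instr_block m R off len fnd i)) = block_size"
  using length_instr_block[of m R off len fnd i] by (simp add: pad_block_def)

lemma code_at_concat_nth:
  assumes "\<forall>x\<in>set xs. length (f x) = s" "p < length xs"
  shows "code_at (concat (map f xs)) (s * p) (f (xs ! p))"
  using assms
proof (induction xs arbitrary: p)
  case Nil then show ?case by simp
next
  case (Cons x xs)
  show ?case
  proof (cases p)
    case 0
    then show ?thesis using Cons.prems code_at_here[of "[]" "f x" "concat (map f xs)"] by simp
  next
    case (Suc p')
    with Cons have ih: "code_at (concat (map f xs)) (s * p') (f (xs ! p'))" by auto
    have "code_at (f x @ concat (map f xs)) (length (f x) + s * p') (f (xs ! p'))"
      using ih code_at_append[of "f x @ concat (map f xs)" 0 "f x"] unfolding code_at_def by (auto simp: nth_append)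
    then show ?thesis using Suc Cons.prems by (simp add: algebra_simps)
  qed
qed

lemma code_at_sub:
  assumes "code_at Q off xs" "code_at xs p ys" shows "code_at Q (off + p) ys"
  using assms unfolding code_at_def by (auto simp: add.assoc)

lemma compile_code_at_block:
  assumes "code_at Q off (compile m R off fnd P)" "p < length P"
  shows "code_at Q (off + block_size * p) (pad_block (instr_block m R off (length P) fnd (P ! p)))"
proof -
  have "code_at (compile m R off fnd P) (block_size * p) (pad_block (instr_block m R off (length P) fnd (P ! p)))"
    unfolding compile_def using code_at_concat_nth[of P "\<lambda>i. pad_block (instr_block m R off (length P) fnd i)" block_size p] assms(2)
    by simp
  with assms(1) show ?thesis by (rule code_at_sub)
qed

lemma length_compile[simp]: "length (compile m R off fnd P) = block_size * length P"
  by (simp add: compile_def length_concat sum_list_triv comp_def)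



definition relocated :: "nat \<Rightarrow> nat \<Rightarrow> mem \<Rightarrow> mem \<Rightarrow> bool" where
  "relocated R amax Mo Mc \<longleftrightarrow> (\<forall>a<amax. Mc (a + R) = Mo a)"

text \<open>The input of a simulated program is recomputed from registers: the build program reads
  m followed by the codes of a e e ... e (the word of the empty set), an update program reads
  its two arguments, and the enumeration program has no input.\<close>
fun input_val :: "mode \<Rightarrow> mem \<Rightarrow> nat \<Rightarrow> nat" where
  "input_val MB M v = (if v = 0 then M rMM else if v = 1 then 0 else if v \<le> M rMM then 3 else 0)"
| "input_val MU M v = (if v = 0 then M rI0 else if v = 1 then M rI1 else 0)"
| "input_val ME M v = 0"

fun write_val :: "nat list \<Rightarrow> instr \<Rightarrow> mem \<Rightarrow> nat" where
  "write_val inp (Const a v) M = v"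
| "write_val inp (Add a b d) M = M b + M d"
| "write_val inp (Sub a b d) M = M b - M d"
| "write_val inp (Mul a b d) M = M b * M d"
| "write_val inp (Div a b d) M = M b div M d"
| "write_val inp (Mod a b d) M = M b mod M d"
| "write_val inp (Load a b) M = M (M b)"
| "write_val inp (Store a b) M = M b"
| "write_val inp (Input a b) M = (if M b < length inp then inp ! (M b) else 0)"
| "write_val inp _ M = 0"

fun write_addr :: "instr \<Rightarrow> mem \<Rightarrow> nat" where
  "write_addr (Store a b) M = M a"
| "write_addr i M = write_reg i"

fun operands_ok :: "instr \<Rightarrow> mem \<Rightarrow> nat \<Rightarrow> bool" where
  "operands_ok (Const a v) M amax = True"
| "operands_ok (Add a b d) M amax = (b < amax \<and> d < amax)"
| "operands_ok (Sub a b d) M amax = (b < amax \<and> d < amax)"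
| "operands_ok (Mul a b d) M amax = (b < amax \<and> d < amax)"
| "operands_ok (Div a b d) M amax = (b < amax \<and> d < amax)"
| "operands_ok (Mod a b d) M amax = (b < amax \<and> d < amax)"
| "operands_ok (Load a b) M amax = (b < amax \<and> M b < amax)"
| "operands_ok (Store a b) M amax = (a < amax \<and> b < amax)"
| "operands_ok (Input a b) M amax = (b < amax)"
| "operands_ok _ M amax = True"

lemma step_write:
  assumes "p < length P" "is_write (P ! p)"
    "step P inp cap amax (p, Mo, Os, t, W) = Some (p', Mo', Os', t', W')"
  shows "p' = Suc p \<and> Mo' = Mo(write_addr (P ! p) Mo := write_val inp (P ! p) Mo) \<and> Os' = Os \<and> t' = Suc t \<and>
    write_addr (P ! p) Mo < amax \<and> write_val inp (P ! p) Mo < cap \<and> operands_ok (P ! p) Mo amax"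
  using assms by (cases "P ! p") (simp_all add: step_def Let_def split: if_split_asm)

text \<open>The case distinction of input_val MB, evaluated with truncated subtraction only, as in
  input_code MB.\<close>
lemma build_input_arith:
  fixes m v :: nat
  assumes "1 \<le> m"
  shows "(1 - v) * m + ((((1 - (v - m)) - (1 - v)) - ((1 - (v - 1)) - (1 - v))) * 3) =
     (if v = 0 then m else if v = 1 then 0 else if v \<le> m then 3 else 0)"
proof -
  consider "v = 0" | "v = 1" | "2 \<le> v \<and> v \<le> m" | "v > m \<and> v \<ge> 2" using assms by linarith
  then show ?thesis
  proof cases
    case 3
    then have "1 - v = 0" "1 - (v - 1) = 0" "1 - (v - m) = 1" by auto
    then show ?thesis using 3 by auto
  next
    case 4
    then have "1 - v = 0" "1 - (v - 1) = 0" "1 - (v - m) = 0" by auto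
    then show ?thesis using 4 by auto
  qed (use assms in auto)
qed

lemma update_input_arith:
  fixes v i0 i1 :: nat
  shows "(1 - v) * i0 + ((1 - (v - 1)) - (1 - v)) * i1 = (if v = 0 then i0 else if v = 1 then i1 else 0)"
proof -
  consider "v = 0" | "v = 1" | "2 \<le> v" by linarith
  then show ?thesis
  proof cases
    case 3
    then have "1 - v = 0" "1 - (v - 1) = 0" by auto
    then show ?thesis using 3 by auto
  qed auto
qed

lemma run_value_code:
  assumes mr: "relocated R amax Mo M" and regs: "M rZ = 0" "M rONE = 1" "M rTHREE = 3" "M rRR = R"
    and R: "log_base \<le> R" and cp: "R + amax \<le> cap" "capo \<le> cap" "4 \<le> cap"
    and mb: "m = MB \<Longrightarrow> 1 \<le> M rMM \<and> M rMM < cap"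
    and mu: "m = MU \<Longrightarrow> M rI0 < cap \<and> M rI1 < cap"
    and inp: "\<forall>v. (if v < length inp then inp ! v else 0) = input_val m M v"
    and w: "is_write i" and ok: "operands_ok i Mo amax" and vb: "write_val inp i Mo < capo" and mob: "\<forall>a. Mo a < capo"
  shows "\<exists>M'. run_straight inp' cap cap (value_code m R i) M = Some M' \<and> M' rV = write_val inp i Mo \<and>
     (\<forall>q. q \<noteq> rT \<and> q \<noteq> rX1 \<and> q \<noteq> rX2 \<and> q \<noteq> rX3 \<and> q \<noteq> rV \<longrightarrow> M' q = M q)"
proof -
  have mrel: "\<And>a. a < amax \<Longrightarrow> M (a + R) = Mo a" using mr by (simp add: relocated_def)
  have lt: "\<And>a. a < amax \<Longrightarrow> a + R < cap" using cp by linarith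
  have ne: "\<And>a q. q < log_base \<Longrightarrow> a + R \<noteq> q" using R by linarith
  have rc: "\<And>q. q \<le> 20 \<Longrightarrow> q < cap" using R cp by linarith
  show ?thesis
  proof (cases i)
    case (Input a b)
    with ok have b: "b < amax" by simp
    from inp have iv: "write_val inp i Mo = input_val m M (Mo b)" using Input by simp
    show ?thesis
    proof (cases m)
      case MB
      with mb have m1: "1 \<le> M rMM" "M rMM < cap" by auto
      have "input_val m M (Mo b) < cap" using MB m1 cp by auto
      have "Mo b < cap" using mob cp by (meson less_le_trans)
      then show ?thesis using Input MB b iv m1 regs cp lt[OF b] ne mrel[OF b] build_input_arith[OF m1(1), of "Mo b"] rc
        by (auto simp: ) 
    next
      case MU
      have "Mo b < cap" using mob cp by (meson less_le_trans)
      then show ?thesis using MU Input b iv regs cp lt[OF b] ne mrel[OF b] update_input_arith[of "Mo b" "M rI0" "M rI1"] mu rc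
        by auto
    next
      case ME
      then show ?thesis using Input iv cp rc by auto
    qed
  qed (use w ok vb cp lt ne mrel regs rc in auto)
qed

lemma run_addr_code:
  assumes w: "is_write i" and mr: "relocated R amax Mo M" and rr: "M rRR = R" and R: "log_base \<le> R"
    and cp: "R + amax \<le> cap" and ok: "operands_ok i Mo amax" and od: "write_addr i Mo < amax"
  shows "run_straight inp' cap cap (addr_code R i) M = Some (M(rX := write_addr i Mo + R))"
proof -
  have rc: "\<And>q. q \<le> 20 \<Longrightarrow> q < cap" using R cp by linarith
  have mrel: "\<And>a. a < amax \<Longrightarrow> M (a + R) = Mo a" using mr by (simp add: relocated_def)
  show ?thesis
  proof (cases i)
    case (Store a b)
    with ok od have "a < amax" "Mo a < amax" by auto
    with Store rr rc cp mrel show ?thesis by (auto simp: addr_code_def)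
  qed (use w od cp rc in \<open>auto simp: addr_code_def\<close>)
qed

lemma run_log_code:
  assumes "M rLP = lp" "M rX = x" "M rONE = 1" "log_base \<le> lp" "lp + 2 < cap" "x < cap" "M x < cap"
    "x \<noteq> lp" "x \<noteq> lp + 1" "log_base \<le> x"
  shows "\<exists>M'. run_straight inp' cap cap (log_code ME) M = Some M' \<and> M' lp = x \<and> M' (lp + 1) = M x \<and> M' rLP = lp + 2 \<and>
     (\<forall>q. q \<noteq> lp \<and> q \<noteq> lp + 1 \<and> q \<noteq> rLP \<and> q \<noteq> rT \<longrightarrow> M' q = M q)"
proof -
  have rc: "\<And>q. q \<le> 20 \<Longrightarrow> q < cap" using assms by linarith
  show ?thesis using assms rc by (auto simp: log_code_def)
qed

lemma run_padding: "rT < cap \<Longrightarrow> 0 < cap \<Longrightarrow> run_straight inp' cap cap (replicate k (Const rT 0)) M = Some (if k = 0 then M else M(rT := 0))"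
  by (induction k arbitrary: M) auto

definition temp_reg :: "nat \<Rightarrow> bool" where "temp_reg q \<longleftrightarrow> 13 \<le> q \<and> q \<le> 20"

lemma steps_write_block:
  assumes ca: "code_at Q pc (pad_block (instr_block m R off len fnd i))"
    and mr: "relocated R amax Mo M" and regs: "M rZ = 0" "M rONE = 1" "M rTHREE = 3" "M rRR = R"
    and R: "log_base \<le> R" and cp: "R + amax \<le> cap" "capo \<le> cap" "4 \<le> cap"
    and mb: "m = MB \<Longrightarrow> 1 \<le> M rMM \<and> M rMM < cap"
    and mu: "m = MU \<Longrightarrow> M rI0 < cap \<and> M rI1 < cap"
    and inp: "\<forall>v. (if v < length inp then inp ! v else 0) = input_val m M v"
    and w: "is_write i" and ok: "operands_ok i Mo amax" and vb: "write_val inp i Mo < capo" and mob: "\<forall>a. Mo a < capo"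
    and od: "write_addr i Mo < amax"
    and me: "m = ME \<Longrightarrow> M rLP = lp \<and> log_base \<le> lp \<and> lp + 2 < R"
  shows "\<exists>M' W'. steps Q inp' cap cap block_size (pc, M, Os, t, W) = Some (pc + block_size, M', Os, t + block_size, W') \<and>
    M' (write_addr i Mo + R) = write_val inp i Mo \<and>
    (\<forall>q. \<not> temp_reg q \<and> q \<noteq> write_addr i Mo + R \<and> (m = ME \<longrightarrow> q \<noteq> lp \<and> q \<noteq> lp + 1) \<longrightarrow> M' q = M q) \<and>
    (m = ME \<longrightarrow> M' lp = write_addr i Mo + R \<and> M' (lp + 1) = M (write_addr i Mo + R) \<and> M' rLP = lp + 2)"
proof -
  let ?x = "write_addr i Mo + R"
  have rc: "\<And>q. q \<le> 20 \<Longrightarrow> q < cap" using R cp by linarith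
  have mrel: "\<And>a. a < amax \<Longrightarrow> M (a + R) = Mo a" using mr by (simp add: relocated_def)
  have xb: "?x < cap" using od cp by linarith
  have instr_block: "instr_block m R off len fnd i = addr_code R i @ log_code m @ value_code m R i @ [Store rX rV]"
    using w by (cases i) (auto simp: instr_block_def)
  define M1 where "M1 = M(rX := ?x)"
  have s1: "run_straight inp' cap cap (addr_code R i) M = Some M1" unfolding M1_def
    by (rule run_addr_code[OF w mr regs(4) R cp(1) ok od])
  obtain M2 where s2: "run_straight inp' cap cap (log_code m) M1 = Some M2"
    and M2: "\<forall>q. \<not> temp_reg q \<and> (m = ME \<longrightarrow> q \<noteq> lp \<and> q \<noteq> lp + 1) \<longrightarrow> M2 q = M1 q"
    and M2e: "m = ME \<longrightarrow> M2 lp = ?x \<and> M2 (lp + 1) = M ?x \<and> M2 rLP = lp + 2"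
    and M2x: "M2 rX = M1 rX"
  proof (cases "m = ME")
    case True
    with me have lp: "M rLP = lp" "log_base \<le> lp" "lp + 2 < R" by auto
    have "M1 rLP = lp" "M1 rX = ?x" "M1 ?x = M ?x" "M1 rONE = 1" using lp R regs unfolding M1_def by auto
    moreover have "M ?x < cap" using mrel[OF od] mob cp by (metis less_le_trans)
    ultimately obtain M' where "run_straight inp' cap cap (log_code ME) M1 = Some M'" "M' lp = ?x" "M' (lp + 1) = M ?x" "M' rLP = lp + 2"
       "\<forall>q. q \<noteq> lp \<and> q \<noteq> lp + 1 \<and> q \<noteq> rLP \<and> q \<noteq> rT \<longrightarrow> M' q = M1 q"
      using run_log_code[of M1 lp ?x cap] lp xb cp R by fastforce
    moreover have "\<forall>q. \<not> temp_reg q \<and> (m = ME \<longrightarrow> q \<noteq> lp \<and> q \<noteq> lp + 1) \<longrightarrow> M' q = M1 q"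
      using calculation(5) True by (auto simp: temp_reg_def)
    moreover have "M' rX = M1 rX" using calculation(5) lp by auto
    ultimately show ?thesis using that[of M'] True by blast
  next
    case False
    then show ?thesis using that[of M1] by (simp add: log_code_def)
  qed
  have M2r: "relocated R amax Mo M2" "M2 rZ = 0" "M2 rONE = 1" "M2 rTHREE = 3" "M2 rRR = R"
    "m = MB \<Longrightarrow> M2 rMM = M rMM" "m = MU \<Longrightarrow> M2 rI0 = M rI0 \<and> M2 rI1 = M rI1"
  proof -
    have "M2 (a + R) = M (a + R)" if "a < amax" for a
    proof -
      have "\<not> temp_reg (a + R)" using R by (auto simp: temp_reg_def)
      moreover have "m = ME \<longrightarrow> a + R \<noteq> lp \<and> a + R \<noteq> lp + 1" using me by auto
      ultimately show ?thesis using M2 R unfolding M1_def by auto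
    qed
    then show "relocated R amax Mo M2" using mr by (simp add: relocated_def)
    have lpq: "m = ME \<longrightarrow> (q::nat) < log_base \<longrightarrow> q \<noteq> lp \<and> q \<noteq> lp + 1" for q using me by auto
    show "M2 rZ = 0" "M2 rONE = 1" "M2 rTHREE = 3" "M2 rRR = R"
      "m = MB \<Longrightarrow> M2 rMM = M rMM" "m = MU \<Longrightarrow> M2 rI0 = M rI0 \<and> M2 rI1 = M rI1"
      using M2 lpq[of 0] lpq[of 1] lpq[of 2] lpq[of 3] lpq[of 4] lpq[of 7] lpq[of 8] regs
      unfolding M1_def by (auto simp: temp_reg_def)
  qed
  have inp2: "\<forall>v. (if v < length inp then inp ! v else 0) = input_val m M2 v"
    using inp M2r(6,7) by (cases m) auto
  obtain M3 where s3: "run_straight inp' cap cap (value_code m R i) M2 = Some M3" and M3v: "M3 rV = write_val inp i Mo"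
    and M3: "\<forall>q. q \<noteq> rT \<and> q \<noteq> rX1 \<and> q \<noteq> rX2 \<and> q \<noteq> rX3 \<and> q \<noteq> rV \<longrightarrow> M3 q = M2 q"
    using run_value_code[OF M2r(1-5) R cp _ _ inp2 w ok vb mob, of inp'] mb mu M2r(6,7) by auto
  have M3x: "M3 rX = ?x"
  proof -
    from M2x show ?thesis using M3 unfolding M1_def by simp
  qed
  define M4 where "M4 = M3(?x := write_val inp i Mo)"
  have vc: "write_val inp i Mo < cap" using vb cp by linarith
  have s4: "run_straight inp' cap cap [Store rX rV] M3 = Some M4"
    unfolding M4_def using M3x M3v rc xb vc by simp
  define k where "k = block_size - length (instr_block m R off len fnd i)"
  have s5: "run_straight inp' cap cap (replicate k (Const rT 0)) M4 = Some (if k = 0 then M4 else M4(rT := 0))"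
    using rc cp by (intro run_padding) auto
  define M' where "M' = (if k = 0 then M4 else M4(rT := 0))"
  have pe: "pad_block (instr_block m R off len fnd i) = (addr_code R i @ log_code m @ value_code m R i @ [Store rX rV]) @ replicate k (Const rT 0)"
    unfolding pad_block_def k_def by (simp only: instr_block)
  have sall: "run_straight inp' cap cap (pad_block (instr_block m R off len fnd i)) M = Some M'"
    unfolding pe M'_def run_straight_append using s1 s2 s3 s4 s5 by simp
  from steps_run_straight[OF ca sall, of Os t W] obtain W' where
    ex: "steps Q inp' cap cap block_size (pc, M, Os, t, W) = Some (pc + block_size, M', Os, t + block_size, W')" by auto
  have x15: "?x \<noteq> rT" using R by auto
  have A: "M' ?x = write_val inp i Mo" unfolding M'_def M4_def using x15 by auto
  have B: "\<forall>q. \<not> temp_reg q \<and> q \<noteq> ?x \<and> (m = ME \<longrightarrow> q \<noteq> lp \<and> q \<noteq> lp + 1) \<longrightarrow> M' q = M q"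
  proof (intro allI impI)
    fix q assume q: "\<not> temp_reg q \<and> q \<noteq> ?x \<and> (m = ME \<longrightarrow> q \<noteq> lp \<and> q \<noteq> lp + 1)"
    hence "q \<noteq> rT" "q \<noteq> rX1" "q \<noteq> rX2" "q \<noteq> rX3" "q \<noteq> rV" "q \<noteq> rX" by (auto simp: temp_reg_def)
    hence "M' q = M2 q" unfolding M'_def M4_def using M3 q by auto
    also have "\<dots> = M q" using M2 q unfolding M1_def by (auto simp: temp_reg_def)
    finally show "M' q = M q" .
  qed
  have C: "m = ME \<longrightarrow> M' lp = ?x \<and> M' (lp + 1) = M ?x \<and> M' rLP = lp + 2"
  proof
    assume mE: "m = ME"
    with me have lp: "log_base \<le> lp" "lp + 2 < R" by auto
    have "lp \<noteq> rT \<and> lp \<noteq> rX1 \<and> lp \<noteq> rX2 \<and> lp \<noteq> rX3 \<and> lp \<noteq> rV \<and> lp \<noteq> ?x \<and> lp + 1 \<noteq> ?x" using lp by auto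
    moreover have "lp + 1 \<noteq> rT \<and> lp + 1 \<noteq> rX1 \<and> lp + 1 \<noteq> rX2 \<and> lp + 1 \<noteq> rX3 \<and> lp + 1 \<noteq> rV" using lp by auto
    ultimately show "M' lp = ?x \<and> M' (lp + 1) = M ?x \<and> M' rLP = lp + 2"
      unfolding M'_def M4_def using M3 M2e mE R by auto
  qed
  from ex A B C show ?thesis by blast
qed



section \<open>Simulating compiled programs\<close>

text \<open>Compiled code may overwrite scratch cells freely; the ds_cell cells hold the relocated
  memory of the simulated program.\<close>
definition scratch :: "nat \<Rightarrow> nat \<Rightarrow> bool" where "scratch R q \<longleftrightarrow> 13 \<le> q \<and> q < R"
definition ds_cell :: "nat \<Rightarrow> nat \<Rightarrow> nat \<Rightarrow> bool" where "ds_cell R amax q \<longleftrightarrow> R \<le> q \<and> q < R + amax"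

definition undo :: "(nat \<times> nat) list \<Rightarrow> mem \<Rightarrow> mem" where
  "undo lg M = foldr (\<lambda>e M. M(fst e := snd e)) lg M"

lemma undo_snoc: "undo (lg @ [e]) M = undo lg (M(fst e := snd e))"
  by (simp add: undo_def)
lemma undo_Nil[simp]: "undo [] M = M" by (simp add: undo_def)

lemma undo_agree:
  assumes "\<forall>q. \<not> scratch R q \<longrightarrow> M1 q = M2 q" "\<forall>e\<in>set lg. \<not> scratch R (fst e)"
  shows "\<forall>q. \<not> scratch R q \<longrightarrow> undo lg M1 q = undo lg M2 q"
  using assms by (induction lg) (auto simp: undo_def)

text \<open>Entry j of the log occupies the cells log_base + 2 j (address) and log_base + 2 j + 1
  (previous value); undoing the whole log restores the memory Mst at the start of the
  enumeration.\<close>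
definition log_inv :: "nat \<Rightarrow> nat \<Rightarrow> mem \<Rightarrow> (nat \<times> nat) list \<Rightarrow> mem \<Rightarrow> bool" where
  "log_inv R amax Mst lg M \<longleftrightarrow> M rLP = log_base + 2 * length lg \<and>
     (\<forall>j<length lg. M (log_base + 2 * j) = fst (lg ! j) \<and> M (log_base + 2 * j + 1) = snd (lg ! j)) \<and>
     (\<forall>e\<in>set lg. R \<le> fst e \<and> fst e < R + amax) \<and>
     (\<forall>q. \<not> scratch R q \<longrightarrow> undo lg M q = Mst q)"

definition sim_ctx :: "mode \<Rightarrow> nat \<Rightarrow> nat \<Rightarrow> nat \<Rightarrow> nat \<Rightarrow> nat \<Rightarrow> mem \<Rightarrow> nat list \<Rightarrow> bool" where
  "sim_ctx m R cap capo amax Bd Mst inp \<longleftrightarrow> Mst rZ = 0 \<and> Mst rONE = 1 \<and> Mst rTHREE = 3 \<and> Mst rRR = R \<and>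
     log_base + 2 * Bd < R \<and> R + amax \<le> cap \<and> capo \<le> cap \<and> 4 \<le> cap \<and>
     (m = MB \<longrightarrow> 1 \<le> Mst rMM \<and> Mst rMM < cap) \<and> (m = MU \<longrightarrow> Mst rI0 < cap \<and> Mst rI1 < cap) \<and>
     (\<forall>v. (if v < length inp then inp ! v else 0) = input_val m Mst v)"

definition sim_rel :: "mode \<Rightarrow> nat \<Rightarrow> nat \<Rightarrow> nat \<Rightarrow> nat \<Rightarrow> mem \<Rightarrow> (nat \<times> nat) list \<Rightarrow> nat \<Rightarrow> mem \<Rightarrow> nat \<Rightarrow> mem \<Rightarrow> nat \<Rightarrow> bool" where
  "sim_rel m R amax off len Mst lg p Mo t Mc pc \<longleftrightarrow> pc = off + block_size * min p len \<and> relocated R amax Mo Mc \<and>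
     (\<forall>q. \<not> scratch R q \<and> \<not> ds_cell R amax q \<longrightarrow> Mc q = Mst q) \<and>
     (m = ME \<longrightarrow> log_inv R amax Mst lg Mc \<and> length lg \<le> t)"

lemma sim_rel_low_regs:
  assumes "sim_rel m R amax off len Mst lg p Mo t Mc pc" "q < 13" "13 \<le> R"
  shows "Mc q = Mst q"
  using assms by (auto simp: sim_rel_def scratch_def ds_cell_def)

lemma sim_rel_clobber_rT:
  assumes "sim_rel m R amax off len Mst lg p Mo t Mc pc" "t \<le> t'" "log_base \<le> R"
  shows "sim_rel m R amax off len Mst lg p' Mo t' (Mc(rT := v)) (off + block_size * min p' len)"
proof -
  have s15: "scratch R rT" using assms(3) by (simp add: scratch_def)
  have mr: "relocated R amax Mo (Mc(rT := v))" using assms(1,3) by (auto simp: sim_rel_def relocated_def)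
  have pr: "\<forall>q. \<not> scratch R q \<and> \<not> ds_cell R amax q \<longrightarrow> (Mc(rT := v)) q = Mst q"
    using assms(1) s15 by (auto simp: sim_rel_def)
  have lgi: "m = ME \<longrightarrow> log_inv R amax Mst lg (Mc(rT := v)) \<and> length lg \<le> t'"
  proof
    assume mE: "m = ME"
    with assms(1) have li: "log_inv R amax Mst lg Mc" "length lg \<le> t" by (auto simp: sim_rel_def)
    have "\<forall>q. \<not> scratch R q \<longrightarrow> undo lg (Mc(rT := v)) q = undo lg Mc q"
      using li(1) s15 by (intro undo_agree) (auto simp: log_inv_def scratch_def)
    with li assms(2,3) show "log_inv R amax Mst lg (Mc(rT := v)) \<and> length lg \<le> t'"
      unfolding log_inv_def by auto
  qed
  from mr pr lgi show ?thesis by (simp add: sim_rel_def)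
qed

lemma log_inv_snoc:
  assumes li: "log_inv R amax Mst lg Mc" and x: "R \<le> x" "x < R + amax"
    and lp: "Mc rLP + 2 < R" and R: "log_base \<le> R"
    and keep: "\<forall>q. \<not> temp_reg q \<and> q \<noteq> x \<and> q \<noteq> Mc rLP \<and> q \<noteq> Mc rLP + 1 \<longrightarrow> Mc' q = Mc q"
    and log: "Mc' (Mc rLP) = x" "Mc' (Mc rLP + 1) = Mc x" "Mc' rLP = Mc rLP + 2"
  shows "log_inv R amax Mst (lg @ [(x, Mc x)]) Mc'"
proof -
  let ?lg = "lg @ [(x, Mc x)]"
  have lpe: "Mc rLP = log_base + 2 * length lg" using li by (simp add: log_inv_def)
  have nsx: "\<And>q. \<not> scratch R q \<Longrightarrow> \<not> temp_reg q \<and> q \<noteq> Mc rLP \<and> q \<noteq> Mc rLP + 1"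
    using lp lpe R by (fastforce simp: scratch_def temp_reg_def)
  have "Mc' rLP = log_base + 2 * length ?lg" using log(3) lpe by simp
  moreover have "\<forall>j<length ?lg. Mc' (log_base + 2 * j) = fst (?lg ! j) \<and> Mc' (log_base + 2 * j + 1) = snd (?lg ! j)"
  proof (intro allI impI)
    fix j assume j: "j < length ?lg"
    show "Mc' (log_base + 2 * j) = fst (?lg ! j) \<and> Mc' (log_base + 2 * j + 1) = snd (?lg ! j)"
    proof (cases "j < length lg")
      case True
      have "log_base + 2 * j \<noteq> Mc rLP" "log_base + 2 * j \<noteq> Mc rLP + 1"
        "log_base + 2 * j + 1 \<noteq> Mc rLP" "log_base + 2 * j + 1 \<noteq> Mc rLP + 1"
        "log_base + 2 * j \<noteq> x" "log_base + 2 * j + 1 \<noteq> x"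
        "\<not> temp_reg (log_base + 2 * j)" "\<not> temp_reg (log_base + 2 * j + 1)"
        using True lpe lp x by (auto simp: temp_reg_def)
      then have "Mc' (log_base + 2 * j) = Mc (log_base + 2 * j)" "Mc' (log_base + 2 * j + 1) = Mc (log_base + 2 * j + 1)"
        using keep by auto
      then show ?thesis using li True by (auto simp: log_inv_def nth_append)
    next
      case False
      hence "j = length lg" using j by simp
      then show ?thesis using log lpe by (simp add: nth_append)
    qed
  qed
  moreover have "\<forall>e\<in>set ?lg. R \<le> fst e \<and> fst e < R + amax" using li x by (auto simp: log_inv_def)
  moreover have "\<forall>q. \<not> scratch R q \<longrightarrow> undo ?lg Mc' q = Mst q"
  proof -
    have ag: "\<forall>q. \<not> scratch R q \<longrightarrow> (Mc'(x := Mc x)) q = Mc q"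
      using keep nsx by auto
    have "\<forall>e\<in>set lg. \<not> scratch R (fst e)" using li by (auto simp: log_inv_def scratch_def)
    from undo_agree[OF ag this] have ua: "\<forall>q. \<not> scratch R q \<longrightarrow> undo lg (Mc'(x := Mc x)) q = undo lg Mc q" .
    have "undo ?lg Mc' = undo lg (Mc'(x := Mc x))" by (simp add: undo_snoc)
    with ua li show ?thesis unfolding log_inv_def by metis
  qed
  ultimately show ?thesis unfolding log_inv_def by blast
qed

lemma sim_write:
  assumes cx: "sim_ctx m R cap capo amax Bd Mst inp"
    and seg: "code_at Q off (compile m R off fnd P)" and pl: "p < length P"
    and w: "is_write (P ! p)"
    and st: "step P inp capo amax (p, Mo, Os, t, W) = Some (p', Mo', Os', t', W')"
    and rel: "sim_rel m R amax off (length P) Mst lg p Mo t Mc pc" and mob: "\<forall>a. Mo a < capo"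
    and me: "m = ME \<Longrightarrow> t < Bd"
  shows "\<exists>k lg' Mc' Wc'. k \<le> block_size \<and> steps Q inp' cap cap k (pc, Mc, Osc, tc, Wc) =
      Some (off + block_size * min p' (length P), Mc', Osc, tc + k, Wc') \<and>
      sim_rel m R amax off (length P) Mst lg' p' Mo' t' Mc' (off + block_size * min p' (length P))"
proof -
  let ?i = "P ! p" let ?len = "length P"
  from step_write[OF pl w st] have o: "p' = Suc p" "Mo' = Mo(write_addr ?i Mo := write_val inp ?i Mo)" "Os' = Os" "t' = Suc t"
    "write_addr ?i Mo < amax" "write_val inp ?i Mo < capo" "operands_ok ?i Mo amax" by auto
  from cx have c: "Mst rZ = 0" "Mst rONE = 1" "Mst rTHREE = 3" "Mst rRR = R" "log_base + 2 * Bd < R"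
    "R + amax \<le> cap" "capo \<le> cap" "4 \<le> cap" "m = MB \<longrightarrow> 1 \<le> Mst rMM \<and> Mst rMM < cap"
    "m = MU \<longrightarrow> Mst rI0 < cap \<and> Mst rI1 < cap" "\<forall>v. (if v < length inp then inp ! v else 0) = input_val m Mst v"
    unfolding sim_ctx_def by auto
  have R13: "13 \<le> R" "log_base \<le> R" using c(5) by auto
  have rg: "\<And>q. q < 13 \<Longrightarrow> Mc q = Mst q" using sim_rel_low_regs[OF rel _ R13(1)] by auto
  have pc: "pc = off + block_size * p" using rel pl by (simp add: sim_rel_def)
  have ca: "code_at Q pc (pad_block (instr_block m R off ?len fnd ?i))" using compile_code_at_block[OF seg pl] pc by simp
  have mr: "relocated R amax Mo Mc" using rel by (simp add: sim_rel_def)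
  have inp: "\<forall>v. (if v < length inp then inp ! v else 0) = input_val m Mc v"
    using c(11) rg[of rMM] rg[of rI0] rg[of rI1] by (cases m) auto
  let ?lp = "Mc rLP"
  have meq: "m = ME \<Longrightarrow> log_inv R amax Mst lg Mc \<and> length lg \<le> t" using rel by (simp add: sim_rel_def)
  have lpv: "m = ME \<Longrightarrow> ?lp = log_base + 2 * length lg" using meq by (simp add: log_inv_def)
  have me2: "m = ME \<Longrightarrow> Mc rLP = ?lp \<and> log_base \<le> ?lp \<and> ?lp + 2 < R"
  proof -
    assume mE: "m = ME"
    with meq me have "length lg < Bd" by fastforce
    with lpv[OF mE] c(5) show ?thesis by auto
  qed
  have r4: "Mc rZ = 0" "Mc rONE = 1" "Mc rTHREE = 3" "Mc rRR = R" using rg c by auto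
  have mb: "m = MB \<Longrightarrow> 1 \<le> Mc rMM \<and> Mc rMM < cap" using rg[of rMM] c(9) by auto
  have mu: "m = MU \<Longrightarrow> Mc rI0 < cap \<and> Mc rI1 < cap" using rg[of rI0] rg[of rI1] c(10) by auto
  from steps_write_block[OF ca mr r4 R13(2) c(6) c(7) c(8) mb mu inp w o(7) o(6) mob o(5) me2, where Os=Osc and t=tc and W=Wc and inp'=inp']
  obtain Mc' Wc' where ex: "steps Q inp' cap cap block_size (pc, Mc, Osc, tc, Wc) = Some (pc + block_size, Mc', Osc, tc + block_size, Wc')"
    and A: "Mc' (write_addr ?i Mo + R) = write_val inp ?i Mo"
    and B: "\<forall>q. \<not> temp_reg q \<and> q \<noteq> write_addr ?i Mo + R \<and> (m = ME \<longrightarrow> q \<noteq> ?lp \<and> q \<noteq> ?lp + 1) \<longrightarrow> Mc' q = Mc q"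
    and C: "m = ME \<longrightarrow> Mc' ?lp = write_addr ?i Mo + R \<and> Mc' (?lp + 1) = Mc (write_addr ?i Mo + R) \<and> Mc' rLP = ?lp + 2"
    by auto
  let ?x = "write_addr ?i Mo + R"
  have xds: "R \<le> ?x" "?x < R + amax" using o(5) by auto
  have lpb: "m = ME \<Longrightarrow> log_base \<le> ?lp \<and> ?lp + 2 < R" using me2 by auto
  have mr': "relocated R amax Mo' Mc'"
    unfolding relocated_def
  proof (intro allI impI)
    fix a assume a: "a < amax"
    show "Mc' (a + R) = Mo' a"
    proof (cases "a = write_addr ?i Mo")
      case True then show ?thesis using A o(2) by simp
    next
      case False
      have "\<not> temp_reg (a + R)" using R13 by (auto simp: temp_reg_def)
      moreover have "m = ME \<longrightarrow> a + R \<noteq> ?lp \<and> a + R \<noteq> ?lp + 1" using lpb by fastforce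
      ultimately have "Mc' (a + R) = Mc (a + R)" using B False by auto
      also have "\<dots> = Mo a" using mr a by (simp add: relocated_def)
      finally show ?thesis using o(2) False by simp
    qed
  qed
  have nsx: "\<And>q. \<not> scratch R q \<Longrightarrow> \<not> temp_reg q \<and> (m = ME \<longrightarrow> q \<noteq> ?lp \<and> q \<noteq> ?lp + 1)"
    using lpb R13 by (fastforce simp: scratch_def temp_reg_def)
  have pr': "\<forall>q. \<not> scratch R q \<and> \<not> ds_cell R amax q \<longrightarrow> Mc' q = Mst q"
  proof (intro allI impI)
    fix q assume q: "\<not> scratch R q \<and> \<not> ds_cell R amax q"
    hence "q \<noteq> ?x" using xds by (auto simp: ds_cell_def)
    with nsx q B have "Mc' q = Mc q" by auto
    also have "\<dots> = Mst q" using rel q by (simp add: sim_rel_def)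
    finally show "Mc' q = Mst q" .
  qed
  have lg': "m = ME \<longrightarrow> log_inv R amax Mst (lg @ [(?x, Mc ?x)]) Mc' \<and> length (lg @ [(?x, Mc ?x)]) \<le> t'"
  proof
    assume mE: "m = ME"
    with meq have li: "log_inv R amax Mst lg Mc" "length lg \<le> t" by auto
    have "log_inv R amax Mst (lg @ [(?x, Mc ?x)]) Mc'"
      using log_inv_snoc[OF li(1) xds _ R13(2)] lpb[OF mE] B C mE by auto
    with li(2) o(4) show "log_inv R amax Mst (lg @ [(?x, Mc ?x)]) Mc' \<and> length (lg @ [(?x, Mc ?x)]) \<le> t'"
      by simp
  qed
  have pcs: "off + block_size * min p' ?len = pc + block_size" using o(1) pl pc by (simp add: algebra_simps)
  have "sim_rel m R amax off ?len Mst (if m = ME then lg @ [(?x, Mc ?x)] else lg) p' Mo' t' Mc' (off + block_size * min p' ?len)"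
    unfolding sim_rel_def using mr' pr' lg' by auto
  then show ?thesis using pcs ex by (metis order_refl)
qed

lemma sim_rel_move:
  assumes "sim_rel m R amax off len Mst lg p Mo t Mc pc" "t \<le> t'"
  shows "sim_rel m R amax off len Mst lg p' Mo t' Mc (off + block_size * min p' len)"
  using assms by (auto simp: sim_rel_def)

lemma step_JmpD: "p < length P \<Longrightarrow> P ! p = Jmp l \<Longrightarrow> step P inp cap amax (p, Mo, Os, t, W) = Some (p', Mo', Os', t', W') \<Longrightarrow>
   p' = l \<and> Mo' = Mo \<and> t' = Suc t"
  by (simp add: step_def)
lemma step_JzD: "p < length P \<Longrightarrow> P ! p = Jz a l \<Longrightarrow> step P inp cap amax (p, Mo, Os, t, W) = Some (p', Mo', Os', t', W') \<Longrightarrow>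
   a < amax \<and> p' = (if Mo a = 0 then l else Suc p) \<and> Mo' = Mo \<and> t' = Suc t"
  by (simp add: step_def split: if_split_asm)
lemma step_OutD: "p < length P \<Longrightarrow> P ! p = Out a b \<Longrightarrow> step P inp cap amax (p, Mo, Os, t, W) = Some (p', Mo', Os', t', W') \<Longrightarrow>
   p' = Suc p \<and> Mo' = Mo \<and> t' = Suc t"
  by (simp add: step_def split: if_split_asm)

lemma steps_padding:
  assumes "code_at Q pc (xs @ replicate (block_size - length xs) (Const rT 0))" "length xs < block_size"
    and "rT < cap"
  shows "\<exists>W'. steps Q inp cap cap (block_size - length xs) (pc + length xs, M, Os, t, W) =
    Some (pc + block_size, M(rT := 0), Os, t + (block_size - length xs), W')"
proof -
  from assms(1) have c2: "code_at Q (pc + length xs) (replicate (block_size - length xs) (Const rT 0))"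
    by (simp add: code_at_append)
  have "run_straight inp cap cap (replicate (block_size - length xs) (Const rT 0)) M = Some (M(rT := 0))"
    using run_padding[of cap inp "block_size - length xs" M] assms(2,3) by auto
  from steps_run_straight[OF c2 this, of Os t W] show ?thesis using assms(2) by auto
qed

lemma sim_Jz:
  assumes cx: "sim_ctx m R cap capo amax Bd Mst inp"
    and seg: "code_at Q off (compile m R off fnd P)" and pl: "p < length P" and jz: "P ! p = Jz a l"
    and st: "step P inp capo amax (p, Mo, Os, t, W) = Some (p', Mo', Os', t', W')"
    and rel: "sim_rel m R amax off (length P) Mst lg p Mo t Mc pc"
  shows "\<exists>k Mc' Wc'. k \<le> block_size \<and> steps Q inp' cap cap k (pc, Mc, Osc, tc, Wc) =
      Some (off + block_size * min p' (length P), Mc', Osc, tc + k, Wc') \<and>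
      sim_rel m R amax off (length P) Mst lg p' Mo' t' Mc' (off + block_size * min p' (length P))"
proof -
  let ?len = "length P" let ?l = "block_addr off (length P) l"
  have R: "log_base \<le> R" "R + amax \<le> cap" using cx by (auto simp: sim_ctx_def)
  have pc: "pc = off + block_size * p" using rel pl by (simp add: sim_rel_def)
  have mr: "relocated R amax Mo Mc" using rel by (simp add: sim_rel_def)
  from step_JzD[OF pl jz st] have o: "a < amax" "p' = (if Mo a = 0 then l else Suc p)" "Mo' = Mo" "t' = Suc t" by auto
  have cz: "code_at Q pc ([Jz (a + R) ?l] @ replicate (block_size - length [Jz (a + R) ?l]) (Const rT 0))"
    using compile_code_at_block[OF seg pl] pc jz by (simp add: pad_block_def instr_block_def)
  have "pc < length Q" "Q ! pc = Jz (a + R) ?l" using cz by (auto simp: code_at_Cons)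
  moreover have "a + R < cap" using R o(1) by linarith
  ultimately have s1: "step Q inp' cap cap (pc, Mc, Osc, tc, Wc) = Some (if Mo a = 0 then ?l else Suc pc, Mc, Osc, Suc tc, Wc)"
    using step_Jz mr o(1) by (auto simp: relocated_def)
  show ?thesis
  proof (cases "Mo a = 0")
    case True
    have "steps Q inp' cap cap 1 (pc, Mc, Osc, tc, Wc) = Some (?l, Mc, Osc, tc + 1, Wc)" using s1 True by simp
    moreover have "sim_rel m R amax off ?len Mst lg p' Mo' t' Mc (off + block_size * min p' ?len)"
      using sim_rel_move[OF rel, of t' p'] o by auto
    ultimately show ?thesis using o True by (intro exI[of _ 1]) (auto simp: block_addr_def block_size_def)
  next
    case False
    from steps_padding[OF cz, where cap = cap and inp = inp' and M = Mc and Os = Osc and t = "Suc tc" and W = Wc] R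
    obtain Wc' where "steps Q inp' cap cap (block_size - 1) (Suc pc, Mc, Osc, Suc tc, Wc) =
        Some (pc + block_size, Mc(rT := 0), Osc, Suc tc + (block_size - 1), Wc')"
      by (auto simp: block_size_def)
    with s1 False have "steps Q inp' cap cap (1 + (block_size - 1)) (pc, Mc, Osc, tc, Wc) =
        Some (pc + block_size, Mc(rT := 0), Osc, Suc tc + (block_size - 1), Wc')"
      by (intro steps_trans[of _ _ _ _ 1]) auto
    moreover have "1 + (block_size - 1) = block_size" "Suc tc + (block_size - 1) = tc + block_size"
      by (auto simp: block_size_def)
    moreover have "pc + block_size = off + block_size * min p' ?len" using o(2) False pl pc by (simp add: algebra_simps)
    moreover have "sim_rel m R amax off ?len Mst lg p' Mo' t' (Mc(rT := 0)) (off + block_size * min p' ?len)"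
      using sim_rel_clobber_rT[OF rel, of t' p'] o R by auto
    ultimately show ?thesis by (metis order_refl)
  qed
qed

lemma sim_step:
  assumes cx: "sim_ctx m R cap capo amax Bd Mst inp"
    and seg: "code_at Q off (compile m R off fnd P)" and pl: "p < length P"
    and st: "step P inp capo amax (p, Mo, Os, t, W) = Some (p', Mo', Os', t', W')"
    and rel: "sim_rel m R amax off (length P) Mst lg p Mo t Mc pc" and mob: "\<forall>a. Mo a < capo"
    and me: "m = ME \<Longrightarrow> t < Bd \<and> (\<forall>a b. P ! p \<noteq> Out a b)"
  shows "\<exists>k lg' Mc' Wc'. k \<le> block_size \<and> steps Q inp' cap cap k (pc, Mc, Osc, tc, Wc) =
      Some (off + block_size * min p' (length P), Mc', Osc, tc + k, Wc') \<and>
      sim_rel m R amax off (length P) Mst lg' p' Mo' t' Mc' (off + block_size * min p' (length P))"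
proof -
  let ?i = "P ! p" let ?len = "length P"
  have R: "log_base \<le> R" "R + amax \<le> cap" using cx by (auto simp: sim_ctx_def)
  have pc: "pc = off + block_size * p" using rel pl by (simp add: sim_rel_def)
  have ca: "code_at Q pc (pad_block (instr_block m R off ?len fnd ?i))" using compile_code_at_block[OF seg pl] pc by simp
  show ?thesis
  proof (cases "is_write ?i")
    case True
    have "m = ME \<Longrightarrow> t < Bd" using me by auto
    from sim_write[OF cx seg pl True st rel mob this] show ?thesis .
  next
    case False
    then consider l where "?i = Jmp l" | a l where "?i = Jz a l" | a b where "?i = Out a b"
      by (cases ?i) auto
    then show ?thesis
    proof cases
      case (1 l)
      from step_JmpD[OF pl 1 st] have o: "p' = l" "Mo' = Mo" "t' = Suc t" by auto
      have "pc < length Q" "Q ! pc = Jmp (block_addr off ?len l)" using ca 1 by (auto simp: code_at_Cons pad_block_def instr_block_def)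
      from step_Jmp[OF this] have "steps Q inp' cap cap 1 (pc, Mc, Osc, tc, Wc) = Some (block_addr off ?len l, Mc, Osc, tc + 1, Wc)" by simp
      moreover have "sim_rel m R amax off ?len Mst lg p' Mo' t' Mc (off + block_size * min p' ?len)"
        using sim_rel_move[OF rel, of t' p'] o by auto
      ultimately show ?thesis using o by (intro exI[of _ 1]) (auto simp: block_addr_def block_size_def)
    next
      case (2 a l)
      from sim_Jz[OF cx seg pl 2 st rel] show ?thesis by blast
    next
      case (3 a b)
      with me have nME: "m \<noteq> ME" by auto
      from step_OutD[OF pl 3 st] have o: "p' = Suc p" "Mo' = Mo" "t' = Suc t" by auto
      have cz: "code_at Q pc ([] @ replicate (block_size - length []) (Const rT 0))"
        using ca 3 nME by (simp add: pad_block_def instr_block_def)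
      from steps_padding[OF cz, where cap = cap and inp = inp' and M = Mc and Os = Osc and t = tc and W = Wc] R
      obtain Wc' where "steps Q inp' cap cap block_size (pc, Mc, Osc, tc, Wc) = Some (pc + block_size, Mc(rT := 0), Osc, tc + block_size, Wc')"
        by (auto simp: block_size_def)
      moreover have "pc + block_size = off + block_size * min p' ?len" using o pl pc by (simp add: algebra_simps)
      moreover have "sim_rel m R amax off ?len Mst lg p' Mo' t' (Mc(rT := 0)) (off + block_size * min p' ?len)"
        using sim_rel_clobber_rT[OF rel, of t' p'] o R by auto
      ultimately show ?thesis by (metis order_refl)
    qed
  qed
qed

lemma step_mem_bounded:
  assumes "step P inp capo amax (p, Mo, Os, t, W) = Some (p', Mo', Os', t', W')" "\<forall>a. Mo a < capo"
  shows "\<forall>a. Mo' a < capo"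
proof (cases "p < length P")
  case True
  show ?thesis
  proof (cases "is_write (P ! p)")
    case True
    from step_write[OF \<open>p < length P\<close> True assms(1)] assms(2) show ?thesis by auto
  next
    case False
    then consider l where "P ! p = Jmp l" | a l where "P ! p = Jz a l" | a b where "P ! p = Out a b"
      by (cases "P ! p") auto
    then show ?thesis
    proof cases
      case 1 from step_JmpD[OF True 1 assms(1)] assms(2) show ?thesis by simp
    next
      case 2 from step_JzD[OF True 2 assms(1)] assms(2) show ?thesis by simp
    next
      case 3 from step_OutD[OF True 3 assms(1)] assms(2) show ?thesis by simp
    qed
  qed
next
  case False
  then show ?thesis using assms by (simp add: step_halt)
qed

lemma sim_steps:
  assumes cx: "sim_ctx m R cap capo amax Bd Mst inp"
    and seg: "code_at Q off (compile m R off fnd P)"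
    and st: "steps P inp capo amax k (p, Mo, Os, t, W) = Some (p', Mo', Os', t', W')"
    and rel: "sim_rel m R amax off (length P) Mst lg p Mo t Mc pc" and mob: "\<forall>a. Mo a < capo"
    and me: "m = ME \<Longrightarrow> t' \<le> Bd \<and> Os' = []"
  shows "\<exists>k' lg' Mc' Wc'. k' \<le> block_size * k \<and> steps Q inp' cap cap k' (pc, Mc, Osc, tc, Wc) =
      Some (off + block_size * min p' (length P), Mc', Osc, tc + k', Wc') \<and>
      sim_rel m R amax off (length P) Mst lg' p' Mo' t' Mc' (off + block_size * min p' (length P)) \<and> (\<forall>a. Mo' a < capo)"
  using st rel mob me
proof (induction k arbitrary: p Mo Os t W lg Mc pc tc Wc)
  case 0
  then show ?case by (intro exI[of _ 0]) (auto simp: sim_rel_def)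
next
  case (Suc k)
  from Suc.prems(1) obtain c1 where s1: "step P inp capo amax (p, Mo, Os, t, W) = Some c1"
    and r: "steps P inp capo amax k c1 = Some (p', Mo', Os', t', W')" by (auto split: Option.bind_splits)
  obtain p1 Mo1 Os1 t1 W1 where c1: "c1 = (p1, Mo1, Os1, t1, W1)" by (cases c1) auto
  show ?case
  proof (cases "p < length P")
    case False
    with s1 c1 have "c1 = (p, Mo, Os, t, W)" by (simp add: step_halt)
    with r have r': "steps P inp capo amax k (p, Mo, Os, t, W) = Some (p', Mo', Os', t', W')" by simp
    from Suc.IH[OF r' Suc.prems(2-4), of tc Wc] obtain k' lg' Mc' Wc' where
      "k' \<le> block_size * k" "steps Q inp' cap cap k' (pc, Mc, Osc, tc, Wc) = Some (off + block_size * min p' (length P), Mc', Osc, tc + k', Wc')"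
      "sim_rel m R amax off (length P) Mst lg' p' Mo' t' Mc' (off + block_size * min p' (length P)) \<and> (\<forall>a. Mo' a < capo)"
      by blast
    moreover have "block_size * k \<le> block_size * Suc k" by simp
    ultimately show ?thesis by (meson le_trans)
  next
    case True
    have t1: "t1 = Suc t" using step_time[OF s1[unfolded c1]] True by auto
    have tt: "t1 \<le> t'" using steps_time[OF r[unfolded c1]] by simp
    have me1: "m = ME \<Longrightarrow> t < Bd \<and> (\<forall>a b. P ! p \<noteq> Out a b)"
    proof -
      assume mE: "m = ME"
      with Suc.prems(4) have "t' \<le> Bd" "Os' = []" by auto
      moreover have "\<forall>a b. P ! p \<noteq> Out a b"
      proof (intro allI notI)
        fix a b assume "P ! p = Out a b"
        with s1 c1 True have "Os1 = Os @ [(Suc t, Mo a, Mo b)]"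
          by (simp add: step_def split: if_split_asm) (metis)
        hence "Os1 \<noteq> []" by simp
        with steps_Os_prefix[OF r[unfolded c1]] \<open>Os' = []\<close> show False by auto
      qed
      ultimately show ?thesis using t1 tt by auto
    qed
    from sim_step[OF cx seg True s1[unfolded c1] Suc.prems(2,3) me1, of inp' Osc tc Wc]
    obtain k1 lg1 Mc1 Wc1 where k1: "k1 \<le> block_size"
      and e1: "steps Q inp' cap cap k1 (pc, Mc, Osc, tc, Wc) = Some (off + block_size * min p1 (length P), Mc1, Osc, tc + k1, Wc1)"
      and r1: "sim_rel m R amax off (length P) Mst lg1 p1 Mo1 t1 Mc1 (off + block_size * min p1 (length P))" by blast
    have mob1: "\<forall>a. Mo1 a < capo" using step_mem_bounded[OF s1[unfolded c1] Suc.prems(3)] .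
    from Suc.IH[OF r[unfolded c1] r1 mob1 Suc.prems(4), of "tc + k1" Wc1]
    obtain k2 lg2 Mc2 Wc2 where k2: "k2 \<le> block_size * k"
      and e2: "steps Q inp' cap cap k2 (off + block_size * min p1 (length P), Mc1, Osc, tc + k1, Wc1) = Some (off + block_size * min p' (length P), Mc2, Osc, tc + k1 + k2, Wc2)"
      and r2: "sim_rel m R amax off (length P) Mst lg2 p' Mo' t' Mc2 (off + block_size * min p' (length P)) \<and> (\<forall>a. Mo' a < capo)"
      by blast
    from steps_trans[OF e1 e2] have "steps Q inp' cap cap (k1 + k2) (pc, Mc, Osc, tc, Wc) = Some (off + block_size * min p' (length P), Mc2, Osc, tc + (k1 + k2), Wc2)"
      by (simp add: add.assoc)
    moreover have "k1 + k2 \<le> block_size * Suc k" using k1 k2 by simp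
    ultimately show ?thesis using r2 by blast
  qed
qed



lemma sim_rel_init: "relocated R amax Mo Mst \<Longrightarrow> (m = ME \<Longrightarrow> Mst rLP = log_base) \<Longrightarrow> sim_rel m R amax off len Mst [] 0 Mo 0 Mst off"
  by (simp add: sim_rel_def log_inv_def)

lemma steps_compile_run:
  assumes cx: "sim_ctx m R cap capo amax Bd Mst inp" and seg: "code_at Q off (compile m R off fnd P)"
    and st: "steps P inp capo amax k (0, Mo, [], 0, W0) = Some (p', Mo', Os', t', W')"
    and hl: "length P \<le> p'" and mr: "relocated R amax Mo Mst" and mob: "\<forall>a. Mo a < capo" and nme: "m \<noteq> ME"
  shows "\<exists>k' Mc' Wc'. k' \<le> block_size * k \<and>
    steps Q inp' cap cap k' (off, Mst, Osc, tc, Wc) = Some (off + block_size * length P, Mc', Osc, tc + k', Wc') \<and>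
    relocated R amax Mo' Mc' \<and> (\<forall>q. \<not> scratch R q \<and> \<not> ds_cell R amax q \<longrightarrow> Mc' q = Mst q) \<and> (\<forall>a. Mo' a < capo)"
proof -
  from sim_steps[OF cx seg st sim_rel_init[OF mr] mob, of inp' Osc tc Wc] nme
  obtain k' lg' Mc' Wc' where "k' \<le> block_size * k"
    "steps Q inp' cap cap k' (off + block_size * min 0 (length P), Mst, Osc, tc, Wc) = Some (off + block_size * min p' (length P), Mc', Osc, tc + k', Wc')"
    "sim_rel m R amax off (length P) Mst lg' p' Mo' t' Mc' (off + block_size * min p' (length P))" "\<forall>a. Mo' a < capo"
    by auto
  moreover have "min p' (length P) = length P" using hl by simp
  ultimately show ?thesis by (auto simp: sim_rel_def)
qed

lemma gaps_le_first: "gaps_le Bd (0 # xs @ [T]) \<Longrightarrow> (xs = [] \<longrightarrow> T \<le> Bd) \<and> (xs \<noteq> [] \<longrightarrow> hd xs \<le> Bd)"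
proof -
  assume g: "gaps_le Bd (0 # xs @ [T])"
  from g have "(0 # xs @ [T]) ! Suc 0 - (0 # xs @ [T]) ! 0 \<le> Bd" unfolding gaps_le_def by (metis length_Cons length_append_singleton less_Suc_eq_0_disj zero_less_Suc)
  thus ?thesis by (cases xs) auto
qed

lemma steps_compile_enum:
  assumes cx: "sim_ctx ME R cap capo amax Bd Mst []" and seg: "code_at Q off (compile ME R off fnd P)"
    and rn: "run P [] capo amax fuel Mo = Some (M', Os, T, W)"
    and gp: "gaps_le Bd (0 # map fst Os @ [T])"
    and mr: "relocated R amax Mo Mst" and mob: "\<forall>a. Mo a < capo" and lp0: "Mst rLP = log_base"
  shows "\<exists>k' Mc' Wc' lg. k' \<le> block_size * Bd + 1 \<and>
    steps Q inp' cap cap k' (off, Mst, Osc, tc, Wc) = Some (if Os = [] then off + block_size * length P else fnd, Mc', Osc, tc + k', Wc') \<and>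
    log_inv R amax Mst lg Mc' \<and> length lg \<le> Bd \<and> (\<forall>q. \<not> scratch R q \<and> \<not> ds_cell R amax q \<longrightarrow> Mc' q = Mst q)"
proof -
  from rn obtain pf where st: "steps P [] capo amax fuel (0, Mo, [], 0, {}) = Some (pf, M', Os, T, W)" and hl: "length P \<le> pf"
    unfolding run_def by (auto split: option.splits if_splits)
  from gaps_le_first[OF gp] have g: "Os = [] \<longrightarrow> T \<le> Bd" "Os \<noteq> [] \<longrightarrow> fst (hd Os) \<le> Bd"
    by (auto simp: hd_map)
  show ?thesis
  proof (cases "Os = []")
    case True
    from steps_time[OF st] have st2: "steps P [] capo amax T (0, Mo, [], 0, {}) = Some (pf, M', Os, T, W)" by simp
    from sim_steps[OF cx seg st2 sim_rel_init[OF mr lp0] mob, of inp' Osc tc Wc] True g(1)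
    obtain k' lg' Mc' Wc' where "k' \<le> block_size * T"
      "steps Q inp' cap cap k' (off + block_size * min 0 (length P), Mst, Osc, tc, Wc) = Some (off + block_size * min pf (length P), Mc', Osc, tc + k', Wc')"
      "sim_rel ME R amax off (length P) Mst lg' pf M' T Mc' (off + block_size * min pf (length P))"
      by auto
    moreover have "min pf (length P) = length P" using hl by simp
    moreover have "block_size * T \<le> block_size * Bd" using True g(1) by simp
    ultimately have "k' \<le> block_size * Bd + 1" by linarith
    with \<open>steps Q inp' cap cap k' _ = _\<close> \<open>sim_rel ME R amax off (length P) Mst lg' pf M' T Mc' _\<close> \<open>min pf (length P) = length P\<close>
    show ?thesis using True g(1) unfolding sim_rel_def
      by (intro exI[of _ k'] exI[of _ Mc'] exI[of _ Wc'] exI[of _ lg']) auto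
  next
    case False
    from steps_first_output[OF st False] obtain j pcm Mm tm Wm a b where
      fo: "steps P [] capo amax j (0, Mo, [], 0, {}) = Some (pcm, Mm, [], tm, Wm)" "pcm < length P" "P ! pcm = Out a b"
        "fst (hd Os) = Suc tm" by blast
    from steps_time[OF fo(1)] have st2: "steps P [] capo amax tm (0, Mo, [], 0, {}) = Some (pcm, Mm, [], tm, Wm)" by simp
    have tmb: "tm < Bd" using g(2) False fo(4) by simp
    from sim_steps[OF cx seg st2 sim_rel_init[OF mr lp0] mob, of inp' Osc tc Wc] tmb
    obtain k' lg' Mc' Wc' where k': "k' \<le> block_size * tm"
      and e1: "steps Q inp' cap cap k' (off + block_size * min 0 (length P), Mst, Osc, tc, Wc) = Some (off + block_size * min pcm (length P), Mc', Osc, tc + k', Wc')"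
      and r: "sim_rel ME R amax off (length P) Mst lg' pcm Mm tm Mc' (off + block_size * min pcm (length P))"
      by auto
    have ca: "code_at Q (off + block_size * pcm) (pad_block (instr_block ME R off (length P) fnd (P ! pcm)))" by (rule compile_code_at_block[OF seg fo(2)])
    hence "off + block_size * pcm < length Q" "Q ! (off + block_size * pcm) = Jmp fnd" using fo(3) by (auto simp: pad_block_def instr_block_def code_at_Cons)
    from step_Jmp[OF this] have "steps Q inp' cap cap 1 (off + block_size * pcm, Mc', Osc, tc + k', Wc') = Some (fnd, Mc', Osc, Suc (tc + k'), Wc')" by simp
    with e1 fo(2) have "steps Q inp' cap cap (k' + 1) (off, Mst, Osc, tc, Wc) = Some (fnd, Mc', Osc, tc + (k' + 1), Wc')"
      using steps_trans by fastforce
    moreover have "k' + 1 \<le> block_size * Bd + 1" using k' tmb by (meson add_le_mono1 le_trans less_imp_le_nat mult_le_mono2)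
    ultimately show ?thesis using False r tmb unfolding sim_rel_def
      by (intro exI[of _ "k' + 1"] exI[of _ Mc'] exI[of _ Wc'] exI[of _ lg']) auto
  qed
qed



lemma steps_mem_bounded:
  assumes "steps P inp cap amax k (p, M, Os, t, W) = Some (p', M', Os', t', W')" "\<forall>a. M a < cap"
  shows "\<forall>a. M' a < cap"
  using assms
proof (induction k arbitrary: p M Os t W)
  case 0 then show ?case by simp
next
  case (Suc k)
  from Suc.prems(1) obtain c1 where s1: "step P inp cap amax (p, M, Os, t, W) = Some c1"
    and r: "steps P inp cap amax k c1 = Some (p', M', Os', t', W')" by (auto split: Option.bind_splits)
  obtain p1 M1 Os1 t1 W1 where c1: "c1 = (p1, M1, Os1, t1, W1)" by (cases c1) auto
  from step_mem_bounded[OF s1[unfolded c1] Suc.prems(2)] have "\<forall>a. M1 a < cap" .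
  with Suc.IH[of p1 M1 Os1 t1 W1] r c1 show ?case by auto
qed

section \<open>Undoing the writes of an enumeration\<close>

definition undo_code :: "nat \<Rightarrow> instr list" where
  "undo_code u = [Sub rT rLP rLB, Jz rT (u + 9), Sub rLP rLP rONE, Sub rLP rLP rONE, Add rT rLP rONE,
     Load rV rT, Load rX rLP, Store rX rV, Jmp u]"

lemma undo_code_at:
  assumes "code_at Q u (undo_code u)"
  shows "code_at Q u [Sub rT rLP rLB]" "code_at Q (u + 1) [Jz rT (u + 9)]"
    "code_at Q (u + 2) [Sub rLP rLP rONE, Sub rLP rLP rONE, Add rT rLP rONE, Load rV rT, Load rX rLP, Store rX rV]"
    "code_at Q (u + 8) [Jmp u]"
proof -
  have "undo_code u = [Sub rT rLP rLB] @ [Jz rT (u + 9)] @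
      [Sub rLP rLP rONE, Sub rLP rLP rONE, Add rT rLP rONE, Load rV rT, Load rX rLP, Store rX rV] @ [Jmp u]"
    by (simp add: undo_code_def)
  from assms[unfolded this code_at_append] show
    "code_at Q u [Sub rT rLP rLB]" "code_at Q (u + 1) [Jz rT (u + 9)]"
    "code_at Q (u + 2) [Sub rLP rLP rONE, Sub rLP rLP rONE, Add rT rLP rONE, Load rV rT, Load rX rLP, Store rX rV]"
    "code_at Q (u + 8) [Jmp u]"
    by (simp_all add: add.assoc numeral_eq_Suc)
qed

lemma steps_undo_code_exit:
  assumes ca: "code_at Q u (undo_code u)" and r: "M rLB = log_base" "M rLP = log_base" and cap: "log_base \<le> cap"
  shows "\<exists>W'. steps Q inp cap cap 2 (u, M, Os, t, W) = Some (u + 9, M(rT := 0), Os, t + 2, W')"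
proof -
  note c = undo_code_at[OF ca]
  have rc: "\<And>q. q \<le> 20 \<Longrightarrow> q < cap" using cap by linarith
  have "run_straight inp cap cap [Sub rT rLP rLB] M = Some (M(rT := 0))" using r rc by simp
  from steps_run_straight[OF c(1) this, of Os t W] obtain W1 where
    e1: "steps Q inp cap cap 1 (u, M, Os, t, W) = Some (u + 1, M(rT := 0), Os, t + 1, W1)" by auto
  have jz: "u + 1 < length Q" "Q ! (u + 1) = Jz rT (u + 9)" using c(2) by (auto simp: code_at_Cons)
  from step_Jz[OF jz, where amax = cap and cap = cap and inp = inp and M = "M(rT := 0)" and Os = Os and t = "t + 1" and W = W1] rc
  have "steps Q inp cap cap 1 (u + 1, M(rT := 0), Os, t + 1, W1) = Some (u + 9, M(rT := 0), Os, t + 2, W1)" by simp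
  from steps_trans[OF e1 this] show ?thesis by (auto simp only: one_add_one)
qed

lemma steps_undo_code_pop:
  assumes ca: "code_at Q u (undo_code u)"
    and r: "M rLB = log_base" "M rONE = 1" "M rLP = log_base + 2 * L + 2"
    and cells: "M (log_base + 2 * L) = a" "M (log_base + 2 * L + 1) = v"
    and a: "R \<le> a" "a < cap" and v: "v < cap" and lb: "log_base + 2 * L + 2 \<le> R" and R: "R \<le> cap"
  shows "\<exists>W'. steps Q inp cap cap 9 (u, M, Os, t, W) = Some (u, M(rT := log_base + 2 * L + 1,
    rLP := log_base + 2 * L, rV := v, rX := a, a := v), Os, t + 9, W')"
proof -
  note c = undo_code_at[OF ca]
  have rc: "\<And>q. q \<le> 20 \<Longrightarrow> q < cap" using lb R by linarith
  define T0 where "T0 = 2 * L + 2"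
  have "run_straight inp cap cap [Sub rT rLP rLB] M = Some (M(rT := T0))"
    using r rc R lb unfolding T0_def by simp
  from steps_run_straight[OF c(1) this, of Os t W] obtain W1 where
    e1: "steps Q inp cap cap 1 (u, M, Os, t, W) = Some (u + 1, M(rT := T0), Os, t + 1, W1)" by auto
  have jz: "u + 1 < length Q" "Q ! (u + 1) = Jz rT (u + 9)" using c(2) by (auto simp: code_at_Cons)
  from step_Jz[OF jz, where amax = cap and cap = cap and inp = inp and M = "M(rT := T0)" and Os = Os and t = "t + 1" and W = W1] rc
  have e2: "steps Q inp cap cap 1 (u + 1, M(rT := T0), Os, t + 1, W1) = Some (u + 2, M(rT := T0), Os, t + 2, W1)"
    by (simp add: T0_def)
  define M2 where "M2 = (M(rT := T0))(rLP := log_base + 2 * L + 1, rLP := log_base + 2 * L, rT := log_base + 2 * L + 1,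
     rV := v, rX := a, a := v)"
  have "run_straight inp cap cap [Sub rLP rLP rONE, Sub rLP rLP rONE, Add rT rLP rONE, Load rV rT, Load rX rLP, Store rX rV]
      (M(rT := T0)) = Some M2"
    using r rc R lb cells a v unfolding M2_def by (simp add: add.commute)
  from steps_run_straight[OF c(3) this, of Os "t + 2" W1] obtain W2 where
    e3: "steps Q inp cap cap 6 (u + 2, M(rT := T0), Os, t + 2, W1) = Some (u + 8, M2, Os, t + 8, W2)"
    by (auto simp: numeral_eq_Suc)
  have "u + 8 < length Q" "Q ! (u + 8) = Jmp u" using c(4) by (auto simp: code_at_Cons)
  from step_Jmp[OF this] have e4: "steps Q inp cap cap 1 (u + 8, M2, Os, t + 8, W2) = Some (u, M2, Os, t + 9, W2)"
    by simp
  have "M2 = M(rT := log_base + 2 * L + 1, rLP := log_base + 2 * L, rV := v, rX := a, a := v)"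
    unfolding M2_def by (simp add: fun_upd_twist)
  moreover have "(1::nat) + 1 + 6 + 1 = 9" by simp
  ultimately show ?thesis
    using steps_trans[OF steps_trans[OF steps_trans[OF e1 e2] e3] e4] by metis
qed

text \<open>The loop pops the log from its top, so the entries are restored in reverse order of
  writing, which yields the memory before the first write.\<close>
lemma steps_undo_code:
  assumes ca: "code_at Q u (undo_code u)"
    and r: "M rLB = log_base" "M rONE = 1" "M rLP = log_base + 2 * length lg"
    and cells: "\<forall>j<length lg. M (log_base + 2 * j) = fst (lg ! j) \<and> M (log_base + 2 * j + 1) = snd (lg ! j)"
    and addr: "\<forall>e\<in>set lg. R \<le> fst e \<and> fst e < cap"
    and lb: "log_base + 2 * length lg \<le> R" and vals: "\<forall>q. M q < cap" and R: "log_base \<le> R" "R \<le> cap"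
  shows "\<exists>k M' W'. k \<le> 9 * length lg + 2 \<and> steps Q inp cap cap k (u, M, Os, t, W) = Some (u + 9, M', Os, t + k, W') \<and>
    (\<forall>q. \<not> scratch R q \<longrightarrow> M' q = undo lg M q) \<and> (\<forall>q. M' q < cap)"
  using r cells addr lb vals
proof (induction lg arbitrary: M t W rule: rev_induct)
  case Nil
  have rc: "\<And>q. q \<le> 20 \<Longrightarrow> q < cap" using R by linarith
  have "M rLP = log_base" "log_base \<le> cap" using Nil.prems(3) R by simp_all
  from steps_undo_code_exit[where M = M and cap = cap, OF ca Nil.prems(1) this,
      where inp = inp and Os = Os and t = t and W = W] obtain W' where
    "steps Q inp cap cap 2 (u, M, Os, t, W) = Some (u + 9, M(rT := 0), Os, t + 2, W')" by auto
  moreover have "\<forall>q. \<not> scratch R q \<longrightarrow> (M(rT := 0)) q = undo [] M q" using R by (auto simp: scratch_def)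
  moreover have "\<forall>q. (M(rT := 0)) q < cap" using Nil rc by auto
  ultimately show ?case by (intro exI[of _ 2]) auto
next
  case (snoc e lg)
  let ?L = "length lg"
  have rc: "\<And>q. q \<le> 20 \<Longrightarrow> q < cap" using R by linarith
  have ce: "M (log_base + 2 * ?L) = fst e" "M (log_base + 2 * ?L + 1) = snd e"
    using snoc.prems(4)[rule_format, of ?L] by (auto simp: nth_append)
  have ea: "R \<le> fst e" "fst e < cap" using snoc.prems(5) by auto
  have lL: "log_base + 2 * ?L + 2 \<le> R" using snoc.prems(6) by simp
  have v1: "snd e < cap" using snoc.prems(7) ce(2) by metis
  define M2 where "M2 = M(rT := log_base + 2 * ?L + 1, rLP := log_base + 2 * ?L, rV := snd e, rX := fst e, fst e := snd e)"
  from steps_undo_code_pop[where M = M and cap = cap, OF ca snoc.prems(1,2) _ ce ea v1 lL R(2), where inp = inp and Os = Os and t = t and W = W] snoc.prems(3)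
  obtain W2 where e5: "steps Q inp cap cap 9 (u, M, Os, t, W) = Some (u, M2, Os, t + 9, W2)"
    unfolding M2_def by auto
  have fe: "fst e \<noteq> rLB" "fst e \<noteq> rONE" "fst e \<noteq> rLP" "fst e \<noteq> rT" "fst e \<noteq> rV" "fst e \<noteq> rX" using ea R by auto
  have p1: "M2 rLB = log_base" "M2 rONE = 1" "M2 rLP = log_base + 2 * ?L" unfolding M2_def using fe snoc.prems(1,2) by auto
  have p2: "\<forall>j<?L. M2 (log_base + 2 * j) = fst (lg ! j) \<and> M2 (log_base + 2 * j + 1) = snd (lg ! j)"
  proof (intro allI impI)
    fix j assume j: "j < ?L"
    have "log_base + 2 * j + 1 < R" using j lL by linarith
    hence "log_base + 2 * j \<noteq> fst e" "log_base + 2 * j + 1 \<noteq> fst e" using ea by auto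
    moreover have "M (log_base + 2 * j) = fst (lg ! j) \<and> M (log_base + 2 * j + 1) = snd (lg ! j)"
      using snoc.prems(4)[rule_format, of j] j by (auto simp: nth_append)
    ultimately show "M2 (log_base + 2 * j) = fst (lg ! j) \<and> M2 (log_base + 2 * j + 1) = snd (lg ! j)"
      unfolding M2_def by auto
  qed
  have p3: "\<forall>e\<in>set lg. R \<le> fst e \<and> fst e < cap" using snoc.prems(5) by auto
  have p4: "log_base + 2 * ?L \<le> R" using lL by simp
  have p5: "\<forall>q. M2 q < cap" using snoc.prems(7) rc v1 ea lL R unfolding M2_def by auto
  from snoc.IH[OF p1 p2 p3 p4 p5, of "t + 9" W2] obtain k M' W' where
    k: "k \<le> 9 * ?L + 2" and e6: "steps Q inp cap cap k (u, M2, Os, t + 9, W2) = Some (u + 9, M', Os, t + 9 + k, W')"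
    and m': "\<forall>q. \<not> scratch R q \<longrightarrow> M' q = undo lg M2 q" "\<forall>q. M' q < cap" by blast
  from steps_trans[OF e5 e6] have e7: "steps Q inp cap cap (9 + k) (u, M, Os, t, W) = Some (u + 9, M', Os, t + (9 + k), W')"
    by (simp add: add.assoc)
  have ag: "\<forall>q. \<not> scratch R q \<longrightarrow> M2 q = (M(fst e := snd e)) q"
    unfolding M2_def using R by (auto simp: scratch_def)
  have "\<forall>e\<in>set lg. \<not> scratch R (fst e)" using p3 by (auto simp: scratch_def)
  from undo_agree[OF ag this]
  have "\<forall>q. \<not> scratch R q \<longrightarrow> undo lg M2 q = undo (lg @ [e]) M q"
    unfolding undo_snoc .
  with m'(1) have "\<forall>q. \<not> scratch R q \<longrightarrow> M' q = undo (lg @ [e]) M q" by auto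
  moreover have "9 + k \<le> 9 * length (lg @ [e]) + 2" using k by simp
  ultimately show ?case using e7 m'(2) by blast
qed

section \<open>The prefix-U1 program\<close>

definition reach :: "instr list \<Rightarrow> nat list \<Rightarrow> nat \<Rightarrow> nat \<Rightarrow> nat \<times> mem \<times> (nat \<times> nat \<times> nat) list \<Rightarrow> nat \<times> mem \<times> (nat \<times> nat \<times> nat) list \<Rightarrow> bool" where
  "reach Q inp cap k c c' \<longleftrightarrow> (\<forall>t W. \<exists>W'. steps Q inp cap cap k (fst c, fst (snd c), snd (snd c), t, W) =
      Some (fst c', fst (snd c'), snd (snd c'), t + k, W'))"

lemma reach_trans: "reach Q inp cap k1 a b \<Longrightarrow> reach Q inp cap k2 b c \<Longrightarrow> reach Q inp cap (k1 + k2) a c"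
  unfolding reach_def
proof (intro allI)
  fix t W
  assume h1: "\<forall>t W. \<exists>W'. steps Q inp cap cap k1 (fst a, fst (snd a), snd (snd a), t, W) = Some (fst b, fst (snd b), snd (snd b), t + k1, W')"
    and h2: "\<forall>t W. \<exists>W'. steps Q inp cap cap k2 (fst b, fst (snd b), snd (snd b), t, W) = Some (fst c, fst (snd c), snd (snd c), t + k2, W')"
  from h1 obtain W1 where e1: "steps Q inp cap cap k1 (fst a, fst (snd a), snd (snd a), t, W) = Some (fst b, fst (snd b), snd (snd b), t + k1, W1)" by blast
  from h2 obtain W2 where e2: "steps Q inp cap cap k2 (fst b, fst (snd b), snd (snd b), t + k1, W1) = Some (fst c, fst (snd c), snd (snd c), t + k1 + k2, W2)" by blast
  from steps_trans[OF e1 e2] show "\<exists>W'. steps Q inp cap cap (k1 + k2) (fst a, fst (snd a), snd (snd a), t, W) = Some (fst c, fst (snd c), snd (snd c), t + (k1 + k2), W')"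
    by (auto simp: add.assoc)
qed

lemma reach_run_straight: "code_at Q pc xs \<Longrightarrow> run_straight inp cap cap xs M = Some M' \<Longrightarrow> reach Q inp cap (length xs) (pc, M, Os) (pc + length xs, M', Os)"
  unfolding reach_def using steps_run_straight by fastforce

lemma reach_run_straightI: "code_at Q pc xs \<Longrightarrow> run_straight inp cap cap xs M = Some M' \<Longrightarrow> length xs = n \<Longrightarrow> pc + n = pc' \<Longrightarrow>
   reach Q inp cap n (pc, M, Os) (pc', M', Os)"
  using reach_run_straight by blast

lemma reach_Jmp: "code_at Q pc [Jmp l] \<Longrightarrow> reach Q inp cap 1 (pc, M, Os) (l, M, Os)"
  unfolding reach_def by (auto simp: code_at_Cons step_Jmp)

lemma reach_Jz: "code_at Q pc [Jz a l] \<Longrightarrow> a < cap \<Longrightarrow> reach Q inp cap 1 (pc, M, Os) (if M a = 0 then l else Suc pc, M, Os)"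
  unfolding reach_def by (auto simp: code_at_Cons step_Jz)



lemma reach_run:
  assumes "reach Q inp cap k (0, M, []) (pc, M', Os)" "length Q \<le> pc" "k \<le> F"
  shows "\<exists>t W. run Q inp cap cap F M = Some (M', Os, t, W)"
proof -
  from assms(1) have "\<forall>t W. \<exists>W'. steps Q inp cap cap k (0, M, [], t, W) = Some (pc, M', Os, t + k, W')"
    unfolding reach_def by simp
  hence "\<exists>W'. steps Q inp cap cap k (0, M, [], 0, {}) = Some (pc, M', Os, 0 + k, W')" by blast
  then obtain W' where "steps Q inp cap cap k (0, M, [], 0, {}) = Some (pc, M', Os, k, W')" by auto
  from steps_mono_halt[OF this assms(2,3)] assms(2) show ?thesis unfolding run_def by auto
qed

lemma reach_run_out:
  assumes "reach Q inp cap k (0, M, []) (pc, M', [])" "code_at Q pc [Out a b]" "length Q \<le> Suc pc"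
    "a < cap" "b < cap" "Suc k \<le> F"
  shows "\<exists>t W Os. run Q inp cap cap F M = Some (M', Os, t, W) \<and> Os \<noteq> []"
proof -
  from assms(1) have "\<forall>t W. \<exists>W'. steps Q inp cap cap k (0, M, [], t, W) = Some (pc, M', [], t + k, W')"
    unfolding reach_def by simp
  hence "\<exists>W'. steps Q inp cap cap k (0, M, [], 0, {}) = Some (pc, M', [], 0 + k, W')" by blast
  then obtain W' where e1: "steps Q inp cap cap k (0, M, [], 0, {}) = Some (pc, M', [], k, W')" by auto
  have "pc < length Q" "Q ! pc = Out a b" using assms(2) by (auto simp: code_at_Cons)
  from step_Out[OF this assms(4,5)] have "steps Q inp cap cap 1 (pc, M', [], k, W') = Some (Suc pc, M', [(Suc k, M' a, M' b)], Suc k, W')"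
    by simp
  from steps_trans[OF e1 this] have "steps Q inp cap cap (Suc k) (0, M, [], 0, {}) = Some (Suc pc, M', [(Suc k, M' a, M' b)], Suc k, W')" by simp
  from steps_mono_halt[OF this assms(3,6)] assms(3) show ?thesis unfolding run_def by auto
qed



lemma step_indep:
  assumes "step Q inp cap amax (pc, M, Os, t, W) = Some (pc', M', Os, t', W')"
  shows "\<exists>W2'. step Q inp cap amax (pc, M, Os2, t2, W2) = Some (pc', M', Os2, t2 + (t' - t), W2')"
  using assms by (auto simp: step_def Let_def split: if_splits instr.splits)

lemma steps_indep:
  assumes "steps Q inp cap amax k (pc, M, Os, t, W) = Some (pc', M', Os, t', W')"
  shows "\<exists>W2'. steps Q inp cap amax k (pc, M, Os2, t2, W2) = Some (pc', M', Os2, t2 + (t' - t), W2')"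
  using assms
proof (induction k arbitrary: pc M t W t2 W2)
  case 0 then show ?case by simp
next
  case (Suc k)
  from Suc.prems obtain c1 where s1: "step Q inp cap amax (pc, M, Os, t, W) = Some c1"
    and r: "steps Q inp cap amax k c1 = Some (pc', M', Os, t', W')" by (auto split: Option.bind_splits)
  obtain p1 M1 Os1 t1 W1 where c1: "c1 = (p1, M1, Os1, t1, W1)" by (cases c1) auto
  from steps_Os_prefix[OF r[unfolded c1]] step_Os[OF s1[unfolded c1]] have o1: "Os1 = Os" by auto
  from step_indep[OF s1[unfolded c1 o1], of Os2 t2 W2] obtain W2a where
    e1: "step Q inp cap amax (pc, M, Os2, t2, W2) = Some (p1, M1, Os2, t2 + (t1 - t), W2a)" by auto
  from Suc.IH[OF r[unfolded c1 o1], of "t2 + (t1 - t)" W2a] obtain W2' where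
    e2: "steps Q inp cap amax k (p1, M1, Os2, t2 + (t1 - t), W2a) = Some (pc', M', Os2, t2 + (t1 - t) + (t' - t1), W2')" by auto
  have "t \<le> t1" using step_time[OF s1[unfolded c1]] by auto
  moreover have "t1 \<le> t'" using steps_time[OF r[unfolded c1]] by auto
  ultimately have "t2 + (t1 - t) + (t' - t1) = t2 + (t' - t)" by simp
  with e1 e2 show ?case by auto
qed

lemma reach_of_steps:
  assumes "steps Q inp cap cap k (pc, M, Os, t, W) = Some (pc', M', Os, t + k, W')"
  shows "reach Q inp cap k (pc, M, Os) (pc', M', Os)"
  unfolding reach_def using steps_indep[OF assms] by auto

text \<open>u1_prog dispatches on the operation: 1 reads the characteristic vector; 2 and 3 update
  it and simulate the update writing c or e at position 3 i + 1; 4 simulates the two updates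
  writing b b in front of x_i, runs the enumeration until its first output, undoes its writes,
  simulates the two updates writing e e back and outputs iff there was no infix.\<close>

abbreviation len_upd :: "instr list \<Rightarrow> nat" where
  "len_upd Pu \<equiv> block_size * length Pu"

abbreviation len_enum :: "instr list \<Rightarrow> nat" where
  "len_enum Pe \<equiv> block_size * length Pe"

definition addr_remove :: "instr list \<Rightarrow> nat" where
  "addr_remove Pu = 20 + len_upd Pu"

definition addr_remove_upd :: "instr list \<Rightarrow> nat" where
  "addr_remove_upd Pu = 25 + len_upd Pu"

definition addr_query :: "instr list \<Rightarrow> nat" where
  "addr_query Pu = 26 + 2 * len_upd Pu"

definition addr_query_upd1 :: "instr list \<Rightarrow> nat" where
  "addr_query_upd1 Pu = 29 + 2 * len_upd Pu"

definition addr_query_upd2 :: "instr list \<Rightarrow> nat" where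
  "addr_query_upd2 Pu = 32 + 3 * len_upd Pu"

definition addr_enum :: "instr list \<Rightarrow> nat" where
  "addr_enum Pu = 34 + 4 * len_upd Pu"

definition addr_found :: "instr list \<Rightarrow> instr list \<Rightarrow> nat" where
  "addr_found Pu Pe = 35 + 4 * len_upd Pu + len_enum Pe"

definition addr_undo :: "instr list \<Rightarrow> instr list \<Rightarrow> nat" where
  "addr_undo Pu Pe = 36 + 4 * len_upd Pu + len_enum Pe"

definition addr_restore_upd1 :: "instr list \<Rightarrow> instr list \<Rightarrow> nat" where
  "addr_restore_upd1 Pu Pe = 48 + 4 * len_upd Pu + len_enum Pe"

definition addr_restore_upd2 :: "instr list \<Rightarrow> instr list \<Rightarrow> nat" where
  "addr_restore_upd2 Pu Pe = 51 + 5 * len_upd Pu + len_enum Pe"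

definition addr_answer :: "instr list \<Rightarrow> instr list \<Rightarrow> nat" where
  "addr_answer Pu Pe = 51 + 6 * len_upd Pu + len_enum Pe"

definition addr_halt :: "instr list \<Rightarrow> instr list \<Rightarrow> nat" where
  "addr_halt Pu Pe = 55 + 6 * len_upd Pu + len_enum Pe"

definition dispatch_code :: "instr list \<Rightarrow> instr list" where
  "dispatch_code Pu = [Input rOP rZ, Input rIX rONE, Sub rT rOP rONE, Jz rT 9, Sub rT rT rONE, Jz rT 14,
     Sub rT rT rONE, Jz rT (addr_remove Pu), Jmp (addr_query Pu)]"

definition member_code :: "instr list \<Rightarrow> instr list \<Rightarrow> instr list" where
  "member_code Pu Pe = [Add rT rBM rIX, Load rV rT, Jz rV (addr_halt Pu Pe), Jmp (addr_answer Pu Pe + 3), Jmp (addr_halt Pu Pe)]"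

definition insert_code :: "instr list" where
  "insert_code = [Add rT rBM rIX, Store rT rONE, Mul rT rIX rTHREE, Add rI0 rT rONE, Const rI1 2]"

definition remove_code :: "instr list" where
  "remove_code = [Add rT rBM rIX, Store rT rZ, Mul rT rIX rTHREE, Add rI0 rT rONE, Const rI1 3]"

definition query_b1_code :: "instr list" where
  "query_b1_code = [Mul rT rIX rTHREE, Sub rI0 rT rONE, Const rI1 1]"

definition query_b2_code :: "instr list" where
  "query_b2_code = [Mul rT rIX rTHREE, Add rI0 rT rZ, Const rI1 1]"

definition enum_init_code :: "instr list" where
  "enum_init_code = [Add rLP rLB rZ, Store rBM rZ]"

definition query_e1_code :: "instr list" where
  "query_e1_code = [Mul rT rIX rTHREE, Sub rI0 rT rONE, Const rI1 3]"

definition query_e2_code :: "instr list" where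
  "query_e2_code = [Mul rT rIX rTHREE, Add rI0 rT rZ, Const rI1 3]"

definition answer_code :: "instr list \<Rightarrow> instr list \<Rightarrow> instr list" where
  "answer_code Pu Pe = [Load rV rBM, Jz rV (addr_answer Pu Pe + 3), Jmp (addr_halt Pu Pe), Out rZ rZ]"

definition u1_prog :: "nat \<Rightarrow> instr list \<Rightarrow> instr list \<Rightarrow> instr list" where
  "u1_prog R Pu Pe = dispatch_code Pu @ member_code Pu Pe @ insert_code @ compile MU R 19 0 Pu @ [Jmp (addr_halt Pu Pe)] @
     remove_code @ compile MU R (addr_remove_upd Pu) 0 Pu @ [Jmp (addr_halt Pu Pe)] @
     query_b1_code @ compile MU R (addr_query_upd1 Pu) 0 Pu @ query_b2_code @ compile MU R (addr_query_upd2 Pu) 0 Pu @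
     enum_init_code @ compile ME R (addr_enum Pu) (addr_found Pu Pe) Pe @ [Jmp (addr_undo Pu Pe)] @ [Store rBM rONE] @ undo_code (addr_undo Pu Pe) @
     query_e1_code @ compile MU R (addr_restore_upd1 Pu Pe) 0 Pu @ query_e2_code @ compile MU R (addr_restore_upd2 Pu Pe) 0 Pu @ answer_code Pu Pe"

lemma u1_prog_code_at:
  fixes R :: nat and Pu Pe :: "instr list"
  defines "Q \<equiv> u1_prog R Pu Pe"
  shows "code_at Q 0 (dispatch_code Pu)" "code_at Q 9 (member_code Pu Pe)" "code_at Q 14 insert_code"
    "code_at Q 19 (compile MU R 19 0 Pu)" "code_at Q (19 + len_upd Pu) [Jmp (addr_halt Pu Pe)]"
    "code_at Q (addr_remove Pu) remove_code" "code_at Q (addr_remove_upd Pu) (compile MU R (addr_remove_upd Pu) 0 Pu)" "code_at Q (addr_remove_upd Pu + len_upd Pu) [Jmp (addr_halt Pu Pe)]"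
    "code_at Q (addr_query Pu) query_b1_code" "code_at Q (addr_query_upd1 Pu) (compile MU R (addr_query_upd1 Pu) 0 Pu)"
    "code_at Q (addr_query_upd1 Pu + len_upd Pu) query_b2_code" "code_at Q (addr_query_upd2 Pu) (compile MU R (addr_query_upd2 Pu) 0 Pu)"
    "code_at Q (addr_query_upd2 Pu + len_upd Pu) enum_init_code" "code_at Q (addr_enum Pu) (compile ME R (addr_enum Pu) (addr_found Pu Pe) Pe)"
    "code_at Q (addr_enum Pu + len_enum Pe) [Jmp (addr_undo Pu Pe)]" "code_at Q (addr_found Pu Pe) [Store rBM rONE]"
    "code_at Q (addr_undo Pu Pe) (undo_code (addr_undo Pu Pe))" "code_at Q (addr_undo Pu Pe + 9) query_e1_code"
    "code_at Q (addr_restore_upd1 Pu Pe) (compile MU R (addr_restore_upd1 Pu Pe) 0 Pu)" "code_at Q (addr_restore_upd1 Pu Pe + len_upd Pu) query_e2_code"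
    "code_at Q (addr_restore_upd2 Pu Pe) (compile MU R (addr_restore_upd2 Pu Pe) 0 Pu)" "code_at Q (addr_answer Pu Pe) (answer_code Pu Pe)"
    "length Q = addr_halt Pu Pe"
proof -
  have self: "\<And>xs. Q = xs \<Longrightarrow> code_at Q 0 xs" by (simp add: code_at_def)
  have Qe: "Q = dispatch_code Pu @ member_code Pu Pe @ insert_code @ compile MU R 19 0 Pu @ [Jmp (addr_halt Pu Pe)] @
     remove_code @ compile MU R (addr_remove_upd Pu) 0 Pu @ [Jmp (addr_halt Pu Pe)] @
     query_b1_code @ compile MU R (addr_query_upd1 Pu) 0 Pu @ query_b2_code @ compile MU R (addr_query_upd2 Pu) 0 Pu @
     enum_init_code @ compile ME R (addr_enum Pu) (addr_found Pu Pe) Pe @ [Jmp (addr_undo Pu Pe)] @ [Store rBM rONE] @ undo_code (addr_undo Pu Pe) @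
     query_e1_code @ compile MU R (addr_restore_upd1 Pu Pe) 0 Pu @ query_e2_code @ compile MU R (addr_restore_upd2 Pu Pe) 0 Pu @ answer_code Pu Pe"
    unfolding Q_def u1_prog_def ..
  note h = self[OF Qe, unfolded code_at_append]
  have l: "length (dispatch_code Pu) = 9" "length (member_code Pu Pe) = 5" "length insert_code = 5" "length remove_code = 5" "length query_b1_code = 3"
    "length query_b2_code = 3" "length enum_init_code = 2" "length query_e1_code = 3" "length query_e2_code = 3" "length (answer_code Pu Pe) = 4"
    "length (undo_code (addr_undo Pu Pe)) = 9"
    by (simp_all add: dispatch_code_def member_code_def insert_code_def remove_code_def query_b1_code_def query_b2_code_def enum_init_code_def query_e1_code_def query_e2_code_def answer_code_def undo_code_def)
  note h2 = h[unfolded l length_compile list.size]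
  show "code_at Q 0 (dispatch_code Pu)" "code_at Q 9 (member_code Pu Pe)" "code_at Q 14 insert_code"
    "code_at Q 19 (compile MU R 19 0 Pu)" "code_at Q (19 + len_upd Pu) [Jmp (addr_halt Pu Pe)]"
    "code_at Q (addr_remove Pu) remove_code" "code_at Q (addr_remove_upd Pu) (compile MU R (addr_remove_upd Pu) 0 Pu)" "code_at Q (addr_remove_upd Pu + len_upd Pu) [Jmp (addr_halt Pu Pe)]"
    "code_at Q (addr_query Pu) query_b1_code" "code_at Q (addr_query_upd1 Pu) (compile MU R (addr_query_upd1 Pu) 0 Pu)"
    "code_at Q (addr_query_upd1 Pu + len_upd Pu) query_b2_code" "code_at Q (addr_query_upd2 Pu) (compile MU R (addr_query_upd2 Pu) 0 Pu)"
    "code_at Q (addr_query_upd2 Pu + len_upd Pu) enum_init_code" "code_at Q (addr_enum Pu) (compile ME R (addr_enum Pu) (addr_found Pu Pe) Pe)"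
    "code_at Q (addr_enum Pu + len_enum Pe) [Jmp (addr_undo Pu Pe)]" "code_at Q (addr_found Pu Pe) [Store rBM rONE]"
    "code_at Q (addr_undo Pu Pe) (undo_code (addr_undo Pu Pe))" "code_at Q (addr_undo Pu Pe + 9) query_e1_code"
    "code_at Q (addr_restore_upd1 Pu Pe) (compile MU R (addr_restore_upd1 Pu Pe) 0 Pu)" "code_at Q (addr_restore_upd1 Pu Pe + len_upd Pu) query_e2_code"
    "code_at Q (addr_restore_upd2 Pu Pe) (compile MU R (addr_restore_upd2 Pu Pe) 0 Pu)" "code_at Q (addr_answer Pu Pe) (answer_code Pu Pe)"
    using h2 by (simp_all add: addr_remove_def addr_remove_upd_def addr_query_def addr_query_upd1_def addr_query_upd2_def addr_enum_def addr_found_def addr_undo_def addr_restore_upd1_def addr_restore_upd2_def addr_answer_def algebra_simps)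
  show "length Q = addr_halt Pu Pe"
    unfolding Q_def u1_prog_def by (simp add: l undo_code_def addr_halt_def addr_remove_def addr_remove_upd_def addr_query_def addr_query_upd1_def addr_query_upd2_def addr_enum_def addr_found_def addr_undo_def addr_restore_upd1_def addr_restore_upd2_def addr_answer_def)
qed



definition u1_regs :: "nat \<Rightarrow> nat \<Rightarrow> nat \<Rightarrow> nat \<Rightarrow> mem \<Rightarrow> bool" where
  "u1_regs R cap m bm M \<longleftrightarrow> M rZ = 0 \<and> M rONE = 1 \<and> M rTHREE = 3 \<and> M rRR = R \<and> M rMM = m \<and> M rBM = bm \<and>
     M rLB = log_base \<and> (\<forall>q. M q < cap)"

definition sim_params :: "nat \<Rightarrow> nat \<Rightarrow> nat \<Rightarrow> nat \<Rightarrow> nat \<Rightarrow> bool" where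
  "sim_params R amax cap capo Bd \<longleftrightarrow> log_base + 2 * Bd < R \<and> R + amax \<le> cap \<and> capo \<le> cap \<and> 4 \<le> cap"

lemma u1_regs_keep:
  assumes "u1_regs R cap m bm M" "\<forall>q. q < 7 \<longrightarrow> M' q = M q" "\<forall>q. M' q < cap"
  shows "u1_regs R cap m bm M'"
  using assms by (simp add: u1_regs_def)

lemma low_regs_keep: "log_base \<le> R \<Longrightarrow> \<forall>q. \<not> scratch R q \<and> \<not> ds_cell R amax q \<longrightarrow> M' q = M q \<Longrightarrow> \<forall>q. q < 13 \<longrightarrow> M' q = M q"
  by (auto simp: scratch_def ds_cell_def)

lemma reach_update:
  assumes pa: "sim_params R amax cap capo Bd" and ps: "u1_regs R cap m bm M"
    and ca: "code_at Q off (compile MU R off 0 Pu)" and i: "M rI0 < cap" "M rI1 < cap"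
    and mr: "relocated R amax Mo M" and mob: "\<forall>a. Mo a < capo"
    and rn: "run Pu [M rI0, M rI1] capo amax Bd Mo = Some (Mo', rr)"
  shows "\<exists>k M'. k \<le> block_size * Bd \<and> reach Q inp cap k (off, M, Os) (off + len_upd Pu, M', Os) \<and> relocated R amax Mo' M' \<and>
    (\<forall>q. \<not> scratch R q \<and> \<not> ds_cell R amax q \<longrightarrow> M' q = M q) \<and> (\<forall>a. Mo' a < capo) \<and> u1_regs R cap m bm M'"
proof -
  from rn obtain pf Os' T W where st: "steps Pu [M rI0, M rI1] capo amax Bd (0, Mo, [], 0, {}) = Some (pf, Mo', Os', T, W)"
    and hl: "length Pu \<le> pf" unfolding run_def by (auto split: option.splits if_splits)
  have cx: "sim_ctx MU R cap capo amax Bd M [M rI0, M rI1]"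
    using pa ps i unfolding sim_ctx_def sim_params_def u1_regs_def by (auto simp: nth_Cons split: nat.splits)
  from steps_compile_run[OF cx ca st hl mr mob, of inp Os 0 "{}"] obtain k' Mc' Wc' where
    k': "k' \<le> block_size * Bd" and e: "steps Q inp cap cap k' (off, M, Os, 0, {}) = Some (off + block_size * length Pu, Mc', Os, 0 + k', Wc')"
    and r: "relocated R amax Mo' Mc'" "\<forall>q. \<not> scratch R q \<and> \<not> ds_cell R amax q \<longrightarrow> Mc' q = M q" "\<forall>a. Mo' a < capo"
    by auto
  have v: "\<forall>q. Mc' q < cap" using steps_mem_bounded[OF e] ps by (simp add: u1_regs_def)
  have "\<forall>q. q < 7 \<longrightarrow> Mc' q = M q" using low_regs_keep[OF _ r(2)] pa by (auto simp: sim_params_def)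
  hence "u1_regs R cap m bm Mc'" using u1_regs_keep[OF ps _ v] by blast
  moreover have "reach Q inp cap k' (off, M, Os) (off + len_upd Pu, Mc', Os)" using reach_of_steps[of Q inp cap k' off M Os 0 "{}"] e by simp
  ultimately show ?thesis using k' r by blast
qed

lemma reach_enum:
  assumes pa: "sim_params R amax cap capo Bd" and ps: "u1_regs R cap m bm M" and lp: "M rLP = log_base"
    and ca: "code_at Q off (compile ME R off fnd Pe)"
    and mr: "relocated R amax Mo M" and mob: "\<forall>a. Mo a < capo"
    and en: "enum_ok L Pe capo amax Bd w Mo"
  shows "\<exists>k M'. k \<le> block_size * Bd + 1 \<and> reach Q inp cap k (off, M, Os) (if infixes L w = {} then off + len_enum Pe else fnd, M', Os) \<and>
    (\<exists>lg. log_inv R amax M lg M' \<and> length lg \<le> Bd) \<and> (\<forall>q. \<not> scratch R q \<and> \<not> ds_cell R amax q \<longrightarrow> M' q = M q) \<and> (\<forall>q. M' q < cap)"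
proof -
  from en obtain fuel M'' Os' T W where rn: "run Pe [] capo amax fuel Mo = Some (M'', Os', T, W)"
    and inf: "set (map snd Os') = infixes L w" and gp: "gaps_le Bd (0 # map fst Os' @ [T])"
    unfolding enum_ok_def by blast
  have cx: "sim_ctx ME R cap capo amax Bd M []"
    using pa ps unfolding sim_ctx_def sim_params_def u1_regs_def by auto
  from steps_compile_enum[OF cx ca rn gp mr mob lp, of inp Os 0 "{}"] obtain k' Mc' Wc' lg where
    k': "k' \<le> block_size * Bd + 1" and e: "steps Q inp cap cap k' (off, M, Os, 0, {}) = Some (if Os' = [] then off + block_size * length Pe else fnd, Mc', Os, 0 + k', Wc')"
    and r: "log_inv R amax M lg Mc'" "length lg \<le> Bd" "\<forall>q. \<not> scratch R q \<and> \<not> ds_cell R amax q \<longrightarrow> Mc' q = M q"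
    by auto
  have v: "\<forall>q. Mc' q < cap" using steps_mem_bounded[OF e] ps by (simp add: u1_regs_def)
  have eq: "(Os' = []) = (infixes L w = {})" using inf by auto
  have "reach Q inp cap k' (off, M, Os) (if infixes L w = {} then off + len_enum Pe else fnd, Mc', Os)"
    using reach_of_steps[of Q inp cap k' off M Os 0 "{}"] e eq by simp
  then show ?thesis using k' r v by blast
qed

lemma undo_upd: "c \<notin> fst ` set lg \<Longrightarrow> undo lg (M(c := v)) = (undo lg M)(c := v)"
  by (induction lg) (auto simp: undo_def fun_upd_twist)

lemma reach_undo:
  assumes pa: "sim_params R amax cap capo Bd" and ca: "code_at Q u (undo_code u)"
    and li: "log_inv R amax Mst lg M0" "length lg \<le> Bd" and r: "M rLB = log_base" "M rONE = 1" and v: "\<forall>q. M q < cap"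
    and c: "M = M0(c := vc)" "\<not> scratch R c" "\<not> ds_cell R amax c"
  shows "\<exists>k M'. k \<le> 9 * Bd + 2 \<and> reach Q inp cap k (u, M, Os) (u + 9, M', Os) \<and>
    (\<forall>q. \<not> scratch R q \<longrightarrow> M' q = (Mst(c := vc)) q) \<and> (\<forall>q. M' q < cap)"
proof -
  from pa have p: "log_base + 2 * Bd < R" "R + amax \<le> cap" by (auto simp: sim_params_def)
  have sc: "\<And>q. scratch R q \<Longrightarrow> q \<noteq> c" using c(2) by auto
  have cn: "c \<notin> fst ` set lg" using li(1) c(3) unfolding log_inv_def ds_cell_def by force
  from li have l: "M rLP = log_base + 2 * length lg"
    "\<forall>j<length lg. M (log_base + 2 * j) = fst (lg ! j) \<and> M (log_base + 2 * j + 1) = snd (lg ! j)"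
    "\<forall>e\<in>set lg. R \<le> fst e \<and> fst e < cap" "\<forall>q. \<not> scratch R q \<longrightarrow> undo lg M q = (Mst(c := vc)) q"
  proof -
    have s19: "scratch R rLP" using p by (simp add: scratch_def)
    show "M rLP = log_base + 2 * length lg" using li(1) sc[OF s19] c(1) by (simp add: log_inv_def)
    show "\<forall>j<length lg. M (log_base + 2 * j) = fst (lg ! j) \<and> M (log_base + 2 * j + 1) = snd (lg ! j)"
    proof (intro allI impI)
      fix j assume j: "j < length lg"
      have "scratch R (log_base + 2 * j)" "scratch R (log_base + 2 * j + 1)" using j li(2) p by (auto simp: scratch_def)
      with sc li(1) j c(1) show "M (log_base + 2 * j) = fst (lg ! j) \<and> M (log_base + 2 * j + 1) = snd (lg ! j)"
        unfolding log_inv_def by auto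
    qed
    show "\<forall>e\<in>set lg. R \<le> fst e \<and> fst e < cap" using li(1) p unfolding log_inv_def by fastforce
    show "\<forall>q. \<not> scratch R q \<longrightarrow> undo lg M q = (Mst(c := vc)) q"
      using li(1) unfolding c(1) undo_upd[OF cn] log_inv_def by auto
  qed
  have lb: "log_base + 2 * length lg \<le> R" using li(2) p by linarith
  from steps_undo_code[OF ca r l(1) l(2) l(3) lb v _ _, of inp Os 0 "{}"] p obtain k M' W' where
    k: "k \<le> 9 * length lg + 2" and e: "steps Q inp cap cap k (u, M, Os, 0, {}) = Some (u + 9, M', Os, 0 + k, W')"
    and m: "\<forall>q. \<not> scratch R q \<longrightarrow> M' q = undo lg M q" "\<forall>q. M' q < cap" by auto
  have "k \<le> 9 * Bd + 2" using k li(2) by linarith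
  moreover have "reach Q inp cap k (u, M, Os) (u + 9, M', Os)" using reach_of_steps[of Q inp cap k u M Os 0 "{}"] e by simp
  ultimately show ?thesis using m l(4) by metis
qed



definition dispatch_target :: "nat \<Rightarrow> instr list \<Rightarrow> nat" where
  "dispatch_target op Pu = (if op = 1 then 9 else if op = 2 then 14 else if op = 3 then addr_remove Pu else addr_query Pu)"

lemma reach_dispatch:
  assumes ca: "code_at Q 0 (dispatch_code Pu)" and ps: "u1_regs R cap m bm M" and op: "op \<in> {1, 2, 3, 4}"
    and ic: "i < cap" and c21: "21 \<le> cap"
  shows "\<exists>k Md. k \<le> 9 \<and> reach Q [op, i] cap k (0, M, []) (dispatch_target op Pu, Md, []) \<and> Md rOP = op \<and> Md rIX = i \<and>
    (\<forall>q. q \<noteq> rOP \<and> q \<noteq> rIX \<and> q \<noteq> rT \<longrightarrow> Md q = M q) \<and> (\<forall>q. Md q < cap)"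
proof -
  have c0: "code_at Q 0 [Input rOP rZ, Input rIX rONE, Sub rT rOP rONE]"
    using code_at_take[OF ca, of 3] by (simp add: dispatch_code_def)
  have c3: "code_at Q 3 [Jz rT 9]" and c4: "code_at Q 4 [Sub rT rT rONE]" and c5: "code_at Q 5 [Jz rT 14]"
    and c6: "code_at Q 6 [Sub rT rT rONE]" and c7: "code_at Q 7 [Jz rT (addr_remove Pu)]" and c8: "code_at Q 8 [Jmp (addr_query Pu)]"
    using code_at_nth[OF ca, of 3] code_at_nth[OF ca, of 4] code_at_nth[OF ca, of 5]
      code_at_nth[OF ca, of 6] code_at_nth[OF ca, of 7] code_at_nth[OF ca, of 8]
    by (simp_all add: dispatch_code_def)
  have rc: "\<And>q. q \<le> 20 \<Longrightarrow> q < cap" using c21 by linarith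
  have r: "M rZ = 0" "M rONE = 1" "\<forall>q. M q < cap" using ps by (auto simp: u1_regs_def)
  have opc: "op < cap" using op c21 by auto
  define M1 where "M1 = M(rOP := op, rIX := i, rT := op - 1)"
  have "run_straight [op, i] cap cap [Input rOP rZ, Input rIX rONE, Sub rT rOP rONE] M = Some M1"
    unfolding M1_def using r rc opc ic by simp
  from reach_run_straightI[OF c0 this] have e0: "reach Q [op, i] cap 3 (0, M, []) (3, M1, [])" by simp
  have M1p: "M1 rOP = op" "M1 rIX = i" "\<forall>q. q \<noteq> rOP \<and> q \<noteq> rIX \<and> q \<noteq> rT \<longrightarrow> M1 q = M q" "\<forall>q. M1 q < cap"
    unfolding M1_def using r opc ic by auto
  have j3: "reach Q [op, i] cap 1 (3, M1, []) (if op = 1 then 9 else 4, M1, [])"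
    using reach_Jz[OF c3, of cap "[op, i]" M1 "[]"] rc unfolding M1_def using op by auto
  show ?thesis
  proof (cases "op = 1")
    case True
    with reach_trans[OF e0 j3] M1p show ?thesis unfolding dispatch_target_def by (intro exI[of _ 4] exI[of _ M1]) auto
  next
    case n1: False
    define M2 where "M2 = M1(rT := op - 1 - 1)"
    have "run_straight [op, i] cap cap [Sub rT rT rONE] M1 = Some M2" unfolding M2_def M1_def using r rc opc by auto
    from reach_run_straightI[OF c4 this] have e4: "reach Q [op, i] cap 1 (4, M1, []) (5, M2, [])" by simp
    have M2p: "M2 rOP = op" "M2 rIX = i" "\<forall>q. q \<noteq> rOP \<and> q \<noteq> rIX \<and> q \<noteq> rT \<longrightarrow> M2 q = M q" "\<forall>q. M2 q < cap"
      unfolding M2_def using M1p opc by auto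
    have j5: "reach Q [op, i] cap 1 (5, M2, []) (if op = 2 then 14 else 6, M2, [])"
      using reach_Jz[OF c5, of cap "[op, i]" M2 "[]"] rc unfolding M2_def using op n1 by auto
    have j3': "reach Q [op, i] cap 1 (3, M1, []) (4, M1, [])" using j3 n1 by simp
    have e5: "reach Q [op, i] cap 6 (0, M, []) (if op = 2 then 14 else 6, M2, [])"
      using reach_trans[OF reach_trans[OF reach_trans[OF e0 j3'] e4] j5] by simp
    show ?thesis
    proof (cases "op = 2")
      case True
      with e5 M2p show ?thesis unfolding dispatch_target_def by (intro exI[of _ 6] exI[of _ M2]) auto
    next
      case n2: False
      define M3 where "M3 = M2(rT := op - 1 - 1 - 1)"
      have "run_straight [op, i] cap cap [Sub rT rT rONE] M2 = Some M3" unfolding M3_def M2_def M1_def using r rc opc by auto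
      from reach_run_straightI[OF c6 this] have e6: "reach Q [op, i] cap 1 (6, M2, []) (7, M3, [])" by simp
      have M3p: "M3 rOP = op" "M3 rIX = i" "\<forall>q. q \<noteq> rOP \<and> q \<noteq> rIX \<and> q \<noteq> rT \<longrightarrow> M3 q = M q" "\<forall>q. M3 q < cap"
        unfolding M3_def using M2p opc by auto
      have j7: "reach Q [op, i] cap 1 (7, M3, []) (if op = 3 then addr_remove Pu else 8, M3, [])"
        using reach_Jz[OF c7, of cap "[op, i]" M3 "[]"] rc unfolding M3_def using op n1 n2 by auto
      have e5': "reach Q [op, i] cap 6 (0, M, []) (6, M2, [])" using e5 n2 by simp
      have e7: "reach Q [op, i] cap 8 (0, M, []) (if op = 3 then addr_remove Pu else 8, M3, [])"
        using reach_trans[OF reach_trans[OF e5' e6] j7] by simp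
      show ?thesis
      proof (cases "op = 3")
        case True
        with e7 M3p show ?thesis unfolding dispatch_target_def by (intro exI[of _ 8] exI[of _ M3]) auto
      next
        case n3: False
        have e7': "reach Q [op, i] cap 8 (0, M, []) (8, M3, [])" using e7 n3 by simp
        have "reach Q [op, i] cap 9 (0, M, []) (addr_query Pu, M3, [])"
          using reach_trans[OF e7' reach_Jmp[OF c8]] by simp
        with M3p n1 n2 n3 show ?thesis unfolding dispatch_target_def by (intro exI[of _ 9] exI[of _ M3]) auto
      qed
    qed
  qed
qed



definition u1_ctx :: "nat \<Rightarrow> nat \<Rightarrow> nat \<Rightarrow> nat \<Rightarrow> nat \<Rightarrow> nat \<Rightarrow> nat \<Rightarrow> nat \<Rightarrow> bool" where
  "u1_ctx R amax cap capo Bd m bm n \<longleftrightarrow> sim_params R amax cap capo Bd \<and> bm = R + amax \<and> m = 3 * n + 1 \<and>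
     bm + n < cap \<and> 3 * n + 2 < cap"

lemma u1_ctxD:
  assumes "u1_ctx R amax cap capo Bd m bm n"
  shows "log_base + 2 * Bd < R" "R + amax \<le> cap" "capo \<le> cap" "4 \<le> cap" "bm = R + amax" "m = 3 * n + 1"
    "bm + n < cap" "3 * n + 2 < cap" "21 \<le> cap"
  using assms by (auto simp: u1_ctx_def sim_params_def)

lemma answer_code_at:
  assumes "code_at Q (addr_answer Pu Pe) (answer_code Pu Pe)"
  shows "code_at Q (addr_answer Pu Pe) [Load rV rBM]" "code_at Q (addr_answer Pu Pe + 1) [Jz rV (addr_answer Pu Pe + 3)]"
    "code_at Q (addr_answer Pu Pe + 2) [Jmp (addr_halt Pu Pe)]" "code_at Q (addr_answer Pu Pe + 3) [Out rZ rZ]"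
  using code_at_nth[OF assms, of 0] code_at_nth[OF assms, of 1] code_at_nth[OF assms, of 2]
    code_at_nth[OF assms, of 3]
  by (simp_all add: answer_code_def)


lemma run_u1_member:
  assumes oc: "u1_ctx R amax cap capo Bd m bm n" and ps: "u1_regs R cap m bm M" and i: "1 \<le> i" "i \<le> n"
    and F: "20 \<le> F"
  shows "\<exists>M' Os t W. run (u1_prog R Pu Pe) [1, i] cap cap F M = Some (M', Os, t, W) \<and> (Os \<noteq> []) = (M (bm + i) \<noteq> 0) \<and>
    u1_regs R cap m bm M' \<and> (\<forall>q. \<not> scratch R q \<and> q \<noteq> rOP \<and> q \<noteq> rIX \<longrightarrow> M' q = M q)"
proof -
  let ?Q = "u1_prog R Pu Pe"
  note f = u1_ctxD[OF oc]
  note pc = u1_prog_code_at[of R Pu Pe]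
  have rc: "\<And>q. q \<le> 20 \<Longrightarrow> q < cap" using f by linarith
  have ic: "i < cap" using f i by linarith
  from reach_dispatch[OF pc(1) ps _ ic f(9), of 1] obtain k1 Md where
    k1: "k1 \<le> 9" and e1: "reach ?Q [1, i] cap k1 (0, M, []) (9, Md, [])" and
    md: "Md rOP = 1" "Md rIX = i" "\<forall>q. q \<noteq> rOP \<and> q \<noteq> rIX \<and> q \<noteq> rT \<longrightarrow> Md q = M q" "\<forall>q. Md q < cap"
    by (auto simp: dispatch_target_def)
  have ca: "code_at ?Q 9 [Add rT rBM rIX, Load rV rT]"
    using code_at_take[OF pc(2), of 2] by (simp add: member_code_def)
  have cb: "code_at ?Q 11 [Jz rV (addr_halt Pu Pe)]" and cc: "code_at ?Q 12 [Jmp (addr_answer Pu Pe + 3)]"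
    using code_at_nth[OF pc(2), of 2] code_at_nth[OF pc(2), of 3] by (simp_all add: member_code_def)
  have bmi: "bm + i \<noteq> rOP" "bm + i \<noteq> rIX" "bm + i \<noteq> rT" "bm + i < cap" using f i by auto
  have mbm: "Md (bm + i) = M (bm + i)" using md(3) bmi by auto
  have mr: "Md rBM = bm" using md(3) ps by (auto simp: u1_regs_def)
  define M2 where "M2 = Md(rT := bm + i, rV := M (bm + i))"
  have "run_straight [1, i] cap cap [Add rT rBM rIX, Load rV rT] Md = Some M2"
    unfolding M2_def using md mr mbm rc bmi ps[unfolded u1_regs_def] by auto
  from reach_run_straightI[OF ca this] have e2: "reach ?Q [1, i] cap 2 (9, Md, []) (11, M2, [])" by simp
  have m2: "\<forall>q. \<not> scratch R q \<and> q \<noteq> rOP \<and> q \<noteq> rIX \<longrightarrow> M2 q = M q"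
    using md(3) f unfolding M2_def by (auto simp: scratch_def)
  have v2: "\<forall>q. M2 q < cap" using md(4) ps bmi unfolding M2_def u1_regs_def by auto
  have "\<forall>q. q < 7 \<longrightarrow> M2 q = M q" using m2 f by (auto simp: scratch_def)
  hence ps2: "u1_regs R cap m bm M2" using u1_regs_keep[OF ps _ v2] by blast
  have j: "reach ?Q [1, i] cap 1 (11, M2, []) (if M (bm + i) = 0 then addr_halt Pu Pe else 12, M2, [])"
    using reach_Jz[OF cb, of cap "[1, i]" M2 "[]"] rc unfolding M2_def by auto
  have e12: "reach ?Q [1, i] cap (k1 + 2 + 1) (0, M, []) (if M (bm + i) = 0 then addr_halt Pu Pe else 12, M2, [])"
    using reach_trans[OF reach_trans[OF e1 e2] j] .
  show ?thesis
  proof (cases "M (bm + i) = 0")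
    case True
    from reach_run[OF e12[unfolded if_P[OF True]], of F] pc(23) k1 F obtain t W where
      "run ?Q [1, i] cap cap F M = Some (M2, [], t, W)" by auto
    with True ps2 m2 show ?thesis by auto
  next
    case False
    have e3: "reach ?Q [1, i] cap (k1 + 2 + 1 + 1) (0, M, []) (addr_answer Pu Pe + 3, M2, [])"
      using reach_trans[OF e12[unfolded if_not_P[OF False]] reach_Jmp[OF cc]] .
    have lq: "length ?Q \<le> Suc (addr_answer Pu Pe + 3)" using pc(23) by (simp add: addr_halt_def addr_answer_def)
    have kf: "Suc (k1 + 2 + 1 + 1) \<le> F" using k1 F by simp
    from reach_run_out[OF e3 answer_code_at(4)[OF pc(22)] lq _ _ kf] rc
    obtain t W Os where "run ?Q [1, i] cap cap F M = Some (M2, Os, t, W)" "Os \<noteq> []" by auto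
    with False ps2 m2 show ?thesis by auto
  qed
qed

lemma reach_update_path:
  assumes oc: "u1_ctx R amax cap capo Bd m bm n" and ps: "u1_regs R cap m bm M" and i: "1 \<le> i" "i \<le> n" "M rIX = i"
    and ca1: "code_at Q s [Add rT rBM rIX, Store rT rB, Mul rT rIX rTHREE, Add rI0 rT rONE, Const rI1 x]"
    and ca2: "code_at Q (s + 5) (compile MU R (s + 5) 0 Pu)" and ca3: "code_at Q (s + 5 + len_upd Pu) [Jmp H]"
    and rB: "rB = rZ \<or> rB = rONE" and x: "x < cap"
    and mr: "relocated R amax Mo M" and mob: "\<forall>a. Mo a < capo"
    and rn: "run Pu [3 * i + 1, x] capo amax Bd Mo = Some (Mo', rr)"
  shows "\<exists>k M'. k \<le> block_size * Bd + 6 \<and> reach Q inp cap k (s, M, []) (H, M', []) \<and> u1_regs R cap m bm M' \<and>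
    relocated R amax Mo' M' \<and> (\<forall>a. Mo' a < capo) \<and> M' (bm + i) = M rB \<and>
    (\<forall>q. \<not> scratch R q \<and> \<not> ds_cell R amax q \<and> q \<noteq> rI0 \<and> q \<noteq> rI1 \<and> q \<noteq> bm + i \<longrightarrow> M' q = M q)"
proof -
  note f = u1_ctxD[OF oc]
  have rc: "\<And>q. q \<le> 20 \<Longrightarrow> q < cap" using f by linarith
  have pr: "M rZ = 0" "M rONE = 1" "M rTHREE = 3" "M rBM = bm" "\<forall>q. M q < cap" using ps by (auto simp: u1_regs_def)
  have bmi: "bm + i < cap" "21 \<le> bm + i" "3 * i + 1 < cap" using f i by auto
  have mrb: "M rB < cap" using pr(5) by auto
  define M2 where "M2 = M(rT := bm + i, bm + i := M rB, rT := 3 * i, rI0 := 3 * i + 1, rI1 := x)"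
  have "run_straight inp cap cap [Add rT rBM rIX, Store rT rB, Mul rT rIX rTHREE, Add rI0 rT rONE, Const rI1 x] M = Some M2"
    unfolding M2_def using pr rc bmi mrb x i(3) rB by auto
  from reach_run_straightI[OF ca1 this] have e1: "reach Q inp cap 5 (s, M, []) (s + 5, M2, [])" by simp
  have m2: "\<forall>q. \<not> scratch R q \<and> q \<noteq> rI0 \<and> q \<noteq> rI1 \<and> q \<noteq> bm + i \<longrightarrow> M2 q = M q"
    unfolding M2_def using f by (auto simp: scratch_def)
  have v2: "\<forall>q. M2 q < cap" unfolding M2_def using pr(5) bmi x by auto
  have "\<forall>q. q < 7 \<longrightarrow> M2 q = M q" using m2 bmi by (auto simp: scratch_def)
  hence ps2: "u1_regs R cap m bm M2" using u1_regs_keep[OF ps _ v2] by blast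
  have mr2: "relocated R amax Mo M2"
    using mr unfolding relocated_def M2_def using f by auto
  have i2: "M2 rI0 = 3 * i + 1" "M2 rI1 = x" unfolding M2_def by auto
  have pa: "sim_params R amax cap capo Bd" using oc by (simp add: u1_ctx_def)
  from reach_update[OF pa ps2 ca2 _ _ mr2 mob, unfolded i2, OF bmi(3) x rn, of inp "[]"]
  obtain k M3 where k: "k \<le> block_size * Bd" and e2: "reach Q inp cap k (s + 5, M2, []) (s + 5 + len_upd Pu, M3, [])"
    and m3: "relocated R amax Mo' M3" "\<forall>q. \<not> scratch R q \<and> \<not> ds_cell R amax q \<longrightarrow> M3 q = M2 q" "\<forall>a. Mo' a < capo" "u1_regs R cap m bm M3"
    by blast
  have e3: "reach Q inp cap (5 + k + 1) (s, M, []) (H, M3, [])"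
    using reach_trans[OF reach_trans[OF e1 e2] reach_Jmp[OF ca3]] .
  have "M3 (bm + i) = M2 (bm + i)" using m3(2) bmi f by (auto simp: scratch_def ds_cell_def)
  also have "\<dots> = M rB" unfolding M2_def using bmi by auto
  finally have b: "M3 (bm + i) = M rB" .
  have "\<forall>q. \<not> scratch R q \<and> \<not> ds_cell R amax q \<and> q \<noteq> rI0 \<and> q \<noteq> rI1 \<and> q \<noteq> bm + i \<longrightarrow> M3 q = M q"
    using m3(2) m2 by auto
  moreover have "5 + k + 1 \<le> block_size * Bd + 6" using k by simp
  ultimately show ?thesis using e3 m3 b by blast
qed

lemma run_u1_insert_remove:
  assumes oc: "u1_ctx R amax cap capo Bd m bm n" and ps: "u1_regs R cap m bm M" and i: "1 \<le> i" "i \<le> n"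
    and op: "op = 2 \<or> op = 3"
    and mr: "relocated R amax Mo M" and mob: "\<forall>a. Mo a < capo"
    and rn: "run Pu [3 * i + 1, if op = 2 then 2 else 3] capo amax Bd Mo = Some (Mo', rr)"
    and F: "block_size * Bd + 20 \<le> F"
  shows "\<exists>M' Os t W. run (u1_prog R Pu Pe) [op, i] cap cap F M = Some (M', Os, t, W) \<and>
    u1_regs R cap m bm M' \<and> relocated R amax Mo' M' \<and> (\<forall>a. Mo' a < capo) \<and> M' (bm + i) = (if op = 2 then 1 else 0) \<and>
    (\<forall>q. R + amax \<le> q \<and> q \<noteq> bm + i \<longrightarrow> M' q = M q)"
proof -
  let ?Q = "u1_prog R Pu Pe"
  note f = u1_ctxD[OF oc]
  note pc = u1_prog_code_at[of R Pu Pe]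
  have ic: "i < cap" using f i by linarith
  from reach_dispatch[OF pc(1) ps _ ic f(9), of op] op obtain k1 Md where
    k1: "k1 \<le> 9" and e1: "reach ?Q [op, i] cap k1 (0, M, []) (dispatch_target op Pu, Md, [])" and
    md: "Md rOP = op" "Md rIX = i" "\<forall>q. q \<noteq> rOP \<and> q \<noteq> rIX \<and> q \<noteq> rT \<longrightarrow> Md q = M q" "\<forall>q. Md q < cap"
    by auto
  have psd: "u1_regs R cap m bm Md" using u1_regs_keep[OF ps _ md(4)] md(3) by auto
  have mrd: "relocated R amax Mo Md" using mr md(3) f unfolding relocated_def by auto
  have mdb: "Md rONE = 1" "Md rZ = 0" using psd by (auto simp: u1_regs_def)
  obtain k2 M' where k2: "k2 \<le> block_size * Bd + 6" and e2: "reach ?Q [op, i] cap k2 (dispatch_target op Pu, Md, []) (addr_halt Pu Pe, M', [])"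
    and m': "u1_regs R cap m bm M'" "relocated R amax Mo' M'" "\<forall>a. Mo' a < capo" "M' (bm + i) = (if op = 2 then 1 else 0)"
      "\<forall>q. \<not> scratch R q \<and> \<not> ds_cell R amax q \<and> q \<noteq> rI0 \<and> q \<noteq> rI1 \<and> q \<noteq> bm + i \<longrightarrow> M' q = Md q"
  proof (cases "op = 2")
    case True
    have ca2: "code_at ?Q (14 + 5) (compile MU R (14 + 5) 0 Pu)" "code_at ?Q (14 + 5 + len_upd Pu) [Jmp (addr_halt Pu Pe)]" using pc(4,5) by simp_all
    have rn2: "run Pu [3 * i + 1, 2] capo amax Bd Mo = Some (Mo', rr)" using rn True by simp
    have x2: "(2::nat) < cap" using f by linarith
    from reach_update_path[OF oc psd i md(2) pc(3)[unfolded insert_code_def] ca2 _ x2 mrd mob rn2, where inp="[op, i]"]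
    show ?thesis using that mdb True unfolding dispatch_target_def by auto
  next
    case False
    hence o3: "op = 3" using op by simp
    have ca2: "code_at ?Q (addr_remove Pu + 5) (compile MU R (addr_remove Pu + 5) 0 Pu)" "code_at ?Q (addr_remove Pu + 5 + len_upd Pu) [Jmp (addr_halt Pu Pe)]"
      using pc(7,8) by (simp_all add: addr_remove_def addr_remove_upd_def)
    have rn2: "run Pu [3 * i + 1, 3] capo amax Bd Mo = Some (Mo', rr)" using rn o3 by simp
    have x2: "(3::nat) < cap" using f by linarith
    from reach_update_path[OF oc psd i md(2) pc(6)[unfolded remove_code_def] ca2 _ x2 mrd mob rn2, where inp="[op, i]"]
    show ?thesis using that mdb o3 unfolding dispatch_target_def by auto
  qed
  from reach_trans[OF e1 e2] have e: "reach ?Q [op, i] cap (k1 + k2) (0, M, []) (addr_halt Pu Pe, M', [])" .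
  from reach_run[OF e, of F] pc(23) k1 k2 F obtain t W where "run ?Q [op, i] cap cap F M = Some (M', [], t, W)" by auto
  moreover have "\<forall>q. R + amax \<le> q \<and> q \<noteq> bm + i \<longrightarrow> M' q = M q"
    using m'(5) md(3) f by (auto simp: scratch_def ds_cell_def)
  ultimately show ?thesis using m' by blast
qed



lemma reach_query_update:
  assumes oc: "u1_ctx R amax cap capo Bd m bm n" and ps: "u1_regs R cap m bm M" and i: "1 \<le> i" "i \<le> n" "M rIX = i"
    and ca1: "code_at Q s [Mul rT rIX rTHREE, ins, Const rI1 x]"
    and ins: "ins = Sub rI0 rT rONE \<and> p = 3 * i - 1 \<or> ins = Add rI0 rT rZ \<and> p = 3 * i"
    and ca2: "code_at Q (s + 3) (compile MU R (s + 3) 0 Pu)" and x: "x < cap"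
    and mr: "relocated R amax Mo M" and mob: "\<forall>a. Mo a < capo"
    and rn: "run Pu [p, x] capo amax Bd Mo = Some (Mo', rr)"
  shows "\<exists>k M'. k \<le> block_size * Bd + 3 \<and> reach Q inp cap k (s, M, []) (s + 3 + len_upd Pu, M', []) \<and> u1_regs R cap m bm M' \<and>
    relocated R amax Mo' M' \<and> (\<forall>a. Mo' a < capo) \<and> M' rIX = i \<and>
    (\<forall>q. \<not> scratch R q \<and> \<not> ds_cell R amax q \<and> q \<noteq> rI0 \<and> q \<noteq> rI1 \<longrightarrow> M' q = M q)"
proof -
  note f = u1_ctxD[OF oc]
  have rc: "\<And>q. q \<le> 20 \<Longrightarrow> q < cap" using f by linarith
  have pr: "M rZ = 0" "M rONE = 1" "M rTHREE = 3" "M rBM = bm" "\<forall>q. M q < cap" using ps by (auto simp: u1_regs_def)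
  have b3: "3 * i < cap" "p < cap" using f i ins by auto
  define M2 where "M2 = M(rT := 3 * i, rI0 := p, rI1 := x)"
  have "run_straight inp cap cap [Mul rT rIX rTHREE, ins, Const rI1 x] M = Some M2"
    using ins
  proof
    assume h: "ins = Sub rI0 rT rONE \<and> p = 3 * i - 1"
    show ?thesis unfolding M2_def using h pr rc b3 x i(3) by (auto simp: mult.commute)
  next
    assume h: "ins = Add rI0 rT rZ \<and> p = 3 * i"
    show ?thesis unfolding M2_def using h pr rc b3 x i(3) by (auto simp: mult.commute)
  qed
  from reach_run_straightI[OF ca1 this] have e1: "reach Q inp cap 3 (s, M, []) (s + 3, M2, [])" by simp
  have m2: "\<forall>q. \<not> scratch R q \<and> q \<noteq> rI0 \<and> q \<noteq> rI1 \<longrightarrow> M2 q = M q"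
    unfolding M2_def using f by (auto simp: scratch_def)
  have v2: "\<forall>q. M2 q < cap" unfolding M2_def using pr(5) b3 x by auto
  have "\<forall>q. q < 7 \<longrightarrow> M2 q = M q" using m2 by (auto simp: scratch_def)
  hence ps2: "u1_regs R cap m bm M2" using u1_regs_keep[OF ps _ v2] by blast
  have mr2: "relocated R amax Mo M2" using mr unfolding relocated_def M2_def using f by auto
  have i2: "M2 rI0 = p" "M2 rI1 = x" unfolding M2_def by auto
  have pa: "sim_params R amax cap capo Bd" using oc by (simp add: u1_ctx_def)
  from reach_update[OF pa ps2 ca2 _ _ mr2 mob, unfolded i2, OF b3(2) x rn, of inp "[]"]
  obtain k M3 where k: "k \<le> block_size * Bd" and e2: "reach Q inp cap k (s + 3, M2, []) (s + 3 + len_upd Pu, M3, [])"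
    and m3: "relocated R amax Mo' M3" "\<forall>q. \<not> scratch R q \<and> \<not> ds_cell R amax q \<longrightarrow> M3 q = M2 q" "\<forall>a. Mo' a < capo" "u1_regs R cap m bm M3"
    by blast
  have "M3 rIX = i" using m3(2) i(3) f unfolding M2_def by (auto simp: scratch_def ds_cell_def)
  moreover have "\<forall>q. \<not> scratch R q \<and> \<not> ds_cell R amax q \<and> q \<noteq> rI0 \<and> q \<noteq> rI1 \<longrightarrow> M3 q = M q"
    using m3(2) m2 by auto
  moreover have "3 + k \<le> block_size * Bd + 3" using k by simp
  ultimately show ?thesis using reach_trans[OF e1 e2] m3 by blast
qed

lemma reach_query_update_pair:
  assumes oc: "u1_ctx R amax cap capo Bd m bm n" and ps: "u1_regs R cap m bm M" and i: "1 \<le> i" "i \<le> n" "M rIX = i"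
    and ca1: "code_at Q s [Mul rT rIX rTHREE, Sub rI0 rT rONE, Const rI1 x]"
    and ca2: "code_at Q (s + 3) (compile MU R (s + 3) 0 Pu)"
    and ca3: "code_at Q (s + 3 + len_upd Pu) [Mul rT rIX rTHREE, Add rI0 rT rZ, Const rI1 x]"
    and ca4: "code_at Q (s + 3 + len_upd Pu + 3) (compile MU R (s + 3 + len_upd Pu + 3) 0 Pu)"
    and x: "x < cap" and mr: "relocated R amax Mo M" and mob: "\<forall>a. Mo a < capo"
    and r1: "run Pu [3 * i - 1, x] capo amax Bd Mo = Some (Mo1, rr1)"
    and r2: "run Pu [3 * i, x] capo amax Bd Mo1 = Some (Mo2, rr2)"
  shows "\<exists>k M'. k \<le> 2 * (block_size * Bd) + 6 \<and>
    reach Q inp cap k (s, M, []) (s + 3 + len_upd Pu + 3 + len_upd Pu, M', []) \<and>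
    u1_regs R cap m bm M' \<and> relocated R amax Mo2 M' \<and> (\<forall>a. Mo2 a < capo) \<and> M' rIX = i \<and>
    (\<forall>q. \<not> scratch R q \<and> \<not> ds_cell R amax q \<and> q \<noteq> rI0 \<and> q \<noteq> rI1 \<longrightarrow> M' q = M q)"
proof -
  from reach_query_update[OF oc ps i ca1 _ ca2 x mr mob r1, where inp = inp]
  obtain k1 M1 where k1: "k1 \<le> block_size * Bd + 3"
    and e1: "reach Q inp cap k1 (s, M, []) (s + 3 + len_upd Pu, M1, [])"
    and m1: "u1_regs R cap m bm M1" "relocated R amax Mo1 M1" "\<forall>a. Mo1 a < capo" "M1 rIX = i"
      "\<forall>q. \<not> scratch R q \<and> \<not> ds_cell R amax q \<and> q \<noteq> rI0 \<and> q \<noteq> rI1 \<longrightarrow> M1 q = M q"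
    by auto
  from reach_query_update[OF oc m1(1) i(1,2) m1(4) ca3 _ ca4 x m1(2,3) r2, where inp = inp]
  obtain k2 M2 where k2: "k2 \<le> block_size * Bd + 3"
    and e2: "reach Q inp cap k2 (s + 3 + len_upd Pu, M1, []) (s + 3 + len_upd Pu + 3 + len_upd Pu, M2, [])"
    and m2: "u1_regs R cap m bm M2" "relocated R amax Mo2 M2" "\<forall>a. Mo2 a < capo" "M2 rIX = i"
      "\<forall>q. \<not> scratch R q \<and> \<not> ds_cell R amax q \<and> q \<noteq> rI0 \<and> q \<noteq> rI1 \<longrightarrow> M2 q = M1 q"
    by auto
  have "k1 + k2 \<le> 2 * (block_size * Bd) + 6" using k1 k2 by linarith
  with reach_trans[OF e1 e2] m1(5) m2 show ?thesis by auto
qed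

text \<open>The enumeration only has to be run until its first output; the cells it wrote are then
  restored from the log, and bm records whether there was an output.\<close>
lemma reach_query_enum_undo:
  assumes oc: "u1_ctx R amax cap capo Bd m bm n" and ps: "u1_regs R cap m bm N"
    and mr: "relocated R amax Mo N" and mob: "\<forall>a. Mo a < capo"
    and en: "enum_ok L Pe capo amax Bd w Mo"
  shows "\<exists>k N'. k \<le> block_size * Bd + 9 * Bd + 6 \<and>
    reach (u1_prog R Pu Pe) inp cap k (addr_query_upd2 Pu + len_upd Pu, N, []) (addr_undo Pu Pe + 9, N', []) \<and>
    u1_regs R cap m bm N' \<and> relocated R amax Mo N' \<and> N' bm = (if infixes L w = {} then 0 else 1) \<and>
    (\<forall>q. \<not> scratch R q \<and> q \<noteq> bm \<longrightarrow> N' q = N q)"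
proof -
  let ?Q = "u1_prog R Pu Pe"
  note f = u1_ctxD[OF oc]
  note pc = u1_prog_code_at[of R Pu Pe]
  have rc: "\<And>q. q \<le> 20 \<Longrightarrow> q < cap" using f by linarith
  have pa: "sim_params R amax cap capo Bd" using oc by (simp add: u1_ctx_def)
  have nsb: "\<not> scratch R bm" "\<not> ds_cell R amax bm" using f by (auto simp: scratch_def ds_cell_def)
  have pn: "N rZ = 0" "N rONE = 1" "N rLB = log_base" "N rBM = bm" "\<forall>q. N q < cap"
    using ps by (auto simp: u1_regs_def)
  define M3 where "M3 = N(rLP := log_base, bm := 0)"
  have "run_straight inp cap cap [Add rLP rLB rZ, Store rBM rZ] N = Some M3"
    unfolding M3_def using pn rc f by auto
  from reach_run_straightI[OF pc(13)[unfolded enum_init_code_def] this]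
  have e3: "reach ?Q inp cap 2 (addr_query_upd2 Pu + len_upd Pu, N, []) (addr_enum Pu, M3, [])"
    by (simp add: addr_query_upd2_def addr_enum_def)
  have m3: "\<forall>q. q \<noteq> rLP \<and> q \<noteq> bm \<longrightarrow> M3 q = N q" "M3 rLP = log_base" "M3 bm = 0"
    unfolding M3_def using f by auto
  have v3: "\<forall>q. M3 q < cap" unfolding M3_def using pn rc f by auto
  have "\<forall>q. q < 7 \<longrightarrow> M3 q = N q" using m3(1) f by auto
  hence ps3: "u1_regs R cap m bm M3" using u1_regs_keep[OF ps _ v3] by blast
  have mr3: "relocated R amax Mo M3" using mr m3(1) f unfolding relocated_def by auto
  from reach_enum[OF pa ps3 m3(2) pc(14) mr3 mob en, where inp = inp and Os = "[]"]
  obtain k4 N3 lg where k4: "k4 \<le> block_size * Bd + 1"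
    and e4: "reach ?Q inp cap k4 (addr_enum Pu, M3, []) (if infixes L w = {} then addr_enum Pu + len_enum Pe else addr_found Pu Pe, N3, [])"
    and li: "log_inv R amax M3 lg N3" "length lg \<le> Bd"
    and n3: "\<forall>q. \<not> scratch R q \<and> \<not> ds_cell R amax q \<longrightarrow> N3 q = M3 q" "\<forall>q. N3 q < cap" by blast
  have n3b: "N3 bm = 0" "N3 rBM = bm" "N3 rONE = 1" "N3 rLB = log_base"
    using n3(1) nsb m3(3) ps3 f by (auto simp: u1_regs_def scratch_def ds_cell_def)
  define ans where "ans = (if infixes L w = {} then (0::nat) else 1)"
  obtain k5 where k5: "k5 \<le> 1" and e5: "reach ?Q inp cap k5
      (if infixes L w = {} then addr_enum Pu + len_enum Pe else addr_found Pu Pe, N3, []) (addr_undo Pu Pe, N3(bm := ans), [])"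
  proof (cases "infixes L w = {}")
    case True
    have "N3(bm := ans) = N3" using n3b True unfolding ans_def by auto
    with reach_Jmp[OF pc(15)] True show ?thesis using that[of 1] by simp
  next
    case False
    have "run_straight inp cap cap [Store rBM rONE] N3 = Some (N3(bm := 1))" using n3b rc f by auto
    from reach_run_straightI[OF pc(16) this] False
    have "reach ?Q inp cap 1 (addr_found Pu Pe, N3, []) (addr_undo Pu Pe, N3(bm := ans), [])"
      unfolding ans_def by (simp add: addr_found_def addr_undo_def)
    with False show ?thesis using that[of 1] by simp
  qed
  have v4: "\<forall>q. (N3(bm := ans)) q < cap" using n3(2) rc unfolding ans_def by auto
  have r4: "(N3(bm := ans)) rLB = log_base" "(N3(bm := ans)) rONE = 1" using n3b f by auto
  from reach_undo[OF pa pc(17) li r4 v4 refl nsb, where inp = inp and Os = "[]"]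
  obtain k6 N4 where k6: "k6 \<le> 9 * Bd + 2"
    and e6: "reach ?Q inp cap k6 (addr_undo Pu Pe, N3(bm := ans), []) (addr_undo Pu Pe + 9, N4, [])"
    and n4: "\<forall>q. \<not> scratch R q \<longrightarrow> N4 q = (M3(bm := ans)) q" "\<forall>q. N4 q < cap" by blast
  have "\<forall>q. q < 7 \<longrightarrow> N4 q = M3 q" using n4(1) f by (auto simp: scratch_def)
  hence "u1_regs R cap m bm N4" using u1_regs_keep[OF ps3 _ n4(2)] by blast
  moreover have "relocated R amax Mo N4" using mr3 n4(1) f unfolding relocated_def by (auto simp: scratch_def)
  moreover have "N4 bm = ans" using n4(1) nsb by auto
  moreover have "\<forall>q. \<not> scratch R q \<and> q \<noteq> bm \<longrightarrow> N4 q = N q"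
    using n4(1) m3(1) f by (auto simp: scratch_def)
  moreover have "2 + (k4 + (k5 + k6)) \<le> block_size * Bd + 9 * Bd + 6" using k4 k5 k6 by linarith
  ultimately show ?thesis
    using reach_trans[OF e3 reach_trans[OF e4 reach_trans[OF e5 e6]]] unfolding ans_def by blast
qed

lemma run_u1_prefix_query:
  assumes oc: "u1_ctx R amax cap capo Bd m bm n" and ps: "u1_regs R cap m bm M" and i: "1 \<le> i" "i \<le> n"
    and mr: "relocated R amax Mo M" and mob: "\<forall>a. Mo a < capo"
    and r1: "run Pu [3 * i - 1, 1] capo amax Bd Mo = Some (Mq1, rr1)"
    and r2: "run Pu [3 * i, 1] capo amax Bd Mq1 = Some (Mq, rr2)"
    and en: "enum_ok L Pe capo amax Bd w Mq"
    and r3: "run Pu [3 * i - 1, 3] capo amax Bd Mq = Some (Mr1, rr3)"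
    and r4: "run Pu [3 * i, 3] capo amax Bd Mr1 = Some (Mr, rr4)"
    and F: "5 * (block_size * Bd) + 9 * Bd + 40 \<le> F"
  shows "\<exists>M' Os t W. run (u1_prog R Pu Pe) [4, i] cap cap F M = Some (M', Os, t, W) \<and> (Os \<noteq> []) = (infixes L w = {}) \<and>
    u1_regs R cap m bm M' \<and> relocated R amax Mr M' \<and> (\<forall>a. Mr a < capo) \<and>
    (\<forall>q. R + amax \<le> q \<and> q \<noteq> bm \<longrightarrow> M' q = M q)"
proof -
  let ?Q = "u1_prog R Pu Pe" let ?inp = "[4, i]"
  note f = u1_ctxD[OF oc]
  note pc = u1_prog_code_at[of R Pu Pe]
  have rc: "\<And>q. q \<le> 20 \<Longrightarrow> q < cap" using f by linarith
  have ic: "i < cap" using f i by linarith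
  from reach_dispatch[OF pc(1) ps _ ic f(9), of 4] obtain k0 Md where
    k0: "k0 \<le> 9" and e0: "reach ?Q ?inp cap k0 (0, M, []) (addr_query Pu, Md, [])" and
    md: "Md rOP = 4" "Md rIX = i" "\<forall>q. q \<noteq> rOP \<and> q \<noteq> rIX \<and> q \<noteq> rT \<longrightarrow> Md q = M q" "\<forall>q. Md q < cap"
    by (auto simp: dispatch_target_def)
  have psd: "u1_regs R cap m bm Md" using u1_regs_keep[OF ps _ md(4)] md(3) by auto
  have mrd: "relocated R amax Mo Md" using mr md(3) f unfolding relocated_def by auto
  have x: "(1::nat) < cap" "(3::nat) < cap" using f by linarith+
  have "code_at ?Q (addr_query Pu + 3) (compile MU R (addr_query Pu + 3) 0 Pu)"
    "code_at ?Q (addr_query Pu + 3 + len_upd Pu) [Mul rT rIX rTHREE, Add rI0 rT rZ, Const rI1 1]"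
    "code_at ?Q (addr_query Pu + 3 + len_upd Pu + 3) (compile MU R (addr_query Pu + 3 + len_upd Pu + 3) 0 Pu)"
    using pc(10-12) by (simp_all add: addr_query_def addr_query_upd1_def addr_query_upd2_def query_b2_code_def)
  from reach_query_update_pair[OF oc psd i md(2) pc(9)[unfolded query_b1_code_def] this x(1) mrd mob r1 r2,
      where inp = ?inp]
  obtain k1 N2 where k1: "k1 \<le> 2 * (block_size * Bd) + 6"
    and e1: "reach ?Q ?inp cap k1 (addr_query Pu, Md, []) (addr_query_upd2 Pu + len_upd Pu, N2, [])"
    and n2: "u1_regs R cap m bm N2" "relocated R amax Mq N2" "\<forall>a. Mq a < capo" "N2 rIX = i"
      "\<forall>q. \<not> scratch R q \<and> \<not> ds_cell R amax q \<and> q \<noteq> rI0 \<and> q \<noteq> rI1 \<longrightarrow> N2 q = Md q"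
    by (auto simp: addr_query_def addr_query_upd2_def add_ac)
  from reach_query_enum_undo[OF oc n2(1-3) en, where inp = ?inp]
  obtain k2 N4 where k2: "k2 \<le> block_size * Bd + 9 * Bd + 6"
    and e2: "reach ?Q ?inp cap k2 (addr_query_upd2 Pu + len_upd Pu, N2, []) (addr_undo Pu Pe + 9, N4, [])"
    and n4: "u1_regs R cap m bm N4" "relocated R amax Mq N4" "N4 bm = (if infixes L w = {} then 0 else 1)"
      "\<forall>q. \<not> scratch R q \<and> q \<noteq> bm \<longrightarrow> N4 q = N2 q"
    by blast
  have n4i: "N4 rIX = i" using n4(4) n2(4) f by (auto simp: scratch_def)
  have "code_at ?Q (addr_undo Pu Pe + 9 + 3) (compile MU R (addr_undo Pu Pe + 9 + 3) 0 Pu)"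
    "code_at ?Q (addr_undo Pu Pe + 9 + 3 + len_upd Pu) [Mul rT rIX rTHREE, Add rI0 rT rZ, Const rI1 3]"
    "code_at ?Q (addr_undo Pu Pe + 9 + 3 + len_upd Pu + 3) (compile MU R (addr_undo Pu Pe + 9 + 3 + len_upd Pu + 3) 0 Pu)"
    using pc(19-21) by (simp_all add: addr_undo_def addr_restore_upd1_def addr_restore_upd2_def query_e2_code_def add_ac)
  from reach_query_update_pair[OF oc n4(1) i n4i pc(18)[unfolded query_e1_code_def] this x(2) n4(2) n2(3) r3 r4,
      where inp = ?inp]
  obtain k3 N6 where k3: "k3 \<le> 2 * (block_size * Bd) + 6"
    and e3: "reach ?Q ?inp cap k3 (addr_undo Pu Pe + 9, N4, []) (addr_answer Pu Pe, N6, [])"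
    and n6: "u1_regs R cap m bm N6" "relocated R amax Mr N6" "\<forall>a. Mr a < capo"
      "\<forall>q. \<not> scratch R q \<and> \<not> ds_cell R amax q \<and> q \<noteq> rI0 \<and> q \<noteq> rI1 \<longrightarrow> N6 q = N4 q"
    by (auto simp: addr_undo_def addr_answer_def add_ac)
  define ans where "ans = (if infixes L w = {} then (0::nat) else 1)"
  note fc = answer_code_at[OF pc(22)]
  have n6b: "N6 bm = ans" "N6 rBM = bm"
    using n6(4) n4(3) n6(1) f unfolding ans_def by (auto simp: u1_regs_def scratch_def ds_cell_def)
  define N7 where "N7 = N6(rV := ans)"
  have "run_straight ?inp cap cap [Load rV rBM] N6 = Some N7"
    unfolding N7_def using n6b rc f x unfolding ans_def by auto
  from reach_run_straightI[OF fc(1) this] have e4: "reach ?Q ?inp cap 1 (addr_answer Pu Pe, N6, []) (addr_answer Pu Pe + 1, N7, [])"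
    by simp
  have j: "reach ?Q ?inp cap 1 (addr_answer Pu Pe + 1, N7, []) (if ans = 0 then addr_answer Pu Pe + 3 else Suc (addr_answer Pu Pe + 1), N7, [])"
    using reach_Jz[OF fc(2), of cap ?inp N7 "[]"] rc unfolding N7_def by auto
  define K where "K = k0 + (k1 + (k2 + (k3 + (1 + 1))))"
  have eall: "reach ?Q ?inp cap K (0, M, []) (if ans = 0 then addr_answer Pu Pe + 3 else Suc (addr_answer Pu Pe + 1), N7, [])"
    unfolding K_def using reach_trans[OF e0 reach_trans[OF e1 reach_trans[OF e2 reach_trans[OF e3 reach_trans[OF e4 j]]]]] .
  have Kb: "K + 2 \<le> F" unfolding K_def using k0 k1 k2 k3 F by linarith
  have v7: "\<forall>q. N7 q < cap" using n6(1) x unfolding N7_def u1_regs_def ans_def by auto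
  have "\<forall>q. q < 7 \<longrightarrow> N7 q = N6 q" unfolding N7_def by auto
  hence ps7: "u1_regs R cap m bm N7" using u1_regs_keep[OF n6(1) _ v7] by blast
  have mr7: "relocated R amax Mr N7" using n6(2) f unfolding relocated_def N7_def by auto
  have keep: "\<forall>q. R + amax \<le> q \<and> q \<noteq> bm \<longrightarrow> N7 q = M q"
  proof (intro allI impI)
    fix q assume q: "R + amax \<le> q \<and> q \<noteq> bm"
    hence ns: "\<not> scratch R q" "\<not> ds_cell R amax q" "q \<noteq> rI0" "q \<noteq> rI1" "q \<noteq> rV" "q \<noteq> rOP" "q \<noteq> rIX" "q \<noteq> rT"
      using f by (auto simp: scratch_def ds_cell_def)
    have "N7 q = N6 q" using ns unfolding N7_def by simp
    also have "\<dots> = N4 q" using n6(4) ns by auto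
    also have "\<dots> = N2 q" using n4(4) ns q by auto
    also have "\<dots> = Md q" using n2(5) ns by auto
    also have "\<dots> = M q" using md(3) ns by auto
    finally show "N7 q = M q" .
  qed
  show ?thesis
  proof (cases "ans = 0")
    case True
    hence emp: "infixes L w = {}" unfolding ans_def by (auto split: if_splits)
    have lq: "length ?Q \<le> Suc (addr_answer Pu Pe + 3)" using pc(23) by (simp add: addr_halt_def addr_answer_def)
    from reach_run_out[OF eall[unfolded if_P[OF True]] fc(4) lq _ _, of F] rc Kb
    obtain t W Os where "run ?Q ?inp cap cap F M = Some (N7, Os, t, W)" "Os \<noteq> []" by auto
    with emp ps7 mr7 n6(3) keep show ?thesis by blast
  next
    case False
    hence nemp: "infixes L w \<noteq> {}" unfolding ans_def by (auto split: if_splits)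
    have e5: "reach ?Q ?inp cap (K + 1) (0, M, []) (addr_halt Pu Pe, N7, [])"
      using reach_trans[OF eall[unfolded if_not_P[OF False]] reach_Jmp] fc(3) by simp
    from reach_run[OF e5, of F] pc(23) Kb obtain t W where "run ?Q ?inp cap cap F M = Some (N7, [], t, W)" by auto
    with nemp ps7 mr7 n6(3) keep show ?thesis by blast
  qed
qed

definition init_prologue :: "nat \<Rightarrow> nat \<Rightarrow> instr list" where
  "init_prologue R Bd = [Input rN rZ, Const rONE 1, Const rTHREE 3, Const rRR R, Const rLB 21, Mul rT rN rTHREE,
     Add rMM rT rONE, Const rT2 Bd, Add rT rMM rONE, Mul rT rT rT2, Add rBM rT rRR]"

definition u1_init_prog :: "nat \<Rightarrow> nat \<Rightarrow> instr list \<Rightarrow> instr list" where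
  "u1_init_prog R Bd Pb = init_prologue R Bd @ compile MB R 11 0 Pb"

lemma build_input_eq:
  fixes n :: nat
  defines "m \<equiv> 3 * n + 1"
  shows "(if v < length (m # map code (set_word n {})) then (m # map code (set_word n {})) ! v else 0) =
    (if v = 0 then m else if v = 1 then 0 else if v \<le> m then 3 else 0)"
proof (cases v)
  case 0 then show ?thesis by simp
next
  case (Suc v')
  show ?thesis
  proof (cases "v' < m")
    case True
    hence "(m # map code (set_word n {})) ! v = code (set_letter {} v')" using Suc by (simp add: set_word_def m_def del: upt_Suc)
    then show ?thesis using Suc True by (auto simp: set_letter_def m_def)
  next
    case False
    then show ?thesis using Suc by (simp add: set_word_def m_def)
  qed
qed

lemma run_u1_init:
  assumes oc: "u1_ctx R amax cap capo Bd m bm n" and am: "amax = Bd * (m + 1)" and c0: "0 < capo"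
    and rn: "run Pb (m # map code (set_word n {})) capo amax (Bd * (m + 1)) (\<lambda>_. 0) = Some (M0ds, rr)"
  shows "\<exists>fuel M0 Os t W. run (u1_init_prog R Bd Pb) [n] cap cap fuel (\<lambda>_. 0) = Some (M0, Os, t, W) \<and> u1_regs R cap m bm M0 \<and>
    relocated R amax M0ds M0 \<and> (\<forall>a. M0ds a < capo) \<and> (\<forall>j. M0 (bm + j) = 0)"
proof -
  note f = u1_ctxD[OF oc]
  have rc: "\<And>q. q \<le> 20 \<Longrightarrow> q < cap" using f by linarith
  have bds: "Bd < cap" "R < cap" "n < cap" "3 * n < cap" "m < cap" "m + 1 < cap" "(m + 1) * Bd < cap" "(m + 1) * Bd + R < cap" "log_base < cap"
    using f am by (auto simp: algebra_simps)
  define Mp where "Mp = (\<lambda>_::nat. 0::nat)(rN := n, rONE := 1, rTHREE := 3, rRR := R, rLB := 21, rT := 3 * n,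
     rMM := m, rT2 := Bd, rT := m + 1, rT := (m + 1) * Bd, rBM := bm)"
  have "run_straight [n] cap cap (init_prologue R Bd) (\<lambda>_. 0) = Some Mp"
    unfolding init_prologue_def Mp_def using bds rc f am by (auto simp: algebra_simps)
  have self: "code_at (u1_init_prog R Bd Pb) 0 (init_prologue R Bd @ compile MB R 11 0 Pb)" by (simp add: u1_init_prog_def code_at_def)
  have l11: "length (init_prologue R Bd) = 11" by (simp add: init_prologue_def)
  have cp: "code_at (u1_init_prog R Bd Pb) 0 (init_prologue R Bd)" "code_at (u1_init_prog R Bd Pb) 11 (compile MB R 11 0 Pb)"
    using code_at_appendD1[OF self] code_at_appendD2[OF self] l11 by simp_all
  from reach_run_straightI[OF cp(1) \<open>run_straight [n] cap cap (init_prologue R Bd) (\<lambda>_. 0) = Some Mp\<close>] have e1: "reach (u1_init_prog R Bd Pb) [n] cap 11 (0, \<lambda>_. 0, []) (11, Mp, [])"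
    by (simp add: init_prologue_def)
  have mp: "Mp rZ = 0" "Mp rONE = 1" "Mp rTHREE = 3" "Mp rRR = R" "Mp rMM = m" "Mp rBM = bm" "Mp rLB = log_base"
    "\<forall>q. Mp q < cap" "\<And>q. 21 \<le> q \<Longrightarrow> Mp q = 0"
    unfolding Mp_def using bds rc f am by (auto simp: algebra_simps)
  have iv: "\<forall>v. (if v < length (m # map code (set_word n {})) then (m # map code (set_word n {})) ! v else 0) = input_val MB Mp v"
  proof
    fix v show "(if v < length (m # map code (set_word n {})) then (m # map code (set_word n {})) ! v else 0) = input_val MB Mp v"
      using build_input_eq[of v n] mp(5) f(6) by (simp only: input_val.simps)
  qed
  have cx: "sim_ctx MB R cap capo amax Bd Mp (m # map code (set_word n {}))"
    unfolding sim_ctx_def using mp(1-5) f bds iv by auto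
  from rn obtain pf Os' T W where st: "steps Pb (m # map code (set_word n {})) capo amax (Bd * (m + 1)) (0, \<lambda>_. 0, [], 0, {}) = Some (pf, M0ds, Os', T, W)"
    and hl: "length Pb \<le> pf" unfolding run_def by (auto split: option.splits if_splits)
  have mr0: "relocated R amax (\<lambda>_. 0) Mp" unfolding relocated_def using mp(9) f by auto
  from steps_compile_run[OF cx cp(2) st hl mr0 _ _, of "[n]" "[]" 0 "{}"] c0
  obtain k' Mc' Wc' where e: "steps (u1_init_prog R Bd Pb) [n] cap cap k' (11, Mp, [], 0, {}) = Some (11 + block_size * length Pb, Mc', [], 0 + k', Wc')"
    and r: "relocated R amax M0ds Mc'" "\<forall>q. \<not> scratch R q \<and> \<not> ds_cell R amax q \<longrightarrow> Mc' q = Mp q" "\<forall>a. M0ds a < capo"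
    by auto
  from reach_of_steps[of _ _ _ k' 11 Mp "[]" 0 "{}"] e have e2: "reach (u1_init_prog R Bd Pb) [n] cap k' (11, Mp, []) (11 + block_size * length Pb, Mc', [])" by simp
  have lp: "length (u1_init_prog R Bd Pb) \<le> 11 + block_size * length Pb" unfolding u1_init_prog_def by (simp add: init_prologue_def)
  from reach_run[OF reach_trans[OF e1 e2] lp order_refl] obtain t W' where
    rr': "run (u1_init_prog R Bd Pb) [n] cap cap (11 + k') (\<lambda>_. 0) = Some (Mc', [], t, W')" by auto
  have v: "\<forall>q. Mc' q < cap" using steps_mem_bounded[OF e] mp(8) by simp
  have "\<forall>q. q < 7 \<longrightarrow> Mc' q = Mp q" using r(2) f by (auto simp: scratch_def ds_cell_def)
  hence ps: "u1_regs R cap m bm Mc'" using v mp unfolding u1_regs_def by auto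
  have bz: "\<forall>j. Mc' (bm + j) = 0" using r(2) mp(9) f by (auto simp: scratch_def ds_cell_def)
  from rr' ps r(1,3) bz show ?thesis by blast
qed



section \<open>Tractability of L3 refutes the prefix-U1 hypothesis\<close>

lemma upds_append: "upds Pu cap amax Bd M (xs @ ys) = Option.bind (upds Pu cap amax Bd M xs) (\<lambda>M'. upds Pu cap amax Bd M' ys)"
  by (induction xs arbitrary: M) (auto split: option.splits)

lemma upds_one: "upds Pu cap amax Bd M [(p, x)] = Some M' \<Longrightarrow> \<exists>r. run Pu [p, code x] cap amax Bd M = Some (M', r)"
  by (auto split: option.splits)

lemma upds_two: "upds Pu cap amax Bd M [(p, x), (p', x')] = Some M' \<Longrightarrow>
   \<exists>M1 r r'. run Pu [p, code x] cap amax Bd M = Some (M1, r) \<and> run Pu [p', code x'] cap amax Bd M1 = Some (M', r')"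
  by (auto split: option.splits)

lemma apply_upds_append: "apply_upds w (xs @ ys) = apply_upds (apply_upds w xs) ys"
  by (simp add: apply_upds_def)

lemma apply_upds_one: "apply_upds w [(p, x)] = w[p - 1 := x]" by (simp add: apply_upds_def)
lemma apply_upds_two: "apply_upds w [(p, x), (p', x')] = w[p - 1 := x, p' - 1 := x']" by (simp add: apply_upds_def)




definition upds_enum_ok :: "sym list set \<Rightarrow> instr list \<Rightarrow> instr list \<Rightarrow> nat \<Rightarrow> nat \<Rightarrow> nat \<Rightarrow> nat \<Rightarrow> mem \<Rightarrow> sym list \<Rightarrow> bool" where
  "upds_enum_ok L Pu Pe cap amax Bd m M0 w \<longleftrightarrow> (\<forall>us. valid_upds m us \<longrightarrow>
     (\<exists>M. upds Pu cap amax Bd M0 us = Some M \<and> enum_ok L Pe cap amax Bd (apply_upds w us) M))"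

text \<open>The simulated memory is reached from the build memory M0ds by updates that turn the
  word of the empty set into the word of S.\<close>
definition u1_inv :: "instr list \<Rightarrow> nat \<Rightarrow> nat \<Rightarrow> nat \<Rightarrow> nat \<Rightarrow> nat \<Rightarrow> nat \<Rightarrow> nat \<Rightarrow> nat \<Rightarrow> mem \<Rightarrow> nat set \<Rightarrow> mem \<Rightarrow> bool" where
  "u1_inv Pu R Bd n capo amax cap m bm M0ds S M \<longleftrightarrow> S \<subseteq> {1..n} \<and> u1_regs R cap m bm M \<and>
     (\<forall>j. 1 \<le> j \<and> j \<le> n \<longrightarrow> M (bm + j) = (if j \<in> S then 1 else 0)) \<and>
     (\<exists>us Mds. valid_upds m us \<and> upds Pu capo amax Bd M0ds us = Some Mds \<and> apply_upds (set_word n {}) us = set_word n S \<and>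
        relocated R amax Mds M \<and> (\<forall>a. Mds a < capo))"

lemma u1_inv_member:
  assumes oc: "u1_ctx R amax cap capo Bd m bm n" and inv: "u1_inv Pu R Bd n capo amax cap m bm M0ds S M"
    and i: "1 \<le> i" "i \<le> n" and F: "20 \<le> Cst"
  shows "\<exists>M' Os t W. run (u1_prog R Pu Pe) [1, i] cap cap Cst M = Some (M', Os, t, W) \<and>
    (Os \<noteq> []) = (i \<in> S) \<and> u1_inv Pu R Bd n capo amax cap m bm M0ds S M'"
proof -
  note f = u1_ctxD[OF oc]
  from inv have S: "S \<subseteq> {1..n}" and ps: "u1_regs R cap m bm M"
    and bmp: "\<forall>j. 1 \<le> j \<and> j \<le> n \<longrightarrow> M (bm + j) = (if j \<in> S then 1 else 0)"
    unfolding u1_inv_def by auto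
  from inv obtain us Mds where us: "valid_upds m us" "upds Pu capo amax Bd M0ds us = Some Mds"
    "apply_upds (set_word n {}) us = set_word n S" "relocated R amax Mds M" "\<forall>a. Mds a < capo"
    unfolding u1_inv_def by blast
  from run_u1_member[OF oc ps i F, of Pu Pe] obtain M' Os t W where
    r: "run (u1_prog R Pu Pe) [1, i] cap cap Cst M = Some (M', Os, t, W)" "(Os \<noteq> []) = (M (bm + i) \<noteq> 0)"
      "u1_regs R cap m bm M'" "\<forall>q. \<not> scratch R q \<and> q \<noteq> rOP \<and> q \<noteq> rIX \<longrightarrow> M' q = M q" by blast
  have "\<forall>j. 1 \<le> j \<and> j \<le> n \<longrightarrow> M' (bm + j) = (if j \<in> S then 1 else 0)"
    using r(4) bmp f by (auto simp: scratch_def)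
  moreover have "relocated R amax Mds M'"
    using us(4) r(4) f unfolding relocated_def by (auto simp: scratch_def)
  ultimately have "u1_inv Pu R Bd n capo amax cap m bm M0ds S M'"
    unfolding u1_inv_def using S r(3) us by blast
  moreover have "(Os \<noteq> []) = (i \<in> S)" using r(2) bmp i by auto
  ultimately show ?thesis using r(1) by blast
qed

lemma u1_inv_insert_remove:
  assumes oc: "u1_ctx R amax cap capo Bd m bm n" and inv: "u1_inv Pu R Bd n capo amax cap m bm M0ds S M"
    and T: "upds_enum_ok L3 Pu Pe capo amax Bd m M0ds (set_word n {})"
    and i: "1 \<le> i" "i \<le> n" and op: "op = 2 \<or> op = 3" and F: "block_size * Bd + 20 \<le> Cst"
  shows "\<exists>M' Os t W. run (u1_prog R Pu Pe) [op, i] cap cap Cst M = Some (M', Os, t, W) \<and>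
    u1_inv Pu R Bd n capo amax cap m bm M0ds (if op = 2 then insert i S else S - {i}) M'"
proof -
  note f = u1_ctxD[OF oc]
  let ?x = "if op = 2 then C else E"
  let ?S' = "if op = 2 then insert i S else S - {i}"
  from inv have S: "S \<subseteq> {1..n}" and ps: "u1_regs R cap m bm M"
    and bmp: "\<forall>j. 1 \<le> j \<and> j \<le> n \<longrightarrow> M (bm + j) = (if j \<in> S then 1 else 0)"
    unfolding u1_inv_def by auto
  from inv obtain us Mds where us: "valid_upds m us" "upds Pu capo amax Bd M0ds us = Some Mds"
    "apply_upds (set_word n {}) us = set_word n S" "relocated R amax Mds M" "\<forall>a. Mds a < capo"
    unfolding u1_inv_def by blast
  let ?us' = "us @ [(3 * i + 1, ?x)]"
  have v: "valid_upds m ?us'" using us(1) i f by (auto simp: valid_upds_def)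
  from T v obtain Mds' where u': "upds Pu capo amax Bd M0ds ?us' = Some Mds'"
    unfolding upds_enum_ok_def by blast
  hence "upds Pu capo amax Bd Mds [(3 * i + 1, ?x)] = Some Mds'" using us(2) by (simp add: upds_append)
  from upds_one[OF this] obtain rr where "run Pu [3 * i + 1, code ?x] capo amax Bd Mds = Some (Mds', rr)" by blast
  hence rn: "run Pu [3 * i + 1, if op = 2 then 2 else 3] capo amax Bd Mds = Some (Mds', rr)"
    by (cases "op = 2") auto
  from run_u1_insert_remove[OF oc ps i op us(4) us(5) rn F, of Pe] obtain M' Os t W where
    r: "run (u1_prog R Pu Pe) [op, i] cap cap Cst M = Some (M', Os, t, W)" "u1_regs R cap m bm M'" "relocated R amax Mds' M'"
      "\<forall>a. Mds' a < capo" "M' (bm + i) = (if op = 2 then 1 else 0)" "\<forall>q. R + amax \<le> q \<and> q \<noteq> bm + i \<longrightarrow> M' q = M q"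
    by blast
  have "?S' \<subseteq> {1..n}" using S i by auto
  moreover have "\<forall>j. 1 \<le> j \<and> j \<le> n \<longrightarrow> M' (bm + j) = (if j \<in> ?S' then 1 else 0)"
  proof (intro allI impI)
    fix j assume j: "1 \<le> j \<and> j \<le> n"
    show "M' (bm + j) = (if j \<in> ?S' then 1 else 0)"
    proof (cases "j = i")
      case True then show ?thesis using r(5) by auto
    next
      case False
      hence "M' (bm + j) = M (bm + j)" using r(6) f by auto
      then show ?thesis using bmp j False by auto
    qed
  qed
  moreover have "apply_upds (set_word n {}) ?us' = set_word n ?S'"
    using us(3) set_word_insert[OF i] set_word_remove[OF i] by (simp add: apply_upds_append apply_upds_one)
  ultimately have "u1_inv Pu R Bd n capo amax cap m bm M0ds ?S' M'"
    unfolding u1_inv_def using r(2,3,4) v u' by blast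
  with r(1) show ?thesis by blast
qed

lemma u1_inv_prefix_query:
  assumes oc: "u1_ctx R amax cap capo Bd m bm n" and inv: "u1_inv Pu R Bd n capo amax cap m bm M0ds S M"
    and T: "upds_enum_ok L3 Pu Pe capo amax Bd m M0ds (set_word n {})"
    and i: "1 \<le> i" "i \<le> n" and F: "5 * (block_size * Bd) + 9 * Bd + 40 \<le> Cst"
  shows "\<exists>M' Os t W. run (u1_prog R Pu Pe) [4, i] cap cap Cst M = Some (M', Os, t, W) \<and>
    (Os \<noteq> []) = (\<forall>j\<in>S. i \<le> j) \<and> u1_inv Pu R Bd n capo amax cap m bm M0ds S M'"
proof -
  note f = u1_ctxD[OF oc]
  from inv have S: "S \<subseteq> {1..n}" and ps: "u1_regs R cap m bm M"
    and bmp: "\<forall>j. 1 \<le> j \<and> j \<le> n \<longrightarrow> M (bm + j) = (if j \<in> S then 1 else 0)"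
    unfolding u1_inv_def by auto
  from inv obtain us Mds where us: "valid_upds m us" "upds Pu capo amax Bd M0ds us = Some Mds"
    "apply_upds (set_word n {}) us = set_word n S" "relocated R amax Mds M" "\<forall>a. Mds a < capo"
    unfolding u1_inv_def by blast
  let ?us1 = "us @ [(3 * i - 1, B), (3 * i, B)]"
  let ?us2 = "?us1 @ [(3 * i - 1, E), (3 * i, E)]"
  have v1: "valid_upds m ?us1" using us(1) i f by (auto simp: valid_upds_def)
  have v2: "valid_upds m ?us2" using v1 i f by (auto simp: valid_upds_def)
  from T v1 obtain Mq where u1: "upds Pu capo amax Bd M0ds ?us1 = Some Mq"
    and en: "enum_ok L3 Pe capo amax Bd (apply_upds (set_word n {}) ?us1) Mq"
    unfolding upds_enum_ok_def by blast
  from T v2 obtain Mr where u2: "upds Pu capo amax Bd M0ds ?us2 = Some Mr"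
    unfolding upds_enum_ok_def by blast
  have "upds Pu capo amax Bd Mds [(3 * i - 1, B), (3 * i, B)] = Some Mq" using u1 us(2) by (simp add: upds_append)
  from upds_two[OF this] obtain Mq1 r1 r2 where rq: "run Pu [3 * i - 1, 1] capo amax Bd Mds = Some (Mq1, r1)"
    "run Pu [3 * i, 1] capo amax Bd Mq1 = Some (Mq, r2)" by auto
  have "upds Pu capo amax Bd Mq [(3 * i - 1, E), (3 * i, E)] = Some Mr"
    using u2 by (subst (asm) upds_append) (simp only: u1 Option.bind.simps)
  from upds_two[OF this] obtain Mr1 r3 r4 where rr: "run Pu [3 * i - 1, 3] capo amax Bd Mq = Some (Mr1, r3)"
    "run Pu [3 * i, 3] capo amax Bd Mr1 = Some (Mr, r4)" by auto
  from run_u1_prefix_query[OF oc ps i us(4,5) rq en rr F] obtain M' Os t W where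
    r: "run (u1_prog R Pu Pe) [4, i] cap cap Cst M = Some (M', Os, t, W)"
      "(Os \<noteq> []) = (infixes L3 (apply_upds (set_word n {}) ?us1) = {})"
      "u1_regs R cap m bm M'" "relocated R amax Mr M'" "\<forall>a. Mr a < capo" "\<forall>q. R + amax \<le> q \<and> q \<noteq> bm \<longrightarrow> M' q = M q"
    by blast
  have wq: "apply_upds (set_word n {}) ?us1 = query_word n S i"
  proof -
    have "apply_upds (set_word n {}) ?us1 = (set_word n S)[3 * i - 1 - 1 := B, 3 * i - 1 := B]"
      using us(3) by (simp only: apply_upds_append apply_upds_two)
    also have "3 * i - 1 - 1 = 3 * i - 2" by simp
    finally show ?thesis using set_word_query[OF i] by simp
  qed
  have "\<forall>j. 1 \<le> j \<and> j \<le> n \<longrightarrow> M' (bm + j) = (if j \<in> S then 1 else 0)"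
    using r(6) bmp f by auto
  moreover have "apply_upds (set_word n {}) ?us2 = set_word n S"
  proof -
    have "apply_upds (set_word n {}) ?us2 = (query_word n S i)[3 * i - 1 - 1 := E, 3 * i - 1 := E]"
      using wq by (simp only: apply_upds_append apply_upds_two)
    also have "3 * i - 1 - 1 = 3 * i - 2" by simp
    finally show ?thesis using query_word_restore[OF i] by simp
  qed
  ultimately have "u1_inv Pu R Bd n capo amax cap m bm M0ds S M'"
    unfolding u1_inv_def using S r(3,4,5) v2 u2 by blast
  moreover have "(Os \<noteq> []) = (\<forall>j\<in>S. i \<le> j)"
    using r(2) wq infixes_query_word_empty_iff[OF S i] by simp
  ultimately show ?thesis using r(1) by blast
qed

lemma u1_inv_step:
  assumes oc: "u1_ctx R amax cap capo Bd m bm n" and inv: "u1_inv Pu R Bd n capo amax cap m bm M0ds S M"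
    and T: "upds_enum_ok L3 Pu Pe capo amax Bd m M0ds (set_word n {})"
    and op: "op \<in> {1, 2, 3, 4}" and i: "1 \<le> i" "i \<le> n" and F: "5 * (block_size * Bd) + 9 * Bd + 40 \<le> Cst"
  shows "\<exists>M' Os t W. run (u1_prog R Pu Pe) [op, i] cap cap Cst M = Some (M', Os, t, W) \<and>
    (op \<in> {1, 4} \<longrightarrow> (Os \<noteq> []) = fst (u1_spec S op i)) \<and>
    u1_inv Pu R Bd n capo amax cap m bm M0ds (snd (u1_spec S op i)) M'"
proof -
  have F': "20 \<le> Cst" "block_size * Bd + 20 \<le> Cst"
    using F by (simp_all add: block_size_def)
  consider "op = 1" | "op = 2" | "op = 3" | "op = 4" using op by auto
  then show ?thesis
  proof cases
    case 1
    with u1_inv_member[OF oc inv i F'(1), of Pe] show ?thesis by (simp add: u1_spec_def)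
  next
    case 2
    then have "op = 2 \<or> op = 3" by simp
    from u1_inv_insert_remove[OF oc inv T i this F'(2)] 2 show ?thesis by (simp add: u1_spec_def)
  next
    case 3
    then have "op = 2 \<or> op = 3" by simp
    from u1_inv_insert_remove[OF oc inv T i this F'(2)] 3 show ?thesis by (simp add: u1_spec_def)
  next
    case 4
    with u1_inv_prefix_query[OF oc inv T i F] show ?thesis by (simp add: u1_spec_def)
  qed
qed

lemma u1_run_correct:
  assumes oc: "u1_ctx R amax cap capo Bd m bm n"
    and T: "upds_enum_ok L3 Pu Pe capo amax Bd m M0ds (set_word n {})"
    and F: "5 * (block_size * Bd) + 9 * Bd + 40 \<le> Cst"
  shows "u1_inv Pu R Bd n capo amax cap m bm M0ds S M \<Longrightarrow> \<forall>(op, i)\<in>set ops. op \<in> {1, 2, 3, 4} \<and> 1 \<le> i \<and> i \<le> n \<Longrightarrow>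
    u1_run (u1_prog R Pu Pe) cap Cst M S ops"
proof (induction ops arbitrary: S M)
  case Nil then show ?case by simp
next
  case (Cons oi ops)
  obtain op i where oi: "oi = (op, i)" by (cases oi)
  with Cons.prems(2) have opi: "op \<in> {1, 2, 3, 4}" "1 \<le> i" "i \<le> n"
    and rest: "\<forall>(op, i)\<in>set ops. op \<in> {1, 2, 3, 4} \<and> 1 \<le> i \<and> i \<le> n" by auto
  from u1_inv_step[OF oc Cons.prems(1) T opi F] obtain M' Os t W where
    "run (u1_prog R Pu Pe) [op, i] cap cap Cst M = Some (M', Os, t, W)"
    "op \<in> {1, 4} \<longrightarrow> (Os \<noteq> []) = fst (u1_spec S op i)"
    "u1_inv Pu R Bd n capo amax cap m bm M0ds (snd (u1_spec S op i)) M'" by blast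
  with Cons.IH[OF _ rest] show ?case
    unfolding oi by simp
qed

lemma u1_ctx_bounds:
  fixes n K0 Bd :: nat
  defines "R \<equiv> log_base + 2 * Bd + 1" and "m \<equiv> 3 * n + 1"
  shows "u1_ctx R (Bd * (m + 1)) ((n + 2) ^ (2 * K0 + R + 3 * Bd + 4)) ((m + 2) ^ K0) Bd m (R + Bd * (m + 1)) n \<and> 0 < (m + 2) ^ K0"
proof -
  let ?j = "R + 3 * Bd + 3"
  let ?A = "(n + 2) ^ (2 * K0)" let ?B = "(n + 2) ^ (R + 3 * Bd + 4)"
  have cap: "(n + 2) ^ (2 * K0 + R + 3 * Bd + 4) = ?A * ?B" by (simp add: power_add add.assoc)
  have "(m + 2) ^ K0 \<le> ((n + 2) ^ 2) ^ K0"
    by (rule power_mono) (auto simp: m_def power2_eq_square)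
  hence A: "(m + 2) ^ K0 \<le> ?A" by (simp add: power_mult)
  have c0: "0 < (m + 2) ^ K0" by simp
  have "2 ^ ?j \<le> (n + 2) ^ ?j" by (rule power_mono) auto
  moreover have "?j < 2 ^ ?j" by (rule less_exp)
  ultimately have "?j + 1 \<le> (n + 2) ^ ?j" by linarith
  hence "(n + 2) * (?j + 1) \<le> (n + 2) * (n + 2) ^ ?j" by (rule mult_le_mono2)
  moreover have "(n + 2) * (n + 2) ^ ?j = ?B"
  proof -
    have "R + 3 * Bd + 4 = Suc ?j" by simp
    hence "?B = (n + 2) ^ Suc ?j" by (simp only:)
    thus ?thesis by (simp only: power_Suc)
  qed
  ultimately have B0: "(n + 2) * (?j + 1) \<le> ?B" by (rule ord_le_eq_trans)
  have j1: "?j + 1 = R + 3 * Bd + 4" by simp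
  from B0 have B: "(n + 2) * (R + 3 * Bd + 4) \<le> ?B" unfolding j1 .
  have A1: "1 \<le> ?A" using A c0 by linarith
  have B1: "1 \<le> ?B" using B by (metis le_trans less_one not_le_imp_less mult_is_0 zero_neq_numeral add_eq_0_iff_both_eq_0)
  have AB1: "?B \<le> ?A * ?B" using mult_le_mono1[OF A1, of ?B] by simp
  have "?A \<le> ?A * ?B" using mult_le_mono2[OF B1, of ?A] by simp
  hence AB2: "(m + 2) ^ K0 \<le> ?A * ?B" using A by linarith
  note AB = AB1 AB2
  have e1: "(n + 2) * (R + 3 * Bd + 4) = R * n + 2 * R + 3 * (Bd * n) + 6 * Bd + 4 * n + 8" by (simp add: algebra_simps)
  have e2: "R + Bd * (m + 1) + n = R + 3 * (Bd * n) + 2 * Bd + n" by (simp add: m_def algebra_simps)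
  have "R + Bd * (m + 1) + n < ?B" using B e1 e2 by linarith
  hence g1: "R + Bd * (m + 1) + n < ?A * ?B" using AB1 by linarith
  have "3 * n + 2 < ?B" "4 \<le> ?B" using B e1 by linarith+
  hence g2: "3 * n + 2 < ?A * ?B" "4 \<le> ?A * ?B" using AB1 by linarith+
  have g3: "log_base + 2 * Bd < R" by (simp add: R_def)
  have g4: "R + Bd * (m + 1) \<le> ?A * ?B" using g1 by linarith
  show ?thesis unfolding u1_ctx_def sim_params_def cap using g1 g2 g3 g4 AB2 c0 by (simp add: m_def)
qed

lemma tractableE:
  assumes "tractable L"
  obtains Pb Pu Pe K Bd where "\<And>w. \<exists>M0 r.
    run Pb (length w # map code w) ((length w + 2) ^ K) (Bd * (length w + 1)) (Bd * (length w + 1)) (\<lambda>_. 0) = Some (M0, r) \<and>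
    upds_enum_ok L Pu Pe ((length w + 2) ^ K) (Bd * (length w + 1)) Bd (length w) M0 w"
proof -
  from assms obtain Pb Pu Pe K Bd where T: "\<forall>w us. valid_upds (length w) us \<longrightarrow>
     (case run Pb (length w # map code w) ((length w + 2) ^ K) (Bd * (length w + 1)) (Bd * (length w + 1)) (\<lambda>_. 0) of
        None \<Rightarrow> False
      | Some (M0, _) \<Rightarrow>
          (case upds Pu ((length w + 2) ^ K) (Bd * (length w + 1)) Bd M0 us of
             None \<Rightarrow> False
           | Some M \<Rightarrow> enum_ok L Pe ((length w + 2) ^ K) (Bd * (length w + 1)) Bd (apply_upds w us) M))"
    unfolding tractable_def Let_def by blast
  have "\<exists>M0 r.
    run Pb (length w # map code w) ((length w + 2) ^ K) (Bd * (length w + 1)) (Bd * (length w + 1)) (\<lambda>_. 0) = Some (M0, r) \<and>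
    upds_enum_ok L Pu Pe ((length w + 2) ^ K) (Bd * (length w + 1)) Bd (length w) M0 w" for w
  proof -
    have "valid_upds (length w) []" by (simp add: valid_upds_def)
    from T[rule_format, OF this] obtain M0 r where
      build: "run Pb (length w # map code w) ((length w + 2) ^ K) (Bd * (length w + 1)) (Bd * (length w + 1)) (\<lambda>_. 0) = Some (M0, r)"
      by (auto split: option.splits)
    have "\<exists>M. upds Pu ((length w + 2) ^ K) (Bd * (length w + 1)) Bd M0 us = Some M \<and>
        enum_ok L Pe ((length w + 2) ^ K) (Bd * (length w + 1)) Bd (apply_upds w us) M"
      if "valid_upds (length w) us" for us
      using T[rule_format, OF that] build by (auto split: option.splits)
    with build show ?thesis
      unfolding upds_enum_ok_def by blast
  qed
  then show thesis by (rule that)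
qed

lemma u1_structure_from_L3_structure:
  fixes n K0 Bd :: nat
  defines "m \<equiv> 3 * n + 1" and "R \<equiv> log_base + 2 * Bd + 1"
  assumes build: "run Pb (m # map code (set_word n {})) ((m + 2) ^ K0) (Bd * (m + 1)) (Bd * (m + 1)) (\<lambda>_. 0) = Some (M0ds, r)"
    and T: "upds_enum_ok L3 Pu Pe ((m + 2) ^ K0) (Bd * (m + 1)) Bd m M0ds (set_word n {})"
    and ops: "\<forall>(op, i)\<in>set ops. op \<in> {1, 2, 3, 4} \<and> 1 \<le> i \<and> i \<le> n"
  shows "\<exists>fuel M0 Os t W.
    run (u1_init_prog R Bd Pb) [n] ((n + 2) ^ (2 * K0 + R + 3 * Bd + 4)) ((n + 2) ^ (2 * K0 + R + 3 * Bd + 4)) fuel (\<lambda>_. 0) =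
      Some (M0, Os, t, W) \<and>
    u1_run (u1_prog R Pu Pe) ((n + 2) ^ (2 * K0 + R + 3 * Bd + 4)) (5 * (block_size * Bd) + 9 * Bd + 40) M0 {} ops"
proof -
  define capo where "capo = (m + 2) ^ K0"
  define amax where "amax = Bd * (m + 1)"
  define cap where "cap = (n + 2) ^ (2 * K0 + R + 3 * Bd + 4)"
  have oc: "u1_ctx R amax cap capo Bd m (R + amax) n" and "0 < capo"
    using u1_ctx_bounds[of Bd n K0] unfolding R_def m_def capo_def amax_def cap_def by auto
  have rn: "run Pb (m # map code (set_word n {})) capo amax (Bd * (m + 1)) (\<lambda>_. 0) = Some (M0ds, r)"
    using build unfolding capo_def amax_def .
  from run_u1_init[OF oc amax_def \<open>0 < capo\<close> rn] obtain fuel M0 Os t W where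
    init: "run (u1_init_prog R Bd Pb) [n] cap cap fuel (\<lambda>_. 0) = Some (M0, Os, t, W)" "u1_regs R cap m (R + amax) M0"
      "relocated R amax M0ds M0" "\<forall>a. M0ds a < capo" "\<forall>j. M0 (R + amax + j) = 0"
    by blast
  have "u1_inv Pu R Bd n capo amax cap m (R + amax) M0ds {} M0"
    unfolding u1_inv_def using init(2-5)
    by (intro conjI exI[of _ "[]"] exI[of _ M0ds]) (auto simp: apply_upds_def valid_upds_def)
  from u1_run_correct[OF oc T[folded capo_def amax_def] order_refl this ops] init(1) show ?thesis
    unfolding cap_def by blast
qed

lemma tractable_L3_refutes_prefix_U1:
  assumes "tractable L3"
  shows "\<not> prefix_U1_hyp"
proof -
  obtain Pb Pu Pe K0 Bd where T: "\<And>w. \<exists>M0 r.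
    run Pb (length w # map code w) ((length w + 2) ^ K0) (Bd * (length w + 1)) (Bd * (length w + 1)) (\<lambda>_. 0) = Some (M0, r) \<and>
    upds_enum_ok L3 Pu Pe ((length w + 2) ^ K0) (Bd * (length w + 1)) Bd (length w) M0 w"
    by (rule tractableE[OF assms], rule that, assumption)
  define R where "R = log_base + 2 * Bd + 1"
  define K where "K = 2 * K0 + R + 3 * Bd + 4"
  define Cst where "Cst = 5 * (block_size * Bd) + 9 * Bd + 40"
  have U: "\<exists>fuel M0 Os t W. run (u1_init_prog R Bd Pb) [n] ((n + 2) ^ K) ((n + 2) ^ K) fuel (\<lambda>_. 0) = Some (M0, Os, t, W) \<and>
      u1_run (u1_prog R Pu Pe) ((n + 2) ^ K) Cst M0 {} ops"
    if "\<forall>(op, i)\<in>set ops. op \<in> {1, 2, 3, 4} \<and> 1 \<le> i \<and> i \<le> n" for n ops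
  proof -
    have len: "length (set_word n {}) = 3 * n + 1" by simp
    from T[of "set_word n {}", unfolded len] obtain M0 r where
      "run Pb ((3 * n + 1) # map code (set_word n {})) ((3 * n + 1 + 2) ^ K0) (Bd * (3 * n + 1 + 1))
         (Bd * (3 * n + 1 + 1)) (\<lambda>_. 0) = Some (M0, r)"
      "upds_enum_ok L3 Pu Pe ((3 * n + 1 + 2) ^ K0) (Bd * (3 * n + 1 + 1)) Bd (3 * n + 1) M0 (set_word n {})"
      by blast
    from u1_structure_from_L3_structure[OF this that] show ?thesis
      unfolding K_def Cst_def R_def .
  qed
  have "\<forall>n ops. (\<forall>(op, i)\<in>set ops. op \<in> {1, 2, 3, 4} \<and> 1 \<le> i \<and> i \<le> n) \<longrightarrow>
      (\<exists>fuel M0 Os t W. run (u1_init_prog R Bd Pb) [n] ((n + 2) ^ K) ((n + 2) ^ K) fuel (\<lambda>_. 0) = Some (M0, Os, t, W) \<and>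
         u1_run (u1_prog R Pu Pe) ((n + 2) ^ K) Cst M0 {} ops)"
    by (intro allI impI) (rule U)
  then show ?thesis
    unfolding prefix_U1_hyp_def by blast
qed

theorem claim7p4:
  shows "ZG L3 \<and> \<not> semi_ext_ZG L3 \<and> (prefix_U1_hyp \<longrightarrow> \<not> tractable L3)"
  using ZG_L3 not_semi_ext_ZG_L3 tractable_L3_refutes_prefix_U1 by blast

end
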